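(* Let $\mathcal{X}$ be a finite state space, let $Q$ be the generator of an irreducible continuous-time Markov chain on $\mathcal{X}$ (the proposal chain), and let the target distribution $\pi$ be the stationary distribution of the chain $Q$. Let $M_1=M_1(Q,\pi)$ and $M_2=M_2(Q,\pi)$ be the two Metropolis-Hastings generators with target $\pi$, and let $\bar{Q}=(Q+Q^* )/2$. Then: (1) (Hitting times) For $\lambda>0$ and $A\subseteq\mathcal{X}$, $$\mathbb{E}_{\pi}(e^{-\lambda \tau_A(M_1)}) \leq \mathbb{E}_{\pi}(e^{-\lambda \tau_A(\bar{Q})}) \leq \min\big\{\mathbb{E}_{\pi}(e^{-\lambda \tau_A(Q)}),\ \mathbb{E}_{\pi}(e^{-\lambda \tau_A(M_2)})\big\}.$$ In particular, for any $A\subseteq\mathcal{X}$, $$\mathbb{E}_{\pi}(\tau_A(M_1)) \geq \mathbb{E}_{\pi}(\tau_A(\bar{Q})) \geq \max\big\{\mathbb{E}_{\pi}(\tau_A(Q)),\ \mathbb{E}_{\pi}(\tau_A(M_2))\big\}.$$ Furthermore, $$t_{av}(M_1,\pi) \geq t_{av}(\bar{Q},\pi)\geq \max\big\{t_{av}(Q,\pi),\ t_{av}(M_2,\pi)\big\}.$$ (2) (Total variation mixing time) There exist positive constants $C_\pi^{(1)},C_\pi^{(2)}$ that depend on $\pi$ such that $$t_{mix}(M_2,\pi,1/4) \leq C_{\pi}^{(1)}t_{mix}(\bar{Q},\pi,1/4) \leq C_{\pi}^{(2)}t_{mix}(M_1,\pi,1/4).$$ That is, $t_{mix}(M_2,\pi,1/4)\lesssim_\pi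 t_{mix}(\bar{Q},\pi,1/4)\lesssim_\pi t_{mix}(M_1,\pi,1/4)$. (3) (Spectral gap) $\lambda_2(M_1,\pi)\leq\lambda_2(\bar{Q},\pi)\leq\lambda_2(M_2,\pi)$. That is, $t_{rel}(M_1,\pi)\geq t_{rel}(\bar{Q},\pi)\geq t_{rel}(M_2,\pi)$. (4) (Asymptotic variance) For $h\in\ell^2_0(\pi)=\{h:\pi(h)=0\}$, $$\sigma^2(h,M_1,\pi) \geq \sigma^2(h,\bar{Q},\pi) \geq \max\big\{\sigma^2(h,Q,\pi),\ \sigma^2(h,M_2,\pi)\big\}.$$ (5) (Large deviations) For any probability distribution $\nu$ on $\mathcal{X}$, $$I(M_1,\nu)\leq I(\bar{Q},\nu)\leq \min\big\{I(Q,\nu),\ I(M_2,\nu)\big\}.$$ (6) (Capacity) For any disjoint $A,B\subseteq\mathcal{X}$, $$\mathrm{cap}(A,B,M_1,\pi) \leq \mathrm{cap}(A,B,\bar{Q},\pi) \leq \min\big\{\mathrm{cap}(A,B,Q,\pi),\ \mathrm{cap}(A,B,M_2,\pi)\big\}.$$ In particular, if we take $A=\{x\}$ and $B=\{y\}$, then $$t_{com}^{x,y}(M_1) \geq t_{com}^{x,y}(\bar{Q}) \geq \max\big\{t_{com}^{x,y}(Q),\ t_{com}^{x,y}(M_2)\big\}.$$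
   Context: A Markov generator on $\mathcal{X}$ is a real matrix with nonnegative off-diagonal entries and zero row sums. The time-reversal of $Q$ with respect to $\pi$ is $Q^*(x,y)=\frac{\pi(y)Q(y,x)}{\pi(x)}$. Metropolis-Hastings generators: for $x\neq y$, $$M_1(x,y)=\min\Big\{Q(x,y),\tfrac{\pi(y)}{\pi(x)}Q(y,x)\Big\},\qquad M_2(x,y)=\max\Big\{Q(x,y),\tfrac{\pi(y)}{\pi(x)}Q(y,x)\Big\},$$ and $M_i(x,x)=-\sum_{z\neq x}M_i(x,z)$ for $i=1,2$. All of $M_1,\bar{Q},M_2,Q$ have $\pi$ as a stationary distribution. Below, $G$ is a generator on $\mathcal{X}$ with stationary distribution $\pi$, $X=(X_t)_{t\geq0}$ is the associated continuous-time chain and $(P_t)_{t\geq0}$ its transition semigroup. $\mathbb{P}_x,\mathbb{E}_x$ refer to the chain started at $x$, and $\mathbb{E}_\pi$ to initial law $\pi$. Write $\pi(f)=\sum_x f(x)\pi(x)$ and $\langle f,g\rangle_\pi=\sum_x f(x)g(x)\pi(x)$ for real functions on $\mathcal{X}$. The convention $\inf\emptyset=\infty$ is used. - Hitting time: $\tau_A(G)=\inf\{t\geq0: X_t\in A\}$; first return time: $\tau_A^+(G)=\inf\{t>0: X_t\in A\text{ and there exists } s\in(0,t)\text{ such that }X_s\neq X_0\}$; $\tau_y=\tau_{\{y\}}$, $\tau_y^+=\tau_{\{y\}}^+$. - Commute time: $t_{com}^{x,y}(G)=\mathbb{E}_x(\tau_y(G))+\mathbb{E}_y(\tau_x(G))$.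 - Average hitting time: $t_{av}(G,\pi)=\sum_{x,y}\mathbb{E}_x(\tau_y(G))\pi(x)\pi(y)$. - Mixing time: $t_{mix}(G,\pi,\epsilon)=\inf\{t\geq0:\sup_x\|P_t(x,\cdot)-\pi\|_{TV}<\epsilon\}$, with $\|\nu-\pi\|_{TV}=\frac12\sum_x|\nu(x)-\pi(x)|$. The notation $a\lesssim_\pi b$ means $a\leq C_\pi b$ for a positive constant $C_\pi$ depending on $\pi$. - Spectral gap: $\lambda_2(G,\pi)=\inf\{\langle -Gf,f\rangle_\pi:\pi(f)=0,\ \pi(f^2)=1\}$; relaxation time $t_{rel}(G,\pi)=1/\lambda_2(G,\pi)$. - Asymptotic variance: for $f$ with $\pi(f)=0$, $\sigma^2(f,G,\pi)=-2\langle f,g\rangle_\pi$, where $g$ solves the Poisson equation $Gg=f$. - Large deviation rate function: $I(G,\nu)=\sup_{u>0}\big(-\sum_{x}\nu(x)\frac{Gu(x)}{u(x)}\big)$, the supremum being over strictly positive functions $u$ on $\mathcal{X}$. - Capacity: for disjoint $A,B\subseteq\mathcal{X}$, $\mathrm{cap}(A,B,G,\pi)=\sum_{x\in A}\pi(x)\,\mathbb{P}_x(\tau_A^+(G)>\tau_B^+(G))$.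
   Formalization: In (6) the capacity weights each escape probability by the exit rate -G(x,x), and t_com(M_1) ≥ t_com(Q̄) is asserted only when M_1 is irreducible (for x, y in different classes of M_1 it is trivial, the left side being infinite); as written both claims have counterexamples. *)

theory Defs
  imports "HOL-Probability.Probability"
begin

definition markov_generator :: "('a::finite \<Rightarrow> 'a \<Rightarrow> real) \<Rightarrow> bool" where
  "markov_generator G \<longleftrightarrow>
     (\<forall>x y. x \<noteq> y \<longrightarrow> 0 \<le> G x y) \<and> (\<forall>x. (\<Sum>y\<in>UNIV. G x y) = 0)"

definition irreducible_generator :: "('a::finite \<Rightarrow> 'a \<Rightarrow> real) \<Rightarrow> bool" where
  "irreducible_generator G \<longleftrightarrow> (\<forall>x y. (x, y) \<in> {(u, v). u \<noteq> v \<and> 0 < G u v}\<^sup>*)"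

definition prob_vector :: "('a::finite \<Rightarrow> real) \<Rightarrow> bool" where
  "prob_vector \<nu> \<longleftrightarrow> (\<forall>x. 0 \<le> \<nu> x) \<and> (\<Sum>x\<in>UNIV. \<nu> x) = 1"

definition stationary :: "('a::finite \<Rightarrow> 'a \<Rightarrow> real) \<Rightarrow> ('a \<Rightarrow> real) \<Rightarrow> bool" where
  "stationary G \<pi> \<longleftrightarrow> prob_vector \<pi> \<and> (\<forall>y. (\<Sum>x\<in>UNIV. \<pi> x * G x y) = 0)"

definition time_reversal :: "('a::finite \<Rightarrow> 'a \<Rightarrow> real) \<Rightarrow> ('a \<Rightarrow> real) \<Rightarrow> 'a \<Rightarrow> 'a \<Rightarrow> real" where
  "time_reversal Q \<pi> x y = \<pi> y * Q y x / \<pi> x"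

definition additive_rev :: "('a::finite \<Rightarrow> 'a \<Rightarrow> real) \<Rightarrow> ('a \<Rightarrow> real) \<Rightarrow> 'a \<Rightarrow> 'a \<Rightarrow> real" where
  "additive_rev Q \<pi> x y = (Q x y + time_reversal Q \<pi> x y) / 2"

definition MH1 :: "('a::finite \<Rightarrow> 'a \<Rightarrow> real) \<Rightarrow> ('a \<Rightarrow> real) \<Rightarrow> 'a \<Rightarrow> 'a \<Rightarrow> real" where
  "MH1 Q \<pi> x y =
     (if x \<noteq> y then min (Q x y) (\<pi> y / \<pi> x * Q y x)
      else - (\<Sum>z\<in>UNIV - {x}. min (Q x z) (\<pi> z / \<pi> x * Q z x)))"

definition MH2 :: "('a::finite \<Rightarrow> 'a \<Rightarrow> real) \<Rightarrow> ('a \<Rightarrow> real) \<Rightarrow> 'a \<Rightarrow> 'a \<Rightarrow> real" where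
  "MH2 Q \<pi> x y =
     (if x \<noteq> y then max (Q x y) (\<pi> y / \<pi> x * Q y x)
      else - (\<Sum>z\<in>UNIV - {x}. max (Q x z) (\<pi> z / \<pi> x * Q z x)))"

text \<open>
  The continuous-time chain is built from its jump chain and holding times. Step \<open>n\<close> is driven by
  an independent pair \<open>(e, \<phi>)\<close>: a standard exponential clock \<open>e\<close>, and a table \<open>\<phi>\<close> whose entry
  \<open>\<phi> x\<close> is distributed as the jump from \<open>x\<close>. A chain sitting in \<open>x\<close> waits for the time
  \<open>e / (- G x x)\<close> and then moves to \<open>\<phi> x\<close>. In an absorbing state (\<open>G x x = 0\<close>) the quotient is
  infinite in \<open>ennreal\<close> for \<open>e > 0\<close>, so the chain stays there forever.
\<close>

definition jump_pmf :: "('a::finite \<Rightarrow> 'a \<Rightarrow> real) \<Rightarrow> 'a \<Rightarrow> 'a pmf" where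
  "jump_pmf G x =
     (if G x x = 0 then return_pmf x
      else embed_pmf (\<lambda>y. if y = x then 0 else G x y / (- G x x)))"

lemma pmf_jump_pmf:
  assumes "markov_generator G" "G x x \<noteq> 0"
  shows "pmf (jump_pmf G x) y = (if y = x then 0 else G x y / (- G x x))"
proof -
  have nn: "\<And>y. y \<noteq> x \<Longrightarrow> 0 \<le> G x y" and s0: "(\<Sum>y\<in>UNIV. G x y) = 0"
    using assms by (auto simp: markov_generator_def)
  have split: "(\<Sum>y\<in>UNIV - {x}. G x y) = - G x x"
    using s0 by (simp add: sum_diff1)
  have "0 \<le> (\<Sum>y\<in>UNIV - {x}. G x y)"
    by (rule sum_nonneg) (use nn in auto)
  hence neg: "G x x < 0"
    using split assms(2) by simp
  let ?f = "\<lambda>y. if y = x then 0 else G x y / (- G x x)"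
  have f0: "\<And>y. 0 \<le> ?f y"
    using nn neg by (simp add: divide_nonneg_neg)
  have "(\<Sum>y\<in>UNIV. ?f y) = (\<Sum>y\<in>UNIV - {x}. G x y / (- G x x))"
    by (rule sum.mono_neutral_cong_right) auto
  also have "\<dots> = (\<Sum>y\<in>UNIV - {x}. G x y) / (- G x x)"
    by (rule sum_divide_distrib[symmetric])
  also have "\<dots> = 1"
    using split neg by simp
  finally have s1: "(\<Sum>y\<in>UNIV. ?f y) = 1" .
  have "(\<integral>\<^sup>+ y. ennreal (?f y) \<partial>count_space UNIV) = (\<Sum>y\<in>UNIV. ennreal (?f y))"
    by (simp add: nn_integral_count_space_finite)
  also have "\<dots> = ennreal (\<Sum>y\<in>UNIV. ?f y)"
    by (rule sum_ennreal) (use f0 in auto)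
  finally have "(\<integral>\<^sup>+ y. ennreal (?f y) \<partial>count_space UNIV) = 1"
    using s1 by simp
  hence "pmf (embed_pmf ?f) y = ?f y"
    using f0 by (intro pmf_embed_pmf) auto
  thus ?thesis
    using assms(2) by (simp add: jump_pmf_def)
qed

type_synonym 'a step = "real \<times> ('a \<Rightarrow> 'a)"

definition step_law :: "('a::finite \<Rightarrow> 'a \<Rightarrow> real) \<Rightarrow> 'a step measure" where
  "step_law G =
     density lborel (\<lambda>t. ennreal (exponential_density 1 t))
       \<Otimes>\<^sub>M measure_pmf (Pi_pmf UNIV undefined (jump_pmf G))"

definition chain_space :: "('a::finite \<Rightarrow> 'a \<Rightarrow> real) \<Rightarrow> 'a step stream measure" where
  "chain_space G = stream_space (step_law G)"

lemma prob_space_chain_space: "prob_space (chain_space G)"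
proof -
  have "prob_space (density lborel (\<lambda>t. ennreal (exponential_density 1 t)))"
    by (rule prob_space_exponential_density) simp
  hence "prob_space (step_law G)"
    unfolding step_law_def
    by (intro prob_space_pair measure_pmf.prob_space_axioms)
  thus ?thesis
    unfolding chain_space_def by (rule prob_space.prob_space_stream_space)
qed

primrec jump_chain :: "'a \<Rightarrow> 'a step stream \<Rightarrow> nat \<Rightarrow> 'a" where
  "jump_chain x \<omega> 0 = x"
| "jump_chain x \<omega> (Suc n) = snd (\<omega> !! n) (jump_chain x \<omega> n)"

definition jump_time ::
    "('a::finite \<Rightarrow> 'a \<Rightarrow> real) \<Rightarrow> 'a \<Rightarrow> 'a step stream \<Rightarrow> nat \<Rightarrow> ennreal" where
  "jump_time G x \<omega> n =
     (\<Sum>k<n. ennreal (fst (\<omega> !! k)) / ennreal (- G (jump_chain x \<omega> k) (jump_chain x \<omega> k)))"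

text \<open>\<open>chain G x \<omega> t\<close> is \<open>X_t\<close> for the chain with generator \<open>G\<close> started at \<open>x\<close>.
  Explosion (no \<open>n\<close> with \<open>t < jump_time G x \<omega> (Suc n)\<close>) is a null event.\<close>

definition chain ::
    "('a::finite \<Rightarrow> 'a \<Rightarrow> real) \<Rightarrow> 'a \<Rightarrow> 'a step stream \<Rightarrow> real \<Rightarrow> 'a" where
  "chain G x \<omega> t = jump_chain x \<omega> (LEAST n. ennreal t < jump_time G x \<omega> (Suc n))"

text \<open>In \<open>ennreal\<close> the infimum of the empty set is \<open>\<infinity>\<close>.\<close>

definition hitting_time :: "'a set \<Rightarrow> (real \<Rightarrow> 'a) \<Rightarrow> ennreal" where
  "hitting_time A X = (INF t\<in>{t. 0 \<le> t \<and> X t \<in> A}. ennreal t)"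

definition return_time :: "'a set \<Rightarrow> (real \<Rightarrow> 'a) \<Rightarrow> ennreal" where
  "return_time A X =
     (INF t\<in>{t. 0 < t \<and> X t \<in> A \<and> (\<exists>s. 0 < s \<and> s < t \<and> X s \<noteq> X 0)}. ennreal t)"

text \<open>\<open>exp_neg_mult l t\<close> is \<open>e\<close> to the power \<open>- l * t\<close>, with value \<open>0\<close> at \<open>t = \<infinity>\<close>
  (used for \<open>l > 0\<close>).\<close>

definition exp_neg_mult :: "real \<Rightarrow> ennreal \<Rightarrow> real" where
  "exp_neg_mult l t = (if t = \<infinity> then 0 else exp (- l * enn2real t))"

definition laplace_hitting ::
    "real \<Rightarrow> 'a set \<Rightarrow> ('a::finite \<Rightarrow> 'a \<Rightarrow> real) \<Rightarrow> ('a \<Rightarrow> real) \<Rightarrow> real" where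
  "laplace_hitting l A G \<mu> =
     (\<Sum>x\<in>UNIV. \<mu> x * (\<integral>\<omega>. exp_neg_mult l (hitting_time A (chain G x \<omega>)) \<partial>chain_space G))"

definition expected_hitting :: "'a set \<Rightarrow> ('a::finite \<Rightarrow> 'a \<Rightarrow> real) \<Rightarrow> 'a \<Rightarrow> ennreal" where
  "expected_hitting A G x = (\<integral>\<^sup>+ \<omega>. hitting_time A (chain G x \<omega>) \<partial>chain_space G)"

definition mean_hitting ::
    "'a set \<Rightarrow> ('a::finite \<Rightarrow> 'a \<Rightarrow> real) \<Rightarrow> ('a \<Rightarrow> real) \<Rightarrow> ennreal" where
  "mean_hitting A G \<mu> = (\<Sum>x\<in>UNIV. ennreal (\<mu> x) * expected_hitting A G x)"

definition t_av :: "('a::finite \<Rightarrow> 'a \<Rightarrow> real) \<Rightarrow> ('a \<Rightarrow> real) \<Rightarrow> ennreal" where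
  "t_av G \<pi> =
     (\<Sum>x\<in>UNIV. \<Sum>y\<in>UNIV. expected_hitting {y} G x * ennreal (\<pi> x) * ennreal (\<pi> y))"

definition t_com :: "'a \<Rightarrow> 'a \<Rightarrow> ('a::finite \<Rightarrow> 'a \<Rightarrow> real) \<Rightarrow> ennreal" where
  "t_com x y G = expected_hitting {y} G x + expected_hitting {x} G y"

definition transition :: "('a::finite \<Rightarrow> 'a \<Rightarrow> real) \<Rightarrow> real \<Rightarrow> 'a \<Rightarrow> 'a \<Rightarrow> real" where
  "transition G t x y = \<P>(\<omega> in chain_space G. chain G x \<omega> t = y)"

definition tv_dist :: "('a::finite \<Rightarrow> real) \<Rightarrow> ('a \<Rightarrow> real) \<Rightarrow> real" where
  "tv_dist \<mu> \<nu> = (\<Sum>x\<in>UNIV. \<bar>\<mu> x - \<nu> x\<bar>) / 2"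

definition t_mix :: "('a::finite \<Rightarrow> 'a \<Rightarrow> real) \<Rightarrow> ('a \<Rightarrow> real) \<Rightarrow> real \<Rightarrow> ennreal" where
  "t_mix G \<pi> \<epsilon> =
     (INF t\<in>{t. 0 \<le> t \<and> (SUP x. tv_dist (transition G t x) \<pi>) < \<epsilon>}. ennreal t)"

definition gen_app :: "('a::finite \<Rightarrow> 'a \<Rightarrow> real) \<Rightarrow> ('a \<Rightarrow> real) \<Rightarrow> 'a \<Rightarrow> real" where
  "gen_app G f x = (\<Sum>y\<in>UNIV. G x y * f y)"

definition mean :: "('a::finite \<Rightarrow> real) \<Rightarrow> ('a \<Rightarrow> real) \<Rightarrow> real" where
  "mean \<pi> f = (\<Sum>x\<in>UNIV. f x * \<pi> x)"

definition pi_inner :: "('a::finite \<Rightarrow> real) \<Rightarrow> ('a \<Rightarrow> real) \<Rightarrow> ('a \<Rightarrow> real) \<Rightarrow> real" where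
  "pi_inner \<pi> f g = (\<Sum>x\<in>UNIV. f x * g x * \<pi> x)"

text \<open>On a one-point space the infimum is over the empty set: the gap is \<open>\<infinity>\<close> and the relaxation
  time is \<open>0\<close>. A vanishing gap gives relaxation time \<open>1 / 0 = \<infinity>\<close>, which is division in \<open>ereal\<close>.\<close>

definition spectral_gap :: "('a::finite \<Rightarrow> 'a \<Rightarrow> real) \<Rightarrow> ('a \<Rightarrow> real) \<Rightarrow> ereal" where
  "spectral_gap G \<pi> =
     (INF f\<in>{f. mean \<pi> f = 0 \<and> mean \<pi> (\<lambda>x. (f x)\<^sup>2) = 1}.
        ereal (pi_inner \<pi> (\<lambda>x. - gen_app G f x) f))"

definition t_rel :: "('a::finite \<Rightarrow> 'a \<Rightarrow> real) \<Rightarrow> ('a \<Rightarrow> real) \<Rightarrow> ereal" where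
  "t_rel G \<pi> = 1 / spectral_gap G \<pi>"

text \<open>
  If \<open>\<pi>\<close> is positive and stationary for \<open>G\<close>, and \<open>f\<close> has mean zero, the value does not depend on
  the solution of the Poisson equation that is chosen. The equation is always solvable when \<open>G\<close> is
  irreducible. The first Metropolis-Hastings generator need not be irreducible; where its Poisson
  equation has no solution, the variance grows linearly in time and the asymptotic variance is \<open>\<infinity>\<close>.
\<close>

definition asymptotic_variance ::
    "('a::finite \<Rightarrow> real) \<Rightarrow> ('a \<Rightarrow> 'a \<Rightarrow> real) \<Rightarrow> ('a \<Rightarrow> real) \<Rightarrow> ereal" where
  "asymptotic_variance f G \<pi> =
     (if \<exists>g. gen_app G g = f then ereal (- 2 * pi_inner \<pi> f (SOME g. gen_app G g = f)) else \<infinity>)"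

definition rate_function :: "('a::finite \<Rightarrow> 'a \<Rightarrow> real) \<Rightarrow> ('a \<Rightarrow> real) \<Rightarrow> ereal" where
  "rate_function G \<nu> =
     (SUP u\<in>{u. \<forall>x. 0 < u x}. ereal (- (\<Sum>x\<in>UNIV. \<nu> x * (gen_app G u x / u x))))"

text \<open>
  This is the continuous-time capacity, in which the escape probability from \<open>x\<close> is weighted by
  \<open>\<pi> x\<close> times the exit rate \<open>- G x x\<close>. The exit rate is what makes the capacity equal to the
  Dirichlet form of the equilibrium potential and makes \<open>1 / capacity\<close> the commute time. Without
  it the quantity is invariant under time changes and is not monotone in the off-diagonal rates.
\<close>

definition capacity ::
    "'a set \<Rightarrow> 'a set \<Rightarrow> ('a::finite \<Rightarrow> 'a \<Rightarrow> real) \<Rightarrow> ('a \<Rightarrow> real) \<Rightarrow> real" where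
  "capacity A B G \<pi> =
     (\<Sum>x\<in>A. \<pi> x * (- G x x) *
        \<P>(\<omega> in chain_space G. return_time A (chain G x \<omega>) > return_time B (chain G x \<omega>)))"

end

theory Submission
  imports Defs
begin

text \<open>
  For a generator \<open>G\<close> with stationary law \<open>\<pi>\<close> the Dirichlet form
  \<open>E_G(f) = \<langle>- G f, f\<rangle> = 1/2 \<Sum> \<pi>(x) G(x,y) (f(x) - f(y))\<^sup>2\<close> depends only on the symmetrised flow
  \<open>\<pi>(x) G(x,y) + \<pi>(y) G(y,x)\<close>. Hence the proposal chain and its additive reversibilisation have the same
  Dirichlet form, and since \<open>min a b \<le> (a + b) / 2 \<le> max a b\<close>, the forms of the first
  Metropolis-Hastings generator, of the reversibilisation and of the second Metropolis-Hastings
  generator increase in this order. All the inequalities therefore have one source: \<open>K\<close> is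
  reversible, \<open>L\<close> is irreducible with the same stationary law, and \<open>E_K \<le> E_L\<close>
  (locale \<open>form_comparison\<close>).

  For reversible \<open>K\<close> each functional is the extremum of a variational problem for \<open>E_K\<close>. The function
  that represents the same functional for \<open>L\<close> is an admissible competitor, and its energy for \<open>L\<close> is
  exactly the functional of \<open>L\<close>, even when \<open>L\<close> is not reversible. In detail:

  \<^item> \<open>u(x) = E_x exp (- l \<tau>_A)\<close> equals \<open>1\<close> on \<open>A\<close>, satisfies \<open>G u = l u\<close> elsewhere, and
    \<open>l \<pi>(u) = E_G(u) + l \<langle>u, u\<rangle>\<close>; for \<open>K\<close> this is the minimum over functions equal to \<open>1\<close> on \<open>A\<close>.
    Mean hitting times are the limits of \<open>(1 - \<pi>(u)) / l\<close> as \<open>l\<close> tends to \<open>0\<close>.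
  \<^item> \<open>h(x) = P_x(\<tau>_B < \<tau>_A)\<close> is \<open>0\<close> on \<open>A\<close>, \<open>1\<close> on \<open>B\<close> and harmonic elsewhere, and the capacity is
    \<open>E_G(h)\<close>; for \<open>K\<close> this is the minimum for the given boundary values.
  \<^item> If \<open>G g = h\<close>, then half the asymptotic variance is \<open>- \<langle>h, g\<rangle> = E_G(g)\<close>; the comparison is
    \<open>E_K(g_K - g_L) \<ge> 0\<close>. The commute time between \<open>x\<close> and \<open>y\<close> is the special case
    \<open>h = 1_y / \<pi>(y) - 1_x / \<pi>(x)\<close>.
  \<^item> With \<open>f = sqrt (\<nu> / \<pi>)\<close>, the rate function of \<open>K\<close> is at most \<open>E_K(f)\<close> by the inequality of
    arithmetic and geometric means, and that of \<open>L\<close> is at least \<open>E_L(f)\<close> by testing with \<open>f + \<epsilon>\<close>.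
  \<^item> The spectral gap \<open>c\<close> of \<open>K\<close> is attained at an eigenfunction, on which the semigroup acts as
    \<open>exp (- c t)\<close>; so \<open>K\<close> can be mixed at time \<open>t\<close> only if \<open>exp (- c t) < 1/2\<close>. Conversely the gap of
    \<open>L\<close> is at least \<open>c\<close>, the variance decays at rate \<open>2 c\<close>, and \<open>L\<close> is mixed at a multiple of \<open>t\<close>
    that is determined by \<open>\<pi>\<close>.

  The probabilistic input is an analysis of the first jump. Cutting off the first step of the sample
  shifts the path by its holding time, which yields the equations for \<open>u\<close> and \<open>h\<close>
  (\<open>discounted_time_equation\<close>, \<open>hits_first_harmonic\<close>, \<open>escape_prob_eq\<close>) and, through a renewal
  equation in time, the backward equation for the transition probabilities
  (\<open>transition_has_derivative\<close>).
\<close>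

section \<open>Sample paths\<close>

text \<open>
  This form of right continuity is what lets the uncountable infima in hitting and return times be
  taken over rational times, which makes these times measurable.
\<close>

definition right_constant :: "(real \<Rightarrow> 'a) \<Rightarrow> bool" where
  "right_constant X \<longleftrightarrow> (\<forall>t\<ge>0. \<exists>d>0. \<forall>s. t \<le> s \<and> s < t + d \<longrightarrow> X s = X t)"

lemma right_constantE:
  assumes "right_constant X" "0 \<le> t"
  obtains d where "d > 0" "\<forall>s. t \<le> s \<and> s < t + d \<longrightarrow> X s = X t"
  using assms unfolding right_constant_def by blast

lemma INF_eq_INF_Rats:
  fixes U :: "real set"
  assumes open_right: "\<And>t. t \<in> U \<Longrightarrow> \<exists>d>0. {t..<t + d} \<subseteq> U"
  shows "(INF t\<in>U. ennreal t) = (INF t\<in>U \<inter> \<rat>. ennreal t)"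
proof (rule antisym)
  show "(INF t\<in>U. ennreal t) \<le> (INF t\<in>U \<inter> \<rat>. ennreal t)"
    by (rule INF_superset_mono) auto
  show "(INF t\<in>U \<inter> \<rat>. ennreal t) \<le> (INF t\<in>U. ennreal t)"
  proof (rule INF_greatest)
    fix t assume "t \<in> U"
    then obtain d where d: "d > 0" "{t..<t + d} \<subseteq> U"
      using open_right by blast
    show "(INF t\<in>U \<inter> \<rat>. ennreal t) \<le> ennreal t"
    proof (rule ennreal_le_epsilon)
      fix e :: real assume e: "0 < e"
      obtain q where q: "q \<in> \<rat>" "t < q" "q < t + min d e"
        using Rats_dense_in_real[of t "t + min d e"] d(1) e by auto
      have "q \<in> U"
        using d(2) q by (auto simp: subset_iff)
      with q(1) have "(INF t\<in>U \<inter> \<rat>. ennreal t) \<le> ennreal q"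
        by (intro INF_lower) auto
      also have "\<dots> \<le> ennreal (t + e)"
        using q by (intro ennreal_leI) auto
      also have "\<dots> \<le> ennreal t + ennreal e"
        using e by (cases "0 \<le> t") (auto simp: ennreal_plus ennreal_neg intro!: ennreal_leI)
      finally show "(INF t\<in>U \<inter> \<rat>. ennreal t) \<le> ennreal t + ennreal e" .
    qed
  qed
qed

lemma hitting_time_eq_INF_Rats:
  assumes "right_constant X"
  shows "hitting_time A X = (INF t\<in>{t \<in> \<rat>. 0 \<le> t \<and> X t \<in> A}. ennreal t)"
proof -
  have "hitting_time A X = (INF t\<in>{t. 0 \<le> t \<and> X t \<in> A} \<inter> \<rat>. ennreal t)"
    unfolding hitting_time_def
  proof (rule INF_eq_INF_Rats)
    fix t assume t: "t \<in> {t. 0 \<le> t \<and> X t \<in> A}"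
    then have "0 \<le> t" by simp
    with assms obtain d where d: "d > 0" "\<forall>s. t \<le> s \<and> s < t + d \<longrightarrow> X s = X t"
      by (rule right_constantE)
    have "r \<in> {t. 0 \<le> t \<and> X t \<in> A}" if r: "r \<in> {t..<t + d}" for r
    proof -
      have "X r = X t" using d(2)[rule_format, of r] r by simp
      with t r show ?thesis by simp
    qed
    with d(1) have "0 < d \<and> {t..<t + d} \<subseteq> {t. 0 \<le> t \<and> X t \<in> A}"
      by blast
    then show "\<exists>d>0. {t..<t + d} \<subseteq> {t. 0 \<le> t \<and> X t \<in> A}" ..
  qed
  also have "{t. 0 \<le> t \<and> X t \<in> A} \<inter> \<rat> = {t \<in> \<rat>. 0 \<le> t \<and> X t \<in> A}"
    by auto
  finally show ?thesis .
qed

lemma return_time_eq_INF_Rats: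
  assumes "right_constant X"
  shows "return_time A X =
    (INF t\<in>{t \<in> \<rat>. 0 < t \<and> X t \<in> A \<and> (\<exists>s\<in>\<rat>. 0 < s \<and> s < t \<and> X s \<noteq> X 0)}. ennreal t)"
proof -
  let ?U = "{t. 0 < t \<and> X t \<in> A \<and> (\<exists>s. 0 < s \<and> s < t \<and> X s \<noteq> X 0)}"
  have "return_time A X = (INF t\<in>?U \<inter> \<rat>. ennreal t)"
    unfolding return_time_def
  proof (rule INF_eq_INF_Rats)
    fix t assume t: "t \<in> ?U"
    then have "0 \<le> t" by simp
    with assms obtain d where d: "d > 0" "\<forall>s. t \<le> s \<and> s < t + d \<longrightarrow> X s = X t"
      by (rule right_constantE)
    have "r \<in> ?U" if r: "r \<in> {t..<t + d}" for r
    proof -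
      have "X r = X t" using d(2)[rule_format, of r] r by simp
      moreover obtain s where "0 < s" "s < t" "X s \<noteq> X 0" using t by auto
      moreover from this have "s < r" using r by auto
      ultimately show ?thesis using t r by auto
    qed
    then have "0 < d \<and> {t..<t + d} \<subseteq> ?U"
      using d by blast
    then show "\<exists>d>0. {t..<t + d} \<subseteq> ?U" ..
  qed
  also have "?U \<inter> \<rat> =
      {t \<in> \<rat>. 0 < t \<and> X t \<in> A \<and> (\<exists>s\<in>\<rat>. 0 < s \<and> s < t \<and> X s \<noteq> X 0)}"
  proof (safe)
    fix t s :: real assume ts: "0 < s" "s < t" "X s \<noteq> X 0"
    from ts(1) have "0 \<le> s" by simp
    with assms obtain d where d: "d > 0" "\<forall>r. s \<le> r \<and> r < s + d \<longrightarrow> X r = X s"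
      by (rule right_constantE)
    obtain q where "q \<in> \<rat>" "s < q" "q < min (s + d) t"
      using Rats_dense_in_real[of s "min (s + d) t"] d(1) ts by auto
    moreover from this have "X q = X s" using d(2)[rule_format, of q] by simp
    ultimately have "q \<in> \<rat> \<and> 0 < q \<and> q < t \<and> X q \<noteq> X 0" using ts by simp
    then show "\<exists>s\<in>\<rat>. 0 < s \<and> s < t \<and> X s \<noteq> X 0" by blast
  qed auto
  finally show ?thesis .
qed

lemma mono_jump_time: "mono (jump_time G x \<omega>)"
  unfolding jump_time_def by (intro monoI sum_mono2) auto

lemma right_constant_chain: "right_constant (chain G x \<omega>)"
  unfolding right_constant_def
proof (intro allI impI)
  fix t :: real assume t: "0 \<le> t"
  let ?T = "jump_time G x \<omega>"
  show "\<exists>d>0. \<forall>s. t \<le> s \<and> s < t + d \<longrightarrow> chain G x \<omega> s = chain G x \<omega> t"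
  proof (cases "\<exists>n. ennreal t < ?T (Suc n)")
    case True
    define N where "N = (LEAST n. ennreal t < ?T (Suc n))"
    have N: "ennreal t < ?T (Suc N)"
      unfolding N_def using True by (rule LeastI_ex)
    have before: "?T (Suc m) \<le> ennreal t" if "m < N" for m
      using not_less_Least[OF that[unfolded N_def]] by simp
    obtain d where d: "d > 0" "\<And>s. t \<le> s \<Longrightarrow> s < t + d \<Longrightarrow> ennreal s < ?T (Suc N)"
    proof (cases "?T (Suc N)")
      case (real r)
      show ?thesis
        by (rule that[of "r - t"]) (use N real t in \<open>auto simp: ennreal_less_iff\<close>)
    next
      case top
      show ?thesis
        by (rule that[of 1]) (auto simp: top)
    qed
    have "chain G x \<omega> s = chain G x \<omega> t" if s: "t \<le> s" "s < t + d" for s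
    proof -
      have "(LEAST n. ennreal s < ?T (Suc n)) = N"
      proof (rule Least_equality)
        show "ennreal s < ?T (Suc N)" by (rule d(2)) fact+
        fix m assume m: "ennreal s < ?T (Suc m)"
        show "N \<le> m"
        proof (rule ccontr)
          assume "\<not> N \<le> m"
          then have "?T (Suc m) \<le> ennreal t" by (intro before) auto
          also have "\<dots> \<le> ennreal s" using s by (intro ennreal_leI)
          finally show False using m by simp
        qed
      qed
      then show ?thesis
        by (simp add: chain_def N_def)
    qed
    then show ?thesis using d(1) by blast
  next
    case False
    then have never: "\<not> ennreal s < ?T (Suc n)" if "t \<le> s" for s n
      using ennreal_leI[OF that] by (meson le_less_trans)
    then have "chain G x \<omega> s = chain G x \<omega> t" if "t \<le> s" for s
      using that False by (simp add: chain_def)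
    then show ?thesis using zero_less_one[where 'a = real] by blast
  qed
qed

lemma jump_chain_SCons:
  "jump_chain x (s ## \<omega>) (Suc n) = jump_chain (snd s x) \<omega> n"
  by (induction n) auto

lemma jump_time_SCons:
  "jump_time G x (s ## \<omega>) (Suc n) =
     ennreal (fst s) / ennreal (- G x x) + jump_time G (snd s x) \<omega> n"
proof -
  have "jump_time G x (s ## \<omega>) (Suc n) =
      (\<Sum>k<Suc n. ennreal (fst ((s ## \<omega>) !! k)) /
         ennreal (- G (jump_chain x (s ## \<omega>) k) (jump_chain x (s ## \<omega>) k)))"
    by (simp add: jump_time_def)
  also have "\<dots> = ennreal (fst s) / ennreal (- G x x) +
      (\<Sum>k<n. ennreal (fst ((s ## \<omega>) !! Suc k)) /
         ennreal (- G (jump_chain x (s ## \<omega>) (Suc k)) (jump_chain x (s ## \<omega>) (Suc k))))"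
    by (subst sum.lessThan_Suc_shift) simp
  also have "\<dots> = ennreal (fst s) / ennreal (- G x x) + jump_time G (snd s x) \<omega> n"
    by (simp add: jump_time_def jump_chain_SCons del: jump_chain.simps(2))
  finally show ?thesis .
qed

definition explosion_time :: "('a::finite \<Rightarrow> 'a \<Rightarrow> real) \<Rightarrow> 'a \<Rightarrow> 'a step stream \<Rightarrow> ennreal" where
  "explosion_time G x \<omega> = (SUP n. jump_time G x \<omega> n)"

text \<open>
  \<open>jump_time_SCons\<close> in the limit. Since it holds for every sample, it is available before explosion
  is known to be a null event.
\<close>

lemma explosion_time_SCons:
  "explosion_time G x (s ## \<omega>) =
     ennreal (fst s) / ennreal (- G x x) + explosion_time G (snd s x) \<omega>"
proof -
  have "explosion_time G x (s ## \<omega>) = (SUP n. jump_time G x (s ## \<omega>) (Suc n))"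
    unfolding explosion_time_def
  proof (rule SUP_eq)
    fix n
    have "jump_time G x (s ## \<omega>) n \<le> jump_time G x (s ## \<omega>) (Suc n)"
      by (rule monoD[OF mono_jump_time]) simp
    then show "\<exists>m\<in>UNIV. jump_time G x (s ## \<omega>) n \<le> jump_time G x (s ## \<omega>) (Suc m)"
      by blast
  qed blast
  also have "\<dots> = ennreal (fst s) / ennreal (- G x x) + explosion_time G (snd s x) \<omega>"
    by (simp add: jump_time_SCons explosion_time_def ennreal_SUP_add_right)
  finally show ?thesis .
qed

lemma chain_0:
  assumes "0 < jump_time G x \<omega> 1"
  shows "chain G x \<omega> 0 = x"
proof -
  have "(LEAST n. ennreal 0 < jump_time G x \<omega> (Suc n)) = 0"
    by (rule Least_equality) (use assms in auto)
  then show ?thesis by (simp add: chain_def)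
qed

lemma chain_SCons_before:
  assumes "ennreal t < ennreal (fst s) / ennreal (- G x x)"
  shows "chain G x (s ## \<omega>) t = x"
proof -
  have "(LEAST n. ennreal t < jump_time G x (s ## \<omega>) (Suc n)) = 0"
    by (rule Least_equality) (use assms in \<open>auto simp: jump_time_SCons jump_time_def\<close>)
  then show ?thesis by (simp add: chain_def)
qed

text \<open>
  Without explosion the index of the current jump is a genuine least element, and dropping the first
  step lowers it by one. On an exploding sample the \<open>LEAST\<close> in \<open>chain\<close> is an arbitrary constant that
  does not shift along.
\<close>

lemma chain_SCons_after:
  assumes r: "ennreal (fst s) / ennreal (- G x x) = ennreal r" "0 \<le> r" "r \<le> t"
    and no_explosion: "explosion_time G (snd s x) \<omega> = \<infinity>"
  shows "chain G x (s ## \<omega>) t = chain G (snd s x) \<omega> (t - r)"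
proof -
  let ?T = "jump_time G (snd s x) \<omega>"
  have shift: "ennreal t < ennreal r + c \<longleftrightarrow> ennreal (t - r) < c" for c
    using r(2,3) by (cases c) (auto simp: ennreal_less_iff simp flip: ennreal_plus)
  have T: "ennreal t < jump_time G x (s ## \<omega>) (Suc n) \<longleftrightarrow> ennreal (t - r) < ?T n" for n
    by (simp add: jump_time_SCons r(1) shift)
  have "ennreal (t - r) < explosion_time G (snd s x) \<omega>"
    using no_explosion by simp
  then obtain n where n: "ennreal (t - r) < ?T n"
    by (auto simp: explosion_time_def less_SUP_iff)
  have "(LEAST n. ennreal (t - r) < ?T n) = Suc (LEAST n. ennreal (t - r) < ?T (Suc n))"
    by (rule Least_Suc[of _ n]) (use n in \<open>auto simp: jump_time_def\<close>)
  then show ?thesis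
    by (simp add: chain_def T jump_chain_SCons del: jump_chain.simps(2))
qed

lemma INF_add_shift:
  fixes r :: real
  assumes "0 \<le> r" "\<And>t. t \<in> U \<Longrightarrow> 0 \<le> t"
  shows "(INF t\<in>(\<lambda>t. r + t) ` U. ennreal t) = ennreal r + (INF t\<in>U. ennreal t)"
proof (cases "U = {}")
  case False
  have "(INF t\<in>(\<lambda>t. r + t) ` U. ennreal t) = (INF t\<in>U. ennreal r + ennreal t)"
    using assms by (auto simp: image_image ennreal_plus intro!: INF_cong)
  also have "\<dots> = ennreal r + (INF t\<in>U. ennreal t)" (is "?L = _")
  proof (rule antisym)
    have "?L - ennreal r \<le> (INF t\<in>U. ennreal t)"
    proof (rule INF_greatest)
      fix t assume "t \<in> U"
      then have "?L \<le> ennreal r + ennreal t" by (rule INF_lower)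
      then show "?L - ennreal r \<le> ennreal t" by (simp add: ennreal_minus_le_iff)
    qed
    then show "?L \<le> ennreal r + (INF t\<in>U. ennreal t)"
      by (simp add: ennreal_minus_le_iff)
    show "ennreal r + (INF t\<in>U. ennreal t) \<le> ?L"
      by (intro INF_greatest add_left_mono INF_lower)
  qed
  finally show ?thesis .
qed simp

lemma hitting_time_SCons:
  assumes "x \<notin> A" "explosion_time G (snd s x) \<omega> = \<infinity>"
  shows "hitting_time A (chain G x (s ## \<omega>)) =
     ennreal (fst s) / ennreal (- G x x) + hitting_time A (chain G (snd s x) \<omega>)"
proof (cases "ennreal (fst s) / ennreal (- G x x)")
  case (real r)
  let ?X = "chain G x (s ## \<omega>)" and ?Y = "chain G (snd s x) \<omega>"
  have "{t. 0 \<le> t \<and> ?X t \<in> A} = (\<lambda>t. r + t) ` {t. 0 \<le> t \<and> ?Y t \<in> A}"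
  proof (intro set_eqI iffI)
    fix t assume t: "t \<in> {t. 0 \<le> t \<and> ?X t \<in> A}"
    have "r \<le> t"
    proof (rule ccontr)
      assume "\<not> r \<le> t"
      then have "?X t = x"
        using real t by (intro chain_SCons_before) (auto simp: ennreal_less_iff)
      with t assms show False by auto
    qed
    then show "t \<in> (\<lambda>t. r + t) ` {t. 0 \<le> t \<and> ?Y t \<in> A}"
      using t chain_SCons_after[OF real(2,1) _ assms(2), of t]
      by (intro image_eqI[of _ _ "t - r"]) auto
  next
    fix t assume "t \<in> (\<lambda>t. r + t) ` {t. 0 \<le> t \<and> ?Y t \<in> A}"
    then show "t \<in> {t. 0 \<le> t \<and> ?X t \<in> A}"
      using chain_SCons_after[OF real(2,1) _ assms(2), of t] real(1) by auto
  qed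
  then have "hitting_time A ?X = (INF t\<in>(\<lambda>t. r + t) ` {t. 0 \<le> t \<and> ?Y t \<in> A}. ennreal t)"
    unfolding hitting_time_def by simp
  also have "\<dots> = ennreal r + (INF t\<in>{t. 0 \<le> t \<and> ?Y t \<in> A}. ennreal t)"
    using real by (intro INF_add_shift) auto
  finally show ?thesis
    by (simp add: hitting_time_def real(2))
next
  case top
  have "{t. 0 \<le> t \<and> chain G x (s ## \<omega>) t \<in> A} = {}"
    using assms(1) chain_SCons_before[of _ s G x \<omega>] by (auto simp: top)
  then show ?thesis
    by (simp add: hitting_time_def top)
qed

text \<open>
  Return times range over strictly positive times. A path that starts in \<open>A\<close> stays there for a while,
  so leaving out the time \<open>0\<close> does not change the infimum.
\<close>

lemma hitting_time_eq_INF_pos: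
  assumes "right_constant X"
  shows "hitting_time A X = (INF t\<in>{t. 0 < t \<and> X t \<in> A}. ennreal t)" (is "_ = ?R")
proof (rule antisym)
  show "hitting_time A X \<le> ?R"
    unfolding hitting_time_def by (rule INF_superset_mono) auto
  show "?R \<le> hitting_time A X"
    unfolding hitting_time_def
  proof (rule INF_greatest)
    fix t assume t: "t \<in> {t. 0 \<le> t \<and> X t \<in> A}"
    then have "0 \<le> t" by simp
    with assms obtain d where d: "d > 0" "\<forall>s. t \<le> s \<and> s < t + d \<longrightarrow> X s = X t"
      by (rule right_constantE)
    show "?R \<le> ennreal t"
    proof (rule ennreal_le_epsilon)
      fix e :: real assume e: "0 < e"
      have "X (t + min (d / 2) e) = X t"
        using d e by (intro d(2)[rule_format]) (auto simp: min_def)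
      then have "?R \<le> ennreal (t + min (d / 2) e)"
        using t d(1) e by (intro INF_lower) (simp add: add_nonneg_pos)
      also have "\<dots> \<le> ennreal t + ennreal e"
        using t e by (auto simp flip: ennreal_plus intro!: ennreal_leI)
      finally show "?R \<le> ennreal t + ennreal e" .
    qed
  qed
qed

text \<open>
  Before the first jump the path has not left its starting point. From the jump on it has, so every
  later visit counts, and the rest of the excursion is a hitting time of the shifted path.
\<close>

lemma return_time_SCons:
  assumes r: "ennreal (fst s) / ennreal (- G x x) = ennreal r" "0 < r"
    and "snd s x \<noteq> x" and no_explosion: "explosion_time G (snd s x) \<omega> = \<infinity>"
    and start: "0 < jump_time G (snd s x) \<omega> 1"
  shows "return_time A (chain G x (s ## \<omega>)) = ennreal r + hitting_time A (chain G (snd s x) \<omega>)"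
proof -
  let ?X = "chain G x (s ## \<omega>)" and ?Y = "chain G (snd s x) \<omega>"
  have before: "?X t = x" if "0 \<le> t" "t < r" for t
    using that r by (intro chain_SCons_before) (auto simp: ennreal_less_iff)
  have after: "?X t = ?Y (t - r)" if "r \<le> t" for t
    using r that no_explosion by (intro chain_SCons_after) auto
  have X0: "?X 0 = x" and Xr: "?X r \<noteq> x"
    using before[of 0] after[of r] chain_0[OF start] assms(3) r(2) by auto
  have "{t. 0 < t \<and> ?X t \<in> A \<and> (\<exists>s. 0 < s \<and> s < t \<and> ?X s \<noteq> ?X 0)}
      = (\<lambda>t. r + t) ` {t. 0 < t \<and> ?Y t \<in> A}"
  proof (intro set_eqI iffI)
    fix t assume t: "t \<in> {t. 0 < t \<and> ?X t \<in> A \<and> (\<exists>s. 0 < s \<and> s < t \<and> ?X s \<noteq> ?X 0)}"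
    then obtain s' where s': "0 < s'" "s' < t" "?X s' \<noteq> x" using X0 by auto
    have "r \<le> s'" by (rule ccontr) (use before[of s'] s' in auto)
    with s' have "r < t" by simp
    then show "t \<in> (\<lambda>t. r + t) ` {t. 0 < t \<and> ?Y t \<in> A}"
      using t after[of t] by (intro image_eqI[of _ _ "t - r"]) auto
  next
    fix t assume "t \<in> (\<lambda>t. r + t) ` {t. 0 < t \<and> ?Y t \<in> A}"
    then show "t \<in> {t. 0 < t \<and> ?X t \<in> A \<and> (\<exists>s. 0 < s \<and> s < t \<and> ?X s \<noteq> ?X 0)}"
      using after[of t] X0 Xr r(2) by (auto intro!: exI[of _ r])
  qed
  then have "return_time A ?X = (INF t\<in>(\<lambda>t. r + t) ` {t. 0 < t \<and> ?Y t \<in> A}. ennreal t)"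
    unfolding return_time_def by simp
  also have "\<dots> = ennreal r + (INF t\<in>{t. 0 < t \<and> ?Y t \<in> A}. ennreal t)"
    using r by (intro INF_add_shift) auto
  also have "(INF t\<in>{t. 0 < t \<and> ?Y t \<in> A}. ennreal t) = hitting_time A ?Y"
    by (rule hitting_time_eq_INF_pos[OF right_constant_chain, symmetric])
  finally show ?thesis .
qed

section \<open>Measurability and the first jump\<close>

abbreviation exp_clock :: "real measure" where
  "exp_clock \<equiv> density lborel (\<lambda>t. ennreal (exponential_density 1 t))"

lemma prob_space_exp_clock: "prob_space exp_clock"
  by (rule prob_space_exponential_density) simp

lemma AE_exp_clock_pos: "AE e in exp_clock. 0 < e"
proof -
  have "AE e in lborel. 0 < ennreal (exponential_density 1 e) \<longrightarrow> 0 < e"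
    using AE_lborel_singleton[of 0]
    by eventually_elim (auto simp: exponential_density_def)
  then show ?thesis
    by (subst AE_density) (auto simp: exponential_density_def)
qed

lemma nn_integral_exp_clock_exp:
  assumes "0 \<le> c"
  shows "(\<integral>\<^sup>+ e. ennreal (exp (- c * e)) \<partial>exp_clock) = ennreal (1 / (1 + c))"
proof -
  interpret E: prob_space "density lborel (exponential_density (1 + c))"
    by (rule prob_space_exponential_density) (use assms in auto)
  have total: "(\<integral>\<^sup>+ e. ennreal (exponential_density (1 + c) e) \<partial>lborel) = 1"
    using E.emeasure_space_1 by (subst (asm) emeasure_density) (auto simp: indicator_def)
  have "(\<integral>\<^sup>+ e. ennreal (exp (- c * e)) \<partial>exp_clock) =
      (\<integral>\<^sup>+ e. ennreal (1 / (1 + c)) * ennreal (exponential_density (1 + c) e) \<partial>lborel)"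
  proof (subst nn_integral_density, measurable, rule nn_integral_cong)
    fix e :: real
    have "exp (- e) * exp (- c * e) = exp (- (1 + c) * e)"
      using assms by (simp add: mult_exp_exp algebra_simps)
    then show "ennreal (exponential_density 1 e) * ennreal (exp (- c * e)) =
        ennreal (1 / (1 + c)) * ennreal (exponential_density (1 + c) e)"
      using assms
      by (simp add: exponential_density_def flip: ennreal_mult) (simp add: algebra_simps)
  qed
  also have "\<dots> = ennreal (1 / (1 + c))"
    using assms by (subst nn_integral_cmult) (auto simp: total)
  finally show ?thesis .
qed

lemma sets_step_law[measurable_cong]:
  "sets (step_law G) = sets (borel \<Otimes>\<^sub>M count_space UNIV)"
  unfolding step_law_def by (intro sets_pair_measure_cong) auto

lemma sets_chain_space[measurable_cong]:
  "sets (chain_space G) = sets (stream_space (borel \<Otimes>\<^sub>M count_space UNIV))"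
  unfolding chain_space_def by (intro sets_stream_space_cong sets_step_law)

lemma measurable_jump_chain[measurable]:
  fixes x :: "'a::finite"
  shows "(\<lambda>\<omega>. jump_chain x \<omega> n) \<in>
     measurable (stream_space (borel \<Otimes>\<^sub>M count_space UNIV)) (count_space UNIV)"
proof (induction n)
  case (Suc n)
  note [measurable] = Suc
  have [measurable]: "(\<lambda>\<omega>. snd (\<omega> !! n)) \<in>
      measurable (stream_space (borel \<Otimes>\<^sub>M count_space UNIV)) (count_space UNIV)"
    by measurable
  have "(\<lambda>\<omega>. (\<lambda>f \<omega>. f (jump_chain x \<omega> n)) (snd (\<omega> !! n)) \<omega>) \<in>
      measurable (stream_space (borel \<Otimes>\<^sub>M count_space UNIV)) (count_space UNIV)"
    by (rule measurable_compose_countable[where g = "\<lambda>\<omega>. snd (\<omega> !! n)"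
          and f = "\<lambda>f \<omega>. f (jump_chain x \<omega> n)"]) measurable
  then show ?case by simp
qed simp

lemma measurable_jump_time[measurable]:
  "(\<lambda>\<omega>. jump_time G x \<omega> n) \<in>
     borel_measurable (stream_space (borel \<Otimes>\<^sub>M count_space UNIV))"
proof -
  have [measurable]: "(\<lambda>\<omega>. ennreal (- G (jump_chain x \<omega> k) (jump_chain x \<omega> k))) \<in>
      borel_measurable (stream_space (borel \<Otimes>\<^sub>M count_space UNIV))" for k
    by (rule measurable_compose[OF measurable_jump_chain]) simp
  show ?thesis unfolding jump_time_def by measurable
qed

lemma measurable_explosion_time[measurable]:
  "explosion_time G x \<in> borel_measurable (stream_space (borel \<Otimes>\<^sub>M count_space UNIV))"
  unfolding explosion_time_def[abs_def] by measurable

lemma measurable_chain_pair: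
  "(\<lambda>(t, \<omega>). chain G x \<omega> t) \<in>
     measurable (borel \<Otimes>\<^sub>M stream_space (borel \<Otimes>\<^sub>M count_space UNIV)) (count_space UNIV)"
proof -
  have "(\<lambda>z. (\<lambda>n z. jump_chain x (snd z) n)
           (LEAST n. ennreal (fst z) < jump_time G x (snd z) (Suc n)) z) \<in>
     measurable (borel \<Otimes>\<^sub>M stream_space (borel \<Otimes>\<^sub>M count_space UNIV)) (count_space UNIV)"
    by (rule measurable_compose_countable) measurable
  then show ?thesis by (simp add: chain_def case_prod_beta')
qed

lemma measurable_chain[measurable]:
  "(\<lambda>\<omega>. chain G x \<omega> t) \<in>
     measurable (stream_space (borel \<Otimes>\<^sub>M count_space UNIV)) (count_space UNIV)"
  using measurable_compose[OF measurable_Pair1'[of t] measurable_chain_pair[of G x]] by simp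

text \<open>
  An infimum over a random index set becomes a countable infimum over a fixed index set when the
  missing indices are given the value \<open>\<infinity>\<close>.
\<close>

lemma measurable_INF_event:
  assumes "countable I" and [measurable]: "\<And>t. t \<in> I \<Longrightarrow> Measurable.pred M (P t)"
  shows "(\<lambda>\<omega>. INF t\<in>{t \<in> I. P t \<omega>}. ennreal t) \<in> borel_measurable M"
proof -
  have "(INF t\<in>{t \<in> I. P t \<omega>}. ennreal t) = (INF t\<in>I. if P t \<omega> then ennreal t else \<infinity>)" for \<omega>
  proof (rule antisym)
    show "(INF t\<in>{t \<in> I. P t \<omega>}. ennreal t) \<le> (INF t\<in>I. if P t \<omega> then ennreal t else \<infinity>)"
    proof (rule INF_greatest)
      fix t assume "t \<in> I"
      then show "(INF t\<in>{t \<in> I. P t \<omega>}. ennreal t) \<le> (if P t \<omega> then ennreal t else \<infinity>)"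
        by (cases "P t \<omega>") (simp_all add: INF_lower)
    qed
    show "(INF t\<in>I. if P t \<omega> then ennreal t else \<infinity>) \<le> (INF t\<in>{t \<in> I. P t \<omega>}. ennreal t)"
    proof (rule INF_greatest)
      fix t assume "t \<in> {t \<in> I. P t \<omega>}"
      then show "(INF t\<in>I. if P t \<omega> then ennreal t else \<infinity>) \<le> ennreal t"
        by (intro INF_lower2[of t]) simp_all
    qed
  qed
  moreover have "(\<lambda>\<omega>. INF t\<in>I. if P t \<omega> then ennreal t else \<infinity>) \<in> borel_measurable M"
    using assms(1) by (rule borel_measurable_INF) measurable
  ultimately show ?thesis by simp
qed

lemma measurable_hitting_time[measurable]:
  "(\<lambda>\<omega>. hitting_time A (chain G x \<omega>)) \<in>
     borel_measurable (stream_space (borel \<Otimes>\<^sub>M count_space UNIV))"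
  unfolding hitting_time_eq_INF_Rats[OF right_constant_chain]
  by (rule measurable_INF_event[OF countable_rat]) measurable

lemma measurable_return_time[measurable]:
  "(\<lambda>\<omega>. return_time A (chain G x \<omega>)) \<in>
     borel_measurable (stream_space (borel \<Otimes>\<^sub>M count_space UNIV))"
proof -
  have [measurable]: "Measurable.pred (stream_space (borel \<Otimes>\<^sub>M count_space UNIV))
      (\<lambda>\<omega>. \<exists>s\<in>\<rat>. 0 < s \<and> s < t \<and> chain G x \<omega> s \<noteq> chain G x \<omega> 0)" for t
    unfolding Rats_def bex_simps by measurable
  show ?thesis
    unfolding return_time_eq_INF_Rats[OF right_constant_chain]
    by (rule measurable_INF_event[OF countable_rat]) measurable
qed

text \<open>
  First-jump analysis in its general form: on a sample \<open>R\<close> of full measure the integrand sees the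
  table of jumps only through the entry at the starting point, which is distributed as the jump.
\<close>

lemma nn_integral_first_step:
  assumes f[measurable]: "f \<in> borel_measurable (chain_space G)"
    and ae: "AE \<omega> in chain_space G. R \<omega>"
    and step: "\<And>e \<phi> \<omega>. 0 < e \<Longrightarrow> \<phi> x \<in> set_pmf (jump_pmf G x) \<Longrightarrow> R \<omega> \<Longrightarrow>
      f ((e, \<phi>) ## \<omega>) = H e (\<phi> x) \<omega>"
  shows "(\<integral>\<^sup>+ \<omega>. f \<omega> \<partial>chain_space G) =
    (\<integral>\<^sup>+ e. (\<Sum>y\<in>UNIV. ennreal (pmf (jump_pmf G x) y) * (\<integral>\<^sup>+ \<omega>. H e y \<omega> \<partial>chain_space G)) \<partial>exp_clock)"
proof -
  interpret S: prob_space "step_law G"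
    unfolding step_law_def
    by (intro prob_space_pair measure_pmf.prob_space_axioms prob_space_exp_clock)
  interpret C: prob_space "chain_space G" by (rule prob_space_chain_space)
  let ?J = "measure_pmf (Pi_pmf UNIV undefined (jump_pmf G))"
  have comp: "map_pmf (\<lambda>\<phi>. \<phi> x) (Pi_pmf UNIV undefined (jump_pmf G)) = jump_pmf G x"
    by (subst Pi_pmf_component) auto
  have "set_pmf (map_pmf (\<lambda>\<phi>. \<phi> x) (Pi_pmf UNIV undefined (jump_pmf G))) = set_pmf (jump_pmf G x)"
    by (simp only: comp)
  then have jumps: "AE \<phi> in ?J. \<phi> x \<in> set_pmf (jump_pmf G x)"
    by (auto simp: AE_measure_pmf_iff)
  have [measurable]: "(\<lambda>s. \<integral>\<^sup>+ \<omega>. f (s ## \<omega>) \<partial>chain_space G) \<in> borel_measurable (exp_clock \<Otimes>\<^sub>M ?J)"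
    by measurable
  have "(\<integral>\<^sup>+ \<omega>. f \<omega> \<partial>chain_space G) = (\<integral>\<^sup>+ s. \<integral>\<^sup>+ \<omega>. f (s ## \<omega>) \<partial>chain_space G \<partial>step_law G)"
    using f unfolding chain_space_def by (rule S.nn_integral_stream_space)
  also have "\<dots> = (\<integral>\<^sup>+ e. \<integral>\<^sup>+ \<phi>. \<integral>\<^sup>+ \<omega>. f ((e, \<phi>) ## \<omega>) \<partial>chain_space G \<partial>?J \<partial>exp_clock)"
    unfolding step_law_def by (rule measure_pmf.nn_integral_fst[symmetric]) measurable
  also have "\<dots> = (\<integral>\<^sup>+ e. \<integral>\<^sup>+ \<phi>. \<integral>\<^sup>+ \<omega>. H e (\<phi> x) \<omega> \<partial>chain_space G \<partial>?J \<partial>exp_clock)"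
  proof (rule nn_integral_cong_AE)
    show "AE e in exp_clock.
        (\<integral>\<^sup>+ \<phi>. \<integral>\<^sup>+ \<omega>. f ((e, \<phi>) ## \<omega>) \<partial>chain_space G \<partial>?J) =
        (\<integral>\<^sup>+ \<phi>. \<integral>\<^sup>+ \<omega>. H e (\<phi> x) \<omega> \<partial>chain_space G \<partial>?J)"
      using AE_exp_clock_pos
    proof eventually_elim
      case (elim e)
      show ?case
        by (intro nn_integral_cong_AE eventually_mono[OF jumps] eventually_mono[OF ae] step elim)
    qed
  qed
  also have "\<dots> = (\<integral>\<^sup>+ e. (\<Sum>y\<in>UNIV. ennreal (pmf (jump_pmf G x) y) *
      (\<integral>\<^sup>+ \<omega>. H e y \<omega> \<partial>chain_space G)) \<partial>exp_clock)"
  proof (rule nn_integral_cong)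
    fix e
    let ?h = "\<lambda>y. \<integral>\<^sup>+ \<omega>. H e y \<omega> \<partial>chain_space G"
    have "(\<integral>\<^sup>+ \<phi>. ?h (\<phi> x) \<partial>?J) = (\<integral>\<^sup>+ y. ?h y \<partial>map_pmf (\<lambda>\<phi>. \<phi> x) (Pi_pmf UNIV undefined (jump_pmf G)))"
      by simp
    also have "\<dots> = (\<integral>\<^sup>+ y. ?h y \<partial>jump_pmf G x)"
      by (simp only: comp)
    also have "\<dots> = (\<Sum>y\<in>UNIV. ennreal (pmf (jump_pmf G x) y) * ?h y)"
      by (simp add: nn_integral_measure_pmf nn_integral_count_space_finite)
    finally show "(\<integral>\<^sup>+ \<phi>. ?h (\<phi> x) \<partial>?J) = (\<Sum>y\<in>UNIV. ennreal (pmf (jump_pmf G x) y) * ?h y)" .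
  qed
  finally show ?thesis .
qed

section \<open>Hitting times and their Laplace transforms\<close>

lemma exp_neg_mult_add: "exp_neg_mult l (a + b) = exp_neg_mult l a * exp_neg_mult l b"
  by (cases a; cases b) (auto simp: exp_neg_mult_def exp_add[symmetric] algebra_simps
      simp flip: ennreal_plus)

lemma exp_neg_mult_nonneg: "0 \<le> exp_neg_mult l t"
  by (simp add: exp_neg_mult_def)

lemma exp_neg_mult_le_1: "0 \<le> l \<Longrightarrow> exp_neg_mult l t \<le> 1"
  by (simp add: exp_neg_mult_def)

lemma exp_neg_mult_ennreal: "0 \<le> r \<Longrightarrow> exp_neg_mult l (ennreal r) = exp (- l * r)"
  by (simp add: exp_neg_mult_def)

lemma measurable_exp_neg_mult[measurable]: "exp_neg_mult l \<in> borel_measurable borel"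
  unfolding exp_neg_mult_def[abs_def] by measurable

lemma integrable_exp_neg_mult:
  assumes "0 \<le> l" and [measurable]: "T \<in> borel_measurable (chain_space G)"
  shows "integrable (chain_space G) (\<lambda>\<omega>. exp_neg_mult l (T \<omega>))"
proof -
  interpret C: prob_space "chain_space G" by (rule prob_space_chain_space)
  show ?thesis
    by (rule C.integrable_const_bound[of _ 1])
       (use assms in \<open>auto simp: exp_neg_mult_nonneg exp_neg_mult_le_1\<close>)
qed

lemma nn_integral_exp_neg_mult:
  assumes "0 \<le> l" "T \<in> borel_measurable (chain_space G)"
  shows "(\<integral>\<^sup>+ \<omega>. ennreal (exp_neg_mult l (T \<omega>)) \<partial>chain_space G) =
    ennreal (\<integral> \<omega>. exp_neg_mult l (T \<omega>) \<partial>chain_space G)"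
  by (rule nn_integral_eq_integral[OF integrable_exp_neg_mult[OF assms]])
     (simp add: exp_neg_mult_nonneg)

lemma markov_generator_diag_le_0:
  assumes "markov_generator G"
  shows "G x x \<le> 0"
proof -
  have "G x x + (\<Sum>y\<in>UNIV - {x}. G x y) = 0"
    using assms by (simp add: markov_generator_def sum.remove[symmetric])
  moreover have "0 \<le> (\<Sum>y\<in>UNIV - {x}. G x y)"
    using assms by (intro sum_nonneg) (auto simp: markov_generator_def)
  ultimately show ?thesis by linarith
qed

lemma markov_generator_diag_0:
  assumes "markov_generator G" "G x x = 0"
  shows "G x y = 0"
proof (cases "y = x")
  case False
  have "(\<Sum>y\<in>UNIV - {x}. G x y) = 0"
    using assms by (simp add: markov_generator_def sum_diff1)
  moreover have "\<forall>y\<in>UNIV - {x}. 0 \<le> G x y"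
    using assms by (auto simp: markov_generator_def)
  ultimately show ?thesis
    using False by (subst (asm) sum_nonneg_eq_0_iff) auto
qed (use assms in simp)

lemma jump_pmf_self: "markov_generator G \<Longrightarrow> G x x \<noteq> 0 \<Longrightarrow> pmf (jump_pmf G x) x = 0"
  by (simp add: pmf_jump_pmf)

text \<open>
  This turns averages over the jump chain into the generator. It includes absorbing states, where both
  sides vanish.
\<close>

lemma sum_jump_pmf:
  assumes "markov_generator G"
  shows "- G x x * (\<Sum>y\<in>UNIV. pmf (jump_pmf G x) y * f y) = gen_app G f x - G x x * f x"
proof (cases "G x x = 0")
  case True
  then show ?thesis
    using markov_generator_diag_0[OF assms True] by (simp add: gen_app_def)
next
  case False
  have "- G x x * (\<Sum>y\<in>UNIV. pmf (jump_pmf G x) y * f y) =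
      (\<Sum>y\<in>UNIV. (if y = x then 0 else G x y * f y))"
    unfolding sum_distrib_left
    by (rule sum.cong) (use False in \<open>auto simp: pmf_jump_pmf[OF assms False] field_simps\<close>)
  also have "\<dots> = (\<Sum>y\<in>UNIV - {x}. G x y * f y)"
    by (rule sum.mono_neutral_cong_right) auto
  also have "\<dots> = gen_app G f x - G x x * f x"
    by (simp add: gen_app_def sum_diff1)
  finally show ?thesis .
qed

lemma gen_app_at_max_le_0:
  assumes "markov_generator G" and max: "\<And>y. f y \<le> f x"
  shows "gen_app G f x \<le> 0"
proof -
  have "gen_app G f x = gen_app G f x - f x * (\<Sum>y\<in>UNIV. G x y)"
    using assms(1) by (simp add: markov_generator_def)
  also have "\<dots> = (\<Sum>y\<in>UNIV. G x y * (f y - f x))"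
    by (simp add: gen_app_def sum_distrib_left sum_subtractf algebra_simps)
  also have "\<dots> \<le> 0"
  proof (rule sum_nonpos)
    fix y show "G x y * (f y - f x) \<le> 0"
      using assms by (cases "y = x") (auto simp: markov_generator_def mult_nonneg_nonpos)
  qed
  finally show ?thesis .
qed

text \<open>
  The Laplace transform of the holding time in a state with exit rate \<open>q\<close>. For \<open>q = 0\<close> the quotient
  \<open>e / 0\<close> is infinite, in agreement with the value \<open>0\<close> on the right.
\<close>

lemma nn_integral_holding_time:
  assumes "0 < l" "0 \<le> q"
  shows "(\<integral>\<^sup>+ e. ennreal (exp_neg_mult l (ennreal e / ennreal q)) \<partial>exp_clock) = ennreal (q / (q + l))"
proof (cases "q = 0")
  case True
  have "(\<integral>\<^sup>+ e. ennreal (exp_neg_mult l (ennreal e / ennreal q)) \<partial>exp_clock) = (\<integral>\<^sup>+ e. 0 \<partial>exp_clock)"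
    using AE_exp_clock_pos
    by (intro nn_integral_cong_AE, eventually_elim)
       (simp add: True ennreal_divide_zero exp_neg_mult_def)
  then show ?thesis by (simp add: True)
next
  case False
  with assms have q: "0 < q" by simp
  have "(\<integral>\<^sup>+ e. ennreal (exp_neg_mult l (ennreal e / ennreal q)) \<partial>exp_clock) =
      (\<integral>\<^sup>+ e. ennreal (exp (- (l / q) * e)) \<partial>exp_clock)"
    using AE_exp_clock_pos
    by (intro nn_integral_cong_AE, eventually_elim)
       (use q in \<open>simp add: divide_ennreal exp_neg_mult_ennreal\<close>)
  also have "\<dots> = ennreal (1 / (1 + l / q))"
    using assms q by (intro nn_integral_exp_clock_exp) simp
  also have "1 / (1 + l / q) = q / (q + l)"
    using q assms by (simp add: field_simps)
  finally show ?thesis .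
qed

text \<open>
  A time that consists of the holding time in \<open>x\<close> and the same time for the path restarted after the
  jump has a Laplace transform that factorises, \<open>D x = q / (q + l) * (\<Sum>y. J x y * D y)\<close>. After
  clearing the denominator this is \<open>G D = l D\<close> at \<open>x\<close>. Hitting times, for \<open>x\<close> outside the
  target, and the explosion time have this structure.
\<close>

lemma discounted_time_equation:
  assumes G: "markov_generator G" and l: "0 < l"
    and meas: "\<And>y. T y \<in> borel_measurable (chain_space G)"
    and ae: "AE \<omega> in chain_space G. R \<omega>"
    and step: "\<And>e \<phi> \<omega>. 0 < e \<Longrightarrow> R \<omega> \<Longrightarrow>
      T x ((e, \<phi>) ## \<omega>) = ennreal e / ennreal (- G x x) + T (\<phi> x) \<omega>"
  defines "D \<equiv> \<lambda>y. \<integral>\<omega>. exp_neg_mult l (T y \<omega>) \<partial>chain_space G"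
  shows "gen_app G D x = l * D x"
proof -
  note [measurable] = meas
  let ?q = "- G x x"
  have q: "0 \<le> ?q" using markov_generator_diag_le_0[OF G, of x] by simp
  have D_nonneg: "0 \<le> D y" for y
    unfolding D_def by (rule integral_nonneg_AE) (simp add: exp_neg_mult_nonneg)
  have S_nonneg: "0 \<le> (\<Sum>y\<in>UNIV. pmf (jump_pmf G x) y * D y)"
    by (intro sum_nonneg mult_nonneg_nonneg D_nonneg) simp
  have inner: "(\<integral>\<^sup>+ \<omega>. ennreal (exp_neg_mult l (T y \<omega>)) \<partial>chain_space G) = ennreal (D y)" for y
    unfolding D_def using l meas by (intro nn_integral_exp_neg_mult) auto
  have "ennreal (D x) = (\<integral>\<^sup>+ \<omega>. ennreal (exp_neg_mult l (T x \<omega>)) \<partial>chain_space G)"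
    by (simp add: inner)
  also have "\<dots> = (\<integral>\<^sup>+ e. (\<Sum>y\<in>UNIV. ennreal (pmf (jump_pmf G x) y) *
      (\<integral>\<^sup>+ \<omega>. ennreal (exp_neg_mult l (ennreal e / ennreal ?q)) * ennreal (exp_neg_mult l (T y \<omega>))
         \<partial>chain_space G)) \<partial>exp_clock)"
    by (rule nn_integral_first_step[OF _ ae])
       (auto simp: step exp_neg_mult_add ennreal_mult exp_neg_mult_nonneg)
  also have "\<dots> = (\<integral>\<^sup>+ e. ennreal (exp_neg_mult l (ennreal e / ennreal ?q)) *
      ennreal (\<Sum>y\<in>UNIV. pmf (jump_pmf G x) y * D y) \<partial>exp_clock)"
  proof (rule nn_integral_cong)
    fix e
    let ?a = "ennreal (exp_neg_mult l (ennreal e / ennreal ?q))"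
    have "(\<Sum>y\<in>UNIV. ennreal (pmf (jump_pmf G x) y) *
        (\<integral>\<^sup>+ \<omega>. ?a * ennreal (exp_neg_mult l (T y \<omega>)) \<partial>chain_space G)) =
        (\<Sum>y\<in>UNIV. ?a * ennreal (pmf (jump_pmf G x) y * D y))"
      by (intro sum.cong refl, subst nn_integral_cmult)
         (auto simp: inner D_nonneg ennreal_mult mult.left_commute)
    also have "\<dots> = ?a * ennreal (\<Sum>y\<in>UNIV. pmf (jump_pmf G x) y * D y)"
      by (simp add: D_nonneg sum_ennreal flip: sum_distrib_left)
    finally show "(\<Sum>y\<in>UNIV. ennreal (pmf (jump_pmf G x) y) *
        (\<integral>\<^sup>+ \<omega>. ?a * ennreal (exp_neg_mult l (T y \<omega>)) \<partial>chain_space G)) =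
        ?a * ennreal (\<Sum>y\<in>UNIV. pmf (jump_pmf G x) y * D y)" .
  qed
  also have "\<dots> = ennreal (?q / (?q + l)) * ennreal (\<Sum>y\<in>UNIV. pmf (jump_pmf G x) y * D y)"
    using l q by (subst nn_integral_multc) (auto simp: nn_integral_holding_time)
  also have "\<dots> = ennreal (?q / (?q + l) * (\<Sum>y\<in>UNIV. pmf (jump_pmf G x) y * D y))"
    using l q S_nonneg by (intro ennreal_mult[symmetric] divide_nonneg_nonneg) auto
  finally have eq: "ennreal (D x) = ennreal (?q / (?q + l) * (\<Sum>y\<in>UNIV. pmf (jump_pmf G x) y * D y))" .
  have "0 \<le> ?q / (?q + l) * (\<Sum>y\<in>UNIV. pmf (jump_pmf G x) y * D y)"
    using l q S_nonneg by (intro mult_nonneg_nonneg divide_nonneg_nonneg) auto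
  with eq D_nonneg have "D x = ?q / (?q + l) * (\<Sum>y\<in>UNIV. pmf (jump_pmf G x) y * D y)"
    by (subst (asm) ennreal_inj)
  then have "(?q + l) * D x = ?q * (\<Sum>y\<in>UNIV. pmf (jump_pmf G x) y * D y)"
    using l q by (simp add: field_simps)
  then show ?thesis
    unfolding sum_jump_pmf[OF G] by (simp add: algebra_simps)
qed

text \<open>
  The Laplace transform \<open>D\<close> of the explosion time satisfies \<open>G D = D\<close> everywhere, which by the maximum
  principle forces \<open>D \<le> 0\<close>.
\<close>

lemma AE_no_explosion:
  assumes G: "markov_generator G"
  shows "AE \<omega> in chain_space G. explosion_time G y \<omega> = \<infinity>"
proof -
  interpret C: prob_space "chain_space G" by (rule prob_space_chain_space)
  define D where "D = (\<lambda>y. \<integral>\<omega>. exp_neg_mult 1 (explosion_time G y \<omega>) \<partial>chain_space G)"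
  have eq: "gen_app G D x = D x" for x
    using discounted_time_equation[OF G, of 1 "explosion_time G" "\<lambda>_. True" x]
    by (simp add: explosion_time_SCons D_def)
  have nonneg: "0 \<le> D x" for x
    unfolding D_def by (rule integral_nonneg_AE) (simp add: exp_neg_mult_nonneg)
  obtain m where m: "\<And>x. D x \<le> D m"
  proof -
    have "Max (range D) \<in> range D" by (rule Max_in) auto
    then obtain m where "Max (range D) = D m" by (rule rangeE)
    then show ?thesis by (intro that[of m]) (simp flip: \<open>Max (range D) = D m\<close>)
  qed
  have "D m \<le> 0"
    using gen_app_at_max_le_0[OF G, of D m, OF m] eq[of m] by simp
  then have "D y = 0"
    using m[of y] nonneg[of y] by simp
  then have "AE \<omega> in chain_space G. exp_neg_mult 1 (explosion_time G y \<omega>) = 0"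
    unfolding D_def
    by (subst (asm) integral_nonneg_eq_0_iff_AE)
       (auto intro!: integrable_exp_neg_mult simp: exp_neg_mult_nonneg)
  then show ?thesis
    by eventually_elim (simp add: exp_neg_mult_def split: if_splits)
qed

text \<open>
  The samples on which the path started in any state is defined by its jumps and really starts there;
  almost every sample is of this kind.
\<close>

definition regular_sample :: "('a::finite \<Rightarrow> 'a \<Rightarrow> real) \<Rightarrow> 'a step stream \<Rightarrow> bool" where
  "regular_sample G \<omega> \<longleftrightarrow> (\<forall>y. explosion_time G y \<omega> = \<infinity> \<and> 0 < jump_time G y \<omega> 1)"

lemma AE_regular_sample:
  assumes G: "markov_generator G"
  shows "AE \<omega> in chain_space G. regular_sample G \<omega>"
proof -
  interpret C: prob_space "chain_space G" by (rule prob_space_chain_space)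
  have "AE \<omega> in chain_space G. 0 < jump_time G y \<omega> 1" for y
  proof -
    have "(\<integral>\<^sup>+ \<omega>. indicator {\<omega>. jump_time G y \<omega> 1 = 0} \<omega> \<partial>chain_space G) =
      (\<integral>\<^sup>+ e. (\<Sum>z\<in>UNIV. ennreal (pmf (jump_pmf G y) z) *
         (\<integral>\<^sup>+ \<omega>. 0 \<partial>chain_space G)) \<partial>exp_clock)"
    proof (rule nn_integral_first_step[where R = "\<lambda>_. True"])
      fix e :: real and \<phi> :: "'a \<Rightarrow> 'a" and \<omega> assume "0 < e"
      then have "jump_time G y ((e, \<phi>) ## \<omega>) 1 \<noteq> 0"
        by (simp add: One_nat_def jump_time_SCons jump_time_def ennreal_divide_eq_0_iff del: One_nat_def
              flip: One_nat_def)
      then show "indicator {\<omega>. jump_time G y \<omega> 1 = 0} ((e, \<phi>) ## \<omega>) = (0::ennreal)"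
        by (simp add: indicator_def)
    qed auto
    also have "\<dots> = 0" by simp
    finally have "AE \<omega> in chain_space G. indicator {\<omega>. jump_time G y \<omega> 1 = 0} \<omega> = (0::ennreal)"
      by (subst (asm) nn_integral_0_iff_AE) auto
    then show ?thesis
      by eventually_elim (auto simp: indicator_def zero_less_iff_neq_zero split: if_splits)
  qed
  then have "AE \<omega> in chain_space G. \<forall>y\<in>UNIV. explosion_time G y \<omega> = \<infinity> \<and> 0 < jump_time G y \<omega> 1"
    using AE_no_explosion[OF G] by (intro AE_finite_allI AE_conjI) auto
  then show ?thesis
    by eventually_elim (simp add: regular_sample_def)
qed

lemma chain_0_regular: "regular_sample G \<omega> \<Longrightarrow> chain G x \<omega> 0 = x"
  by (rule chain_0) (simp add: regular_sample_def)

lemma hitting_time_start: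
  assumes "regular_sample G \<omega>" "x \<in> A"
  shows "hitting_time A (chain G x \<omega>) = 0"
proof -
  have "hitting_time A (chain G x \<omega>) \<le> ennreal 0"
    unfolding hitting_time_def using assms by (intro INF_lower) (simp add: chain_0_regular)
  then show ?thesis by simp
qed

definition laplace :: "real \<Rightarrow> 'a set \<Rightarrow> ('a::finite \<Rightarrow> 'a \<Rightarrow> real) \<Rightarrow> 'a \<Rightarrow> real" where
  "laplace l A G x = (\<integral>\<omega>. exp_neg_mult l (hitting_time A (chain G x \<omega>)) \<partial>chain_space G)"

lemma laplace_in:
  assumes "markov_generator G" "x \<in> A"
  shows "laplace l A G x = 1"
proof -
  interpret C: prob_space "chain_space G" by (rule prob_space_chain_space)
  have "laplace l A G x = (\<integral>\<omega>. 1 \<partial>chain_space G)"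
    unfolding laplace_def
  proof (rule integral_cong_AE)
    show "AE \<omega> in chain_space G. exp_neg_mult l (hitting_time A (chain G x \<omega>)) = 1"
      using AE_regular_sample[OF assms(1)]
      by eventually_elim (simp add: hitting_time_start assms(2) exp_neg_mult_def)
  qed auto
  then show ?thesis by (simp add: C.prob_space)
qed

lemma laplace_out:
  assumes G: "markov_generator G" and "x \<notin> A" "0 < l"
  shows "gen_app G (laplace l A G) x = l * laplace l A G x"
  unfolding laplace_def[abs_def]
proof (rule discounted_time_equation[OF G \<open>0 < l\<close> _ AE_regular_sample[OF G]])
  fix e :: real and \<phi> :: "'a \<Rightarrow> 'a" and \<omega> assume "regular_sample G \<omega>"
  then show "hitting_time A (chain G x ((e, \<phi>) ## \<omega>)) =
      ennreal e / ennreal (- G x x) + hitting_time A (chain G (\<phi> x) \<omega>)"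
    using \<open>x \<notin> A\<close> by (subst hitting_time_SCons) (auto simp: regular_sample_def)
qed measurable

text \<open>
  Monotone convergence of \<open>(1 - exp (- l t)) / l\<close> to \<open>t\<close> along \<open>l = 1 / (n + 1)\<close>. It also covers infinite
  expectations, so that hitting times can be compared through their Laplace transforms alone.
\<close>

lemma expected_hitting_LIMSEQ:
  "(\<lambda>n. ennreal (real (Suc n) * (1 - laplace (1 / real (Suc n)) A G x)))
    \<longlonglongrightarrow> expected_hitting A G x"
proof -
  interpret C: prob_space "chain_space G" by (rule prob_space_chain_space)
  define T where "T = (\<lambda>\<omega>. hitting_time A (chain G x \<omega>))"
  have [measurable]: "T \<in> borel_measurable (chain_space G)"
    unfolding T_def by measurable
  let ?f = "\<lambda>n t. ennreal (real (Suc n) * (1 - exp_neg_mult (1 / real (Suc n)) t))"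
  have mono: "?f m t \<le> ?f n t" if "m \<le> n" for m n t
  proof (cases t)
    case (real r)
    let ?a = "real (Suc m)" and ?b = "real (Suc n)"
    have ab: "0 < ?a" "?a \<le> ?b" using that by auto
    \<comment> \<open>Convexity of \<open>exp\<close> between \<open>0\<close> and \<open>- r / a\<close>.\<close>
    have "exp ((1 - ?a / ?b) *\<^sub>R 0 + (?a / ?b) *\<^sub>R (- r / ?a)) \<le>
        (1 - ?a / ?b) * exp 0 + (?a / ?b) * exp (- r / ?a)"
      using ab by (intro convex_onD[OF exp_convex]) auto
    also have "(1 - ?a / ?b) *\<^sub>R 0 + (?a / ?b) *\<^sub>R (- r / ?a) = - r / ?b"
      using ab by (simp add: field_simps del: of_nat_Suc)
    finally have "?b * exp (- r / ?b) \<le> ?b * ((1 - ?a / ?b) * exp 0 + (?a / ?b) * exp (- r / ?a))"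
      using ab by (intro mult_left_mono) auto
    also have "\<dots> = ?b - ?a + ?a * exp (- r / ?a)"
      using ab by (simp add: field_simps del: of_nat_Suc)
    finally have "?a * (1 - exp (- r / ?a)) \<le> ?b * (1 - exp (- r / ?b))"
      by (simp add: algebra_simps del: of_nat_Suc)
    then show ?thesis
      using real by (intro ennreal_leI) (simp add: exp_neg_mult_def del: of_nat_Suc)
  next
    case top
    then show ?thesis using that by (auto simp: exp_neg_mult_def intro!: ennreal_leI)
  qed
  have inc: "incseq (\<lambda>n. ?f n t)" for t
    using mono by (auto simp: incseq_def)
  have lim: "(SUP n. ?f n t) = t" for t
  proof -
    have "(\<lambda>n. ?f n t) \<longlonglongrightarrow> t"
    proof (cases t)
      case (real r)
      let ?c = "\<lambda>n. real (Suc n)"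
      have lower: "r / (1 + r / ?c n) \<le> ?c n * (1 - exp (- r / ?c n))" for n
      proof -
        define x where "x = r / ?c n"
        have x: "0 \<le> x" "r = ?c n * x"
          using real by (simp_all add: x_def)
        have "exp (- x) \<le> 1 / (1 + x)"
          using exp_ge_add_one_self[of x] x
          by (simp add: exp_minus inverse_eq_divide frac_le)
        then have "?c n * (x / (1 + x)) \<le> ?c n * (1 - exp (- x))"
          using x by (intro mult_left_mono) (auto simp: field_simps)
        then show ?thesis by (simp add: x_def[symmetric] x(2)[symmetric] del: of_nat_Suc)
      qed
      have upper: "?c n * (1 - exp (- r / ?c n)) \<le> r" for n
      proof -
        have "?c n * (1 - exp (- r / ?c n)) \<le> ?c n * (r / ?c n)"
          using exp_ge_add_one_self[of "- r / ?c n"] by (intro mult_left_mono) auto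
        then show ?thesis by simp
      qed
      have "(\<lambda>n. r / (1 + r * inverse (?c n))) \<longlonglongrightarrow> r / (1 + r * 0)"
        by (intro tendsto_intros LIMSEQ_inverse_real_of_nat) simp
      then have "(\<lambda>n. r / (1 + r / ?c n)) \<longlonglongrightarrow> r"
        by (simp add: divide_inverse)
      from _ _ this tendsto_const have "(\<lambda>n. ?c n * (1 - exp (- r / ?c n))) \<longlonglongrightarrow> r"
        by (rule tendsto_sandwich) (use lower upper in \<open>auto intro!: always_eventually\<close>)
      then show ?thesis
        using real by (simp add: exp_neg_mult_def tendsto_ennrealI)
    next
      case top
      have "(\<lambda>n. ennreal (real (Suc n))) \<longlonglongrightarrow> top"
        using LIMSEQ_Suc[OF of_nat_tendsto_top_ennreal] by (simp add: ennreal_of_nat_eq_real_of_nat del: of_nat_Suc)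
      then show ?thesis using top by (simp add: exp_neg_mult_def)
    qed
    then show ?thesis
      using LIMSEQ_SUP[OF inc] LIMSEQ_unique by blast
  qed
  have incseq_int: "incseq (\<lambda>n. \<integral>\<^sup>+ \<omega>. ?f n (T \<omega>) \<partial>chain_space G)"
    using mono by (auto simp: incseq_def intro!: nn_integral_mono)
  have "expected_hitting A G x = (\<integral>\<^sup>+ \<omega>. (SUP n. ?f n (T \<omega>)) \<partial>chain_space G)"
    by (simp only: expected_hitting_def lim T_def)
  also have "\<dots> = (SUP n. \<integral>\<^sup>+ \<omega>. ?f n (T \<omega>) \<partial>chain_space G)"
    by (rule nn_integral_monotone_convergence_SUP)
       (use mono in \<open>auto simp: incseq_def le_fun_def simp del: of_nat_Suc\<close>)
  finally have "(\<lambda>n. \<integral>\<^sup>+ \<omega>. ?f n (T \<omega>) \<partial>chain_space G) \<longlonglongrightarrow> expected_hitting A G x"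
    by (simp only: LIMSEQ_SUP[OF incseq_int])
  moreover have "(\<integral>\<^sup>+ \<omega>. ?f n (T \<omega>) \<partial>chain_space G) =
      ennreal (real (Suc n) * (1 - laplace (1 / real (Suc n)) A G x))" for n
  proof -
    have int: "integrable (chain_space G) (\<lambda>\<omega>. exp_neg_mult (1 / real (Suc n)) (T \<omega>))"
      by (rule integrable_exp_neg_mult) auto
    have "(\<integral>\<^sup>+ \<omega>. ?f n (T \<omega>) \<partial>chain_space G) =
        ennreal (\<integral>\<omega>. real (Suc n) * (1 - exp_neg_mult (1 / real (Suc n)) (T \<omega>)) \<partial>chain_space G)"
      using int by (intro nn_integral_eq_integral) (auto simp: exp_neg_mult_le_1)
    also have "(\<integral>\<omega>. real (Suc n) * (1 - exp_neg_mult (1 / real (Suc n)) (T \<omega>)) \<partial>chain_space G) =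
        real (Suc n) * (1 - laplace (1 / real (Suc n)) A G x)"
      using int by (simp add: laplace_def T_def C.prob_space)
    finally show "(\<integral>\<^sup>+ \<omega>. ?f n (T \<omega>) \<partial>chain_space G) =
        ennreal (real (Suc n) * (1 - laplace (1 / real (Suc n)) A G x))" .
  qed
  ultimately show ?thesis by simp
qed

section \<open>Escape probabilities\<close>

definition hits_first :: "('a::finite \<Rightarrow> 'a \<Rightarrow> real) \<Rightarrow> 'a set \<Rightarrow> 'a set \<Rightarrow> 'a \<Rightarrow> real" where
  "hits_first G A B x =
     \<P>(\<omega> in chain_space G. hitting_time B (chain G x \<omega>) < hitting_time A (chain G x \<omega>))"

lemma nn_integral_indicator_prob:
  assumes [measurable]: "Measurable.pred (chain_space G) P"
  shows "(\<integral>\<^sup>+ \<omega>. indicator {\<omega>. P \<omega>} \<omega> \<partial>chain_space G) = ennreal (\<P>(\<omega> in chain_space G. P \<omega>))"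
proof -
  interpret C: prob_space "chain_space G" by (rule prob_space_chain_space)
  have "(\<integral>\<^sup>+ \<omega>. indicator {\<omega>. P \<omega>} \<omega> \<partial>chain_space G) =
      (\<integral>\<^sup>+ \<omega>. indicator {\<omega> \<in> space (chain_space G). P \<omega>} \<omega> \<partial>chain_space G)"
    by (rule nn_integral_cong) (simp add: indicator_def)
  then show ?thesis by (simp add: C.emeasure_eq_measure)
qed

text \<open>The first-jump analysis for events that do not see the holding time.\<close>

lemma prob_first_jump:
  assumes G: "markov_generator G"
    and [measurable]: "Measurable.pred (chain_space G) P"
      "\<And>y. Measurable.pred (chain_space G) (P' y)"
    and ae: "AE \<omega> in chain_space G. R \<omega>"
    and step: "\<And>e \<phi> \<omega>. 0 < e \<Longrightarrow> R \<omega> \<Longrightarrow> \<phi> x \<in> set_pmf (jump_pmf G x) \<Longrightarrow>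
      P ((e, \<phi>) ## \<omega>) \<longleftrightarrow> P' (\<phi> x) \<omega>"
  shows "\<P>(\<omega> in chain_space G. P \<omega>) =
    (\<Sum>y\<in>UNIV. pmf (jump_pmf G x) y * \<P>(\<omega> in chain_space G. P' y \<omega>))"
proof -
  have "ennreal (\<P>(\<omega> in chain_space G. P \<omega>)) =
      (\<integral>\<^sup>+ \<omega>. indicator {\<omega>. P \<omega>} \<omega> \<partial>chain_space G)"
    by (rule nn_integral_indicator_prob[symmetric]) measurable
  also have "\<dots> = (\<integral>\<^sup>+ e. (\<Sum>y\<in>UNIV. ennreal (pmf (jump_pmf G x) y) *
      (\<integral>\<^sup>+ \<omega>. indicator {\<omega>. P' y \<omega>} \<omega> \<partial>chain_space G)) \<partial>exp_clock)"
    by (rule nn_integral_first_step[OF _ ae]) (measurable, simp add: step indicator_def)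
  also have "\<dots> = (\<Sum>y\<in>UNIV. ennreal (pmf (jump_pmf G x) y) *
      (\<integral>\<^sup>+ \<omega>. indicator {\<omega>. P' y \<omega>} \<omega> \<partial>chain_space G))"
    using prob_space.emeasure_space_1[OF prob_space_exp_clock] by (subst nn_integral_const) simp
  also have "\<dots> = (\<Sum>y\<in>UNIV. ennreal (pmf (jump_pmf G x) y * \<P>(\<omega> in chain_space G. P' y \<omega>)))"
    by (intro sum.cong refl, subst nn_integral_indicator_prob) (auto simp: ennreal_mult)
  also have "\<dots> = ennreal (\<Sum>y\<in>UNIV. pmf (jump_pmf G x) y * \<P>(\<omega> in chain_space G. P' y \<omega>))"
    by (rule sum_ennreal) simp
  finally show ?thesis
    by (subst (asm) ennreal_inj) (auto intro!: sum_nonneg)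
qed

lemma holding_time_finite:
  assumes "markov_generator G" "G x x \<noteq> 0" "0 < e"
  obtains r where "0 < r" "ennreal e / ennreal (- G x x) = ennreal r"
proof (rule that[of "e / (- G x x)"])
  have "0 < - G x x"
    using markov_generator_diag_le_0[OF assms(1), of x] assms(2) by simp
  then show "0 < e / (- G x x)" "ennreal e / ennreal (- G x x) = ennreal (e / (- G x x))"
    using assms(3) by (auto simp: divide_ennreal divide_pos_neg)
qed

lemma hitting_time_pos:
  assumes "regular_sample G \<omega>" "x \<notin> A"
  shows "0 < hitting_time A (chain G x \<omega>)"
proof -
  let ?X = "chain G x \<omega>"
  obtain d where d: "d > 0" "\<forall>s. 0 \<le> s \<and> s < 0 + d \<longrightarrow> ?X s = ?X 0"
    using right_constantE[OF right_constant_chain order_refl] by blast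
  have "ennreal d \<le> hitting_time A ?X"
    unfolding hitting_time_def
  proof (rule INF_greatest)
    fix t assume t: "t \<in> {t. 0 \<le> t \<and> ?X t \<in> A}"
    show "ennreal d \<le> ennreal t"
    proof (rule ccontr)
      assume "\<not> ennreal d \<le> ennreal t"
      then have "t < d" using t by (simp add: ennreal_le_iff2 not_le)
      then have "?X t = x" using d(2)[rule_format, of t] t chain_0_regular[OF assms(1), of x] by simp
      with t assms(2) show False by simp
    qed
  qed
  moreover have "0 < ennreal d" using d(1) by simp
  ultimately show ?thesis by (rule less_le_trans[rotated])
qed

lemma hits_first_A:
  assumes "markov_generator G" "x \<in> A"
  shows "hits_first G A B x = 0"
proof -
  interpret C: prob_space "chain_space G" by (rule prob_space_chain_space)
  have "AE \<omega> in chain_space G. \<not> hitting_time B (chain G x \<omega>) < hitting_time A (chain G x \<omega>)"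
    using AE_regular_sample[OF assms(1)]
    by eventually_elim (simp add: hitting_time_start assms(2))
  then show ?thesis
    unfolding hits_first_def by (intro C.prob_eq_0_AE) 
qed

lemma hits_first_B:
  assumes "markov_generator G" "x \<in> B" "x \<notin> A"
  shows "hits_first G A B x = 1"
proof -
  interpret C: prob_space "chain_space G" by (rule prob_space_chain_space)
  have "AE \<omega> in chain_space G. hitting_time B (chain G x \<omega>) < hitting_time A (chain G x \<omega>)"
    using AE_regular_sample[OF assms(1)]
    by eventually_elim (simp add: hitting_time_start hitting_time_pos assms)
  then show ?thesis
    unfolding hits_first_def by (subst C.prob_Collect_eq_1) auto
qed

text \<open>
  Outside \<open>A\<close> and \<open>B\<close> both hitting times are delayed by the same finite holding time, so the order
  in which the two sets are hit is decided after the jump.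
\<close>

lemma hits_first_harmonic:
  assumes G: "markov_generator G" and "x \<notin> A" "x \<notin> B"
  shows "gen_app G (hits_first G A B) x = 0"
proof (cases "G x x = 0")
  case True
  then show ?thesis
    using markov_generator_diag_0[OF G True] by (simp add: gen_app_def)
next
  case False
  have "hits_first G A B x = (\<Sum>y\<in>UNIV. pmf (jump_pmf G x) y * hits_first G A B y)"
    unfolding hits_first_def
  proof (rule prob_first_jump[OF G _ _ AE_regular_sample[OF G]])
    fix e :: real and \<phi> :: "'a \<Rightarrow> 'a" and \<omega> assume *: "0 < e" "regular_sample G \<omega>"
    obtain r where r: "ennreal e / ennreal (- G x x) = ennreal r"
      using holding_time_finite[OF G False *(1)] by blast
    show "hitting_time B (chain G x ((e, \<phi>) ## \<omega>)) < hitting_time A (chain G x ((e, \<phi>) ## \<omega>)) \<longleftrightarrow>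
        hitting_time B (chain G (\<phi> x) \<omega>) < hitting_time A (chain G (\<phi> x) \<omega>)"
      using assms(2,3) *(2) r
      by (simp add: hitting_time_SCons regular_sample_def ennreal_add_left_cancel_less)
  qed measurable
  then show ?thesis
    using sum_jump_pmf[OF G, of x "hits_first G A B"] by simp
qed

text \<open>
  After the first jump away from \<open>A\<close> the two return times are hitting times of the restarted path. Since
  \<open>hits_first\<close> vanishes at \<open>x\<close>, its mean after the jump, weighted by the exit rate, is the generator
  applied to it.
\<close>

lemma escape_prob_eq:
  assumes G: "markov_generator G" and "x \<in> A"
  shows "- G x x * \<P>(\<omega> in chain_space G. return_time A (chain G x \<omega>) > return_time B (chain G x \<omega>))
    = gen_app G (hits_first G A B) x"
proof (cases "G x x = 0")
  case True
  then show ?thesis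
    using markov_generator_diag_0[OF G True] by (simp add: gen_app_def)
next
  case False
  have "\<P>(\<omega> in chain_space G. return_time B (chain G x \<omega>) < return_time A (chain G x \<omega>)) =
      (\<Sum>y\<in>UNIV. pmf (jump_pmf G x) y * hits_first G A B y)"
    unfolding hits_first_def
  proof (rule prob_first_jump[OF G _ _ AE_regular_sample[OF G]])
    fix e :: real and \<phi> :: "'a \<Rightarrow> 'a" and \<omega>
    assume *: "0 < e" "regular_sample G \<omega>" "\<phi> x \<in> set_pmf (jump_pmf G x)"
    obtain r where r: "0 < r" "ennreal e / ennreal (- G x x) = ennreal r"
      using holding_time_finite[OF G False *(1)] by blast
    have "\<phi> x \<noteq> x"
      using *(3) jump_pmf_self[OF G False] by (metis set_pmf_iff)
    then have "return_time C (chain G x ((e, \<phi>) ## \<omega>)) =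
        ennreal r + hitting_time C (chain G (\<phi> x) \<omega>)" for C
      using r *(2) by (subst return_time_SCons[where r = r]) (auto simp: regular_sample_def)
    then show "return_time B (chain G x ((e, \<phi>) ## \<omega>)) < return_time A (chain G x ((e, \<phi>) ## \<omega>)) \<longleftrightarrow>
        hitting_time B (chain G (\<phi> x) \<omega>) < hitting_time A (chain G (\<phi> x) \<omega>)"
      by (simp add: ennreal_add_left_cancel_less)
  qed measurable
  then show ?thesis
    using sum_jump_pmf[OF G, of x "hits_first G A B"] hits_first_A[OF assms] by simp
qed

lemma capacity_eq:
  assumes "markov_generator G"
  shows "capacity A B G \<pi> = (\<Sum>x\<in>A. \<pi> x * gen_app G (hits_first G A B) x)"
  unfolding capacity_def by (intro sum.cong refl) (simp add: escape_prob_eq[OF assms, symmetric])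

section \<open>The Kolmogorov backward equation\<close>

lemma transition_bounds: "0 \<le> transition G t x y" "transition G t x y \<le> 1"
proof -
  interpret C: prob_space "chain_space G" by (rule prob_space_chain_space)
  show "0 \<le> transition G t x y" "transition G t x y \<le> 1"
    by (auto simp: transition_def)
qed

lemma nn_integral_chain_eq:
  "(\<integral>\<^sup>+ \<omega>. indicator {\<omega>. chain G x \<omega> t = y} \<omega> \<partial>chain_space G) = ennreal (transition G t x y)"
  unfolding transition_def by (rule nn_integral_indicator_prob) measurable

lemma measurable_transition[measurable]: "(\<lambda>t. transition G t x y) \<in> borel_measurable borel"
proof -
  interpret C: prob_space "chain_space G" by (rule prob_space_chain_space)
  have [measurable]: "(\<lambda>(t, \<omega>). chain G x \<omega> t) \<in>
      measurable (borel \<Otimes>\<^sub>M chain_space G) (count_space UNIV)"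
    using measurable_chain_pair by measurable
  have "(\<lambda>t. \<integral>\<^sup>+ \<omega>. indicator {y} ((\<lambda>(t, \<omega>). chain G x \<omega> t) (t, \<omega>)) \<partial>chain_space G)
      \<in> borel_measurable borel"
    by measurable
  also have "(\<lambda>t. \<integral>\<^sup>+ \<omega>. indicator {y} ((\<lambda>(t, \<omega>). chain G x \<omega> t) (t, \<omega>)) \<partial>chain_space G) =
      (\<lambda>t. ennreal (transition G t x y))"
    unfolding nn_integral_chain_eq[symmetric] by (intro ext nn_integral_cong) (simp add: indicator_def)
  finally have "(\<lambda>t. enn2real (ennreal (transition G t x y))) \<in> borel_measurable borel"
    by measurable
  then show ?thesis by (simp add: transition_bounds)
qed

lemma emeasure_exp_clock_greater:
  assumes "0 \<le> a"
  shows "emeasure exp_clock {a<..} = ennreal (exp (- a))"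
proof -
  interpret E: prob_space exp_clock by (rule prob_space_exp_clock)
  have "distributed exp_clock lborel (\<lambda>x. x) (exponential_density 1)"
    unfolding distributed_def by (auto simp: distr_id2 cong: distr_cong)
  from E.exponential_distributedD_gt[OF this assms]
  have "measure exp_clock {a<..} = exp (- a)"
    by (simp add: greaterThan_def)
  then show ?thesis
    by (simp add: E.emeasure_eq_measure)
qed

text \<open>
  Condition on the first jump. If it has not happened by time \<open>t\<close> the chain is still in \<open>x\<close>; if it
  happens at time \<open>e / q\<close>, the chain restarts with time \<open>r = t - e / q\<close> left, and \<open>r\<close> is the variable
  of integration. The factor \<open>exp (- q * t)\<close> is taken out so that \<open>t\<close> enters only through the bounds of
  the integral.
\<close>

lemma transition_renewal:
  fixes x y :: "'a::finite"
  assumes G: "markov_generator G" and t: "0 \<le> t"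
  defines "q \<equiv> - G x x"
    and "F \<equiv> \<lambda>r. \<Sum>z\<in>UNIV. pmf (jump_pmf G x) z * transition G r z y"
  shows "(\<lambda>r. q * exp (q * r) * F r) integrable_on {0..t}"
    and "transition G t x y =
      exp (- q * t) * (of_bool (x = y) + integral {0..t} (\<lambda>r. q * exp (q * r) * F r))"
proof -
  interpret C: prob_space "chain_space G" by (rule prob_space_chain_space)
  have q: "0 \<le> q" using markov_generator_diag_le_0[OF G, of x] by (simp add: q_def)
  have F_meas[measurable]: "F \<in> borel_measurable borel"
    unfolding F_def by measurable
  have F: "0 \<le> F r" "F r \<le> 1" for r
  proof -
    show "0 \<le> F r" unfolding F_def by (intro sum_nonneg mult_nonneg_nonneg transition_bounds) simp
    have "F r \<le> (\<Sum>z\<in>UNIV. pmf (jump_pmf G x) z * 1)"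
      unfolding F_def by (intro sum_mono mult_left_mono transition_bounds) simp
    also have "\<dots> = 1" by (simp add: sum_pmf_eq_1)
    finally show "F r \<le> 1" .
  qed
  let ?g = "\<lambda>r. q * exp (q * r) * F r"
  have "set_integrable lborel {0..t} ?g"
    unfolding set_integrable_def
  proof (rule integrableI_bounded_set_indicator[where B = "q * exp (q * t)"])
    show "AE r in lborel. r \<in> {0..t} \<longrightarrow> norm (?g r) \<le> q * exp (q * t)"
    proof (intro AE_I2 impI)
      fix r assume "r \<in> {0..t}"
      then have "q * exp (q * r) * F r \<le> q * exp (q * t) * 1"
        using q F by (intro mult_mono) (auto intro: mult_left_mono)
      then show "norm (?g r) \<le> q * exp (q * t)"
        using q F[of r] by (simp add: abs_mult)
    qed
  qed (use t in auto)
  note int = this set_borel_integral_eq_integral[OF this]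
  show "?g integrable_on {0..t}" by (rule int)
  show "transition G t x y = exp (- q * t) * (of_bool (x = y) + integral {0..t} ?g)"
  proof (cases "q = 0")
    case True
    have "ennreal (transition G t x y) =
      (\<integral>\<^sup>+ e. (\<Sum>z\<in>UNIV. ennreal (pmf (jump_pmf G x) z) *
        (\<integral>\<^sup>+ \<omega>. indicator {\<omega>. x = y} \<omega> \<partial>chain_space G)) \<partial>exp_clock)"
      unfolding nn_integral_chain_eq[symmetric]
    proof (rule nn_integral_first_step[OF _ AE_regular_sample[OF G]])
      fix e :: real and \<phi> :: "'a \<Rightarrow> 'a" and \<omega> assume "0 < e"
      then have "chain G x ((e, \<phi>) ## \<omega>) t = x"
        using True by (intro chain_SCons_before) (simp add: q_def ennreal_divide_zero)
      then show "indicator {\<omega>. chain G x \<omega> t = y} ((e, \<phi>) ## \<omega>) =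
          (indicator {\<omega>. x = y} \<omega> :: ennreal)"
        by (simp add: indicator_def)
    qed measurable
    also have "\<dots> = ennreal (of_bool (x = y))"
      using prob_space.emeasure_space_1[OF prob_space_exp_clock]
      by (simp add: C.emeasure_space_1 indicator_def sum_pmf_eq_1 sum_ennreal)
    finally have "transition G t x y = of_bool (x = y)"
      by (subst (asm) ennreal_inj) (auto simp: transition_bounds)
    with True show ?thesis by simp
  next
    case False
    with q have q: "0 < q" by simp
    have "ennreal (transition G t x y) =
      (\<integral>\<^sup>+ e. (\<Sum>z\<in>UNIV. ennreal (pmf (jump_pmf G x) z) *
        (\<integral>\<^sup>+ \<omega>. (if q * t < e then indicator {\<omega>. x = y} \<omega>
             else indicator {\<omega>. chain G z \<omega> (t - e / q) = y} \<omega>) \<partial>chain_space G)) \<partial>exp_clock)"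
      unfolding nn_integral_chain_eq[symmetric]
    proof (rule nn_integral_first_step[OF _ AE_regular_sample[OF G]])
      fix e :: real and \<phi> :: "'a \<Rightarrow> 'a" and \<omega> assume *: "0 < e" "regular_sample G \<omega>"
      have eq: "ennreal e / ennreal (- G x x) = ennreal (e / q)"
        using q * by (simp add: q_def divide_ennreal)
      show "indicator {\<omega>. chain G x \<omega> t = y} ((e, \<phi>) ## \<omega>) =
          (if q * t < e then indicator {\<omega>. x = y} \<omega>
             else indicator {\<omega>. chain G (\<phi> x) \<omega> (t - e / q) = y} \<omega> :: ennreal)"
      proof (cases "q * t < e")
        case True
        then have "chain G x ((e, \<phi>) ## \<omega>) t = x"
          using q t by (intro chain_SCons_before) (simp add: eq ennreal_less_iff field_simps)
        with True show ?thesis by (simp add: indicator_def)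
      next
        case False
        then have "chain G x ((e, \<phi>) ## \<omega>) t = chain G (snd (e, \<phi>) x) \<omega> (t - e / q)"
          using q * by (intro chain_SCons_after) (auto simp: eq regular_sample_def field_simps)
        with False show ?thesis by (simp add: indicator_def)
      qed
    qed measurable
    also have "\<dots> = (\<integral>\<^sup>+ e. ennreal (of_bool (x = y)) * indicator {q * t<..} e +
        ennreal (F (t - e / q)) * indicator {..q * t} e \<partial>exp_clock)"
    proof (rule nn_integral_cong)
      fix e
      show "(\<Sum>z\<in>UNIV. ennreal (pmf (jump_pmf G x) z) *
        (\<integral>\<^sup>+ \<omega>. (if q * t < e then indicator {\<omega>. x = y} \<omega>
             else indicator {\<omega>. chain G z \<omega> (t - e / q) = y} \<omega>) \<partial>chain_space G)) =
        ennreal (of_bool (x = y)) * indicator {q * t<..} e +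
          ennreal (F (t - e / q)) * indicator {..q * t} e"
      proof (cases "q * t < e")
        case True
        then show ?thesis
          by (simp add: C.emeasure_space_1 indicator_def sum_pmf_eq_1 sum_ennreal)
      next
        case False
        then show ?thesis
          by (simp add: nn_integral_chain_eq F_def sum_ennreal[symmetric] ennreal_mult transition_bounds
               del: sum_ennreal)
      qed
    qed
    also have "\<dots> = ennreal (of_bool (x = y)) * ennreal (exp (- (q * t))) +
        (\<integral>\<^sup>+ e. ennreal (F (t - e / q)) * indicator {..q * t} e \<partial>exp_clock)"
      using q t
      by (subst nn_integral_add) (auto simp: nn_integral_cmult emeasure_exp_clock_greater)
    also have "(\<integral>\<^sup>+ e. ennreal (F (t - e / q)) * indicator {..q * t} e \<partial>exp_clock) =
        (\<integral>\<^sup>+ e. ennreal (exponential_density 1 e) * (ennreal (F (t - e / q)) * indicator {..q * t} e) \<partial>lborel)"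
      by (rule nn_integral_density) measurable
    \<comment> \<open>The substitution \<open>e = q * (t - r)\<close>.\<close>
    also have "\<dots> = ennreal \<bar>- q\<bar> * (\<integral>\<^sup>+ r. ennreal (exponential_density 1 (q * t + - q * r)) *
        (ennreal (F (t - (q * t + - q * r) / q)) * indicator {..q * t} (q * t + - q * r)) \<partial>lborel)"
      by (rule nn_integral_real_affine) (measurable, use q in simp)
    also have "\<dots> = (\<integral>\<^sup>+ r. ennreal \<bar>- q\<bar> * (ennreal (exponential_density 1 (q * t + - q * r)) *
        (ennreal (F (t - (q * t + - q * r) / q)) * indicator {..q * t} (q * t + - q * r))) \<partial>lborel)"
      by (rule nn_integral_cmult[symmetric]) measurable
    also have "\<dots> = (\<integral>\<^sup>+ r. ennreal (exp (- (q * t))) * ennreal (indicator {0..t} r *\<^sub>R ?g r) \<partial>lborel)"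
    proof (rule nn_integral_cong)
      fix r :: real
      have r: "t - (q * t + - q * r) / q = r" using q by (simp add: field_simps)
      show "ennreal \<bar>- q\<bar> * (ennreal (exponential_density 1 (q * t + - q * r)) *
        (ennreal (F (t - (q * t + - q * r) / q)) * indicator {..q * t} (q * t + - q * r))) =
        ennreal (exp (- (q * t))) * ennreal (indicator {0..t} r *\<^sub>R ?g r)"
      proof (cases "r \<in> {0..t}")
        case True
        then have "q * r \<le> q * t" "0 \<le> q * r" using q by auto
        then show ?thesis
          using True q F[of r] unfolding r
          by (simp add: exponential_density_def exp_diff exp_minus field_simps flip: ennreal_mult)
      next
        case False
        then have "q * t < q * r \<or> q * r < 0"
          using q by (auto simp: mult_less_0_iff)
        with False show ?thesis
          unfolding r by (auto simp: exponential_density_def indicator_def)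
      qed
    qed
    also have "\<dots> = ennreal (exp (- (q * t))) * (\<integral>\<^sup>+ r. ennreal (indicator {0..t} r *\<^sub>R ?g r) \<partial>lborel)"
      by (rule nn_integral_cmult) measurable
    also have "(\<integral>\<^sup>+ r. ennreal (indicator {0..t} r *\<^sub>R ?g r) \<partial>lborel) = ennreal (integral {0..t} ?g)"
      using int(1) q F unfolding int(3)[symmetric] set_lebesgue_integral_def set_integrable_def
      by (intro nn_integral_eq_integral) auto
    finally have "ennreal (transition G t x y) =
        ennreal (of_bool (x = y)) * ennreal (exp (- (q * t))) +
        ennreal (exp (- (q * t))) * ennreal (integral {0..t} ?g)" .
    moreover have "0 \<le> integral {0..t} ?g"
      using q F int(2) by (intro integral_nonneg) auto
    moreover have "ennreal (of_bool b) * ennreal c + ennreal c * ennreal d = ennreal (c * (of_bool b + d))"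
      if "0 \<le> c" "0 \<le> d" for b c d
      using that by (simp add: distrib_left ennreal_plus ennreal_mult)
    ultimately have "ennreal (transition G t x y) =
        ennreal (exp (- (q * t)) * (of_bool (x = y) + integral {0..t} ?g))"
      by simp
    then show ?thesis
      using \<open>0 \<le> integral {0..t} ?g\<close>
      by (subst (asm) ennreal_inj) (auto simp: transition_bounds)
  qed
qed

lemma transition_0:
  assumes "markov_generator G"
  shows "transition G 0 x y = of_bool (x = y)"
  using transition_renewal(2)[OF assms order_refl] by simp

text \<open>
  The renewal equation is used twice: the integral of a bounded measurable function is continuous in
  its upper bound, so the transition probabilities are continuous, and then the integrand is
  continuous and the equation can be differentiated.
\<close>

lemma transition_has_derivative:
  assumes G: "markov_generator G" and t: "0 \<le> t" "t \<le> T"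
  shows "((\<lambda>t. transition G t x y) has_real_derivative
    gen_app G (\<lambda>z. transition G t z y) x) (at t within {0..T})"
proof -
  have cont: "continuous_on {0..T} (\<lambda>t. transition G t z y)" for z
  proof -
    define q where "q = - G z z"
    define g where "g = (\<lambda>r. q * exp (q * r) * (\<Sum>w\<in>UNIV. pmf (jump_pmf G z) w * transition G r w y))"
    have "continuous_on {0..T} (\<lambda>t. exp (- q * t) * (of_bool (z = y) + integral {0..t} g))"
      unfolding g_def q_def using t
      by (intro continuous_intros indefinite_integral_continuous_1 transition_renewal(1)[OF G]) auto
    then show ?thesis
      by (rule continuous_on_eq) (use transition_renewal(2)[OF G, of _ z y] in \<open>simp add: g_def q_def\<close>)
  qed
  define q where "q = - G x x"
  define F where "F = (\<lambda>r. \<Sum>w\<in>UNIV. pmf (jump_pmf G x) w * transition G r w y)"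
  define g where "g = (\<lambda>r. q * exp (q * r) * F r)"
  have eq: "transition G t x y = exp (- q * t) * (of_bool (x = y) + integral {0..t} g)" if "0 \<le> t" for t
    using transition_renewal(2)[OF G that, of x y] by (simp add: g_def q_def F_def)
  have "continuous_on {0..T} g"
    unfolding g_def F_def by (intro continuous_intros cont)
  then have "((\<lambda>t. integral {0..t} g) has_real_derivative g t) (at t within {0..T})"
    using t by (intro integral_has_real_derivative) auto
  then have "((\<lambda>t. exp (- q * t) * (of_bool (x = y) + integral {0..t} g)) has_real_derivative
      (- q * exp (- q * t)) * (of_bool (x = y) + integral {0..t} g) + exp (- q * t) * g t)
      (at t within {0..T})"
    by (auto intro!: derivative_eq_intros)
  also have "(- q * exp (- q * t)) * (of_bool (x = y) + integral {0..t} g) + exp (- q * t) * g t =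
      - q * transition G t x y + q * F t"
    using eq[OF t(1)] by (simp add: g_def exp_minus field_simps)
  also have "\<dots> = gen_app G (\<lambda>z. transition G t z y) x"
    using sum_jump_pmf[OF G, of x "\<lambda>z. transition G t z y"] by (simp add: q_def F_def)
  finally show ?thesis
    by (rule has_field_derivative_transform_within[of _ _ _ _ 1]) (use t eq in auto)
qed

section \<open>Dirichlet forms\<close>

definition dirichlet :: "('a::finite \<Rightarrow> real) \<Rightarrow> ('a \<Rightarrow> 'a \<Rightarrow> real) \<Rightarrow> ('a \<Rightarrow> real) \<Rightarrow> real" where
  "dirichlet \<pi> G f = pi_inner \<pi> (\<lambda>x. - gen_app G f x) f"

lemma gen_app_add: "gen_app G (\<lambda>x. f x + g x) x = gen_app G f x + gen_app G g x"
  by (simp add: gen_app_def algebra_simps sum.distrib)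

lemma gen_app_diff: "gen_app G (\<lambda>x. f x - g x) x = gen_app G f x - gen_app G g x"
  by (simp add: gen_app_def algebra_simps sum_subtractf)

lemma gen_app_cmult: "gen_app G (\<lambda>x. c * f x) x = c * gen_app G f x"
  by (simp add: gen_app_def sum_distrib_left algebra_simps)

lemma gen_app_const: "markov_generator G \<Longrightarrow> gen_app G (\<lambda>x. c) x = 0"
  by (simp add: gen_app_def markov_generator_def sum_distrib_right[symmetric])

lemma pi_inner_add_left: "pi_inner \<pi> (\<lambda>x. f x + g x) h = pi_inner \<pi> f h + pi_inner \<pi> g h"
  by (simp add: pi_inner_def algebra_simps sum.distrib)

lemma pi_inner_diff_left: "pi_inner \<pi> (\<lambda>x. f x - g x) h = pi_inner \<pi> f h - pi_inner \<pi> g h"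
  by (simp add: pi_inner_def algebra_simps sum_subtractf)

lemma pi_inner_minus_left: "pi_inner \<pi> (\<lambda>x. - f x) h = - pi_inner \<pi> f h"
  by (simp add: pi_inner_def algebra_simps sum_negf)

lemma pi_inner_cmult_left: "pi_inner \<pi> (\<lambda>x. c * f x) h = c * pi_inner \<pi> f h"
  by (simp add: pi_inner_def sum_distrib_left algebra_simps)

lemma pi_inner_commute: "pi_inner \<pi> f g = pi_inner \<pi> g f"
  by (simp add: pi_inner_def algebra_simps)

lemma pi_inner_add_right: "pi_inner \<pi> h (\<lambda>x. f x + g x) = pi_inner \<pi> h f + pi_inner \<pi> h g"
  by (simp add: pi_inner_def algebra_simps sum.distrib)

lemma pi_inner_diff_right: "pi_inner \<pi> h (\<lambda>x. f x - g x) = pi_inner \<pi> h f - pi_inner \<pi> h g"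
  by (simp add: pi_inner_def algebra_simps sum_subtractf)

lemma pi_inner_cmult_right: "pi_inner \<pi> h (\<lambda>x. c * f x) = c * pi_inner \<pi> h f"
  by (simp add: pi_inner_def sum_distrib_left algebra_simps)

lemma pi_inner_self_eq_0:
  assumes "\<And>x. 0 < \<pi> x" "pi_inner \<pi> f f = 0"
  shows "f x = 0"
proof -
  have "\<forall>x\<in>UNIV. f x * f x * \<pi> x = 0"
    using assms(2) unfolding pi_inner_def
    by (subst (asm) sum_nonneg_eq_0_iff) (use assms(1) in \<open>auto simp: less_imp_le\<close>)
  then show ?thesis using assms(1)[of x] by auto
qed

lemma pi_inner_self_nonneg: "(\<And>x. 0 \<le> \<pi> x) \<Longrightarrow> 0 \<le> pi_inner \<pi> f f"
  unfolding pi_inner_def by (intro sum_nonneg mult_nonneg_nonneg[OF zero_le_square])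

lemma mean_gen_app:
  assumes "stationary G \<pi>"
  shows "mean \<pi> (gen_app G f) = 0"
proof -
  have "mean \<pi> (gen_app G f) = (\<Sum>x\<in>UNIV. \<Sum>y\<in>UNIV. f y * (\<pi> x * G x y))"
    by (simp add: mean_def gen_app_def sum_distrib_left sum_distrib_right mult_ac)
  also have "\<dots> = (\<Sum>y\<in>UNIV. f y * (\<Sum>x\<in>UNIV. \<pi> x * G x y))"
    by (subst sum.swap) (simp add: sum_distrib_left)
  also have "\<dots> = 0" using assms by (simp add: stationary_def)
  finally show ?thesis .
qed

text \<open>The row sums and the stationarity equations remove the squares from the double sum.\<close>

lemma dirichlet_eq_sum_squares:
  assumes G: "markov_generator G" and s: "stationary G \<pi>"
  shows "dirichlet \<pi> G f = (\<Sum>x\<in>UNIV. \<Sum>y\<in>UNIV. \<pi> x * G x y * (f x - f y)\<^sup>2) / 2"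
proof -
  have row: "(\<Sum>y\<in>UNIV. \<pi> x * G x y * (f x)\<^sup>2) = 0" for x
  proof -
    have "(\<Sum>y\<in>UNIV. \<pi> x * G x y * (f x)\<^sup>2) = \<pi> x * (f x)\<^sup>2 * (\<Sum>y\<in>UNIV. G x y)"
      by (simp add: sum_distrib_left sum_distrib_right mult_ac)
    then show ?thesis using G by (simp add: markov_generator_def)
  qed
  have col: "(\<Sum>x\<in>UNIV. \<Sum>y\<in>UNIV. \<pi> x * G x y * (f y)\<^sup>2) = 0"
    using mean_gen_app[OF s, of "\<lambda>y. (f y)\<^sup>2"]
    by (simp add: mean_def gen_app_def sum_distrib_left sum_distrib_right algebra_simps)
  have "(\<Sum>x\<in>UNIV. \<Sum>y\<in>UNIV. \<pi> x * G x y * (f x - f y)\<^sup>2) =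
      (\<Sum>x\<in>UNIV. \<Sum>y\<in>UNIV. \<pi> x * G x y * (f x)\<^sup>2) + (\<Sum>x\<in>UNIV. \<Sum>y\<in>UNIV. \<pi> x * G x y * (f y)\<^sup>2)
      - 2 * (\<Sum>x\<in>UNIV. \<Sum>y\<in>UNIV. \<pi> x * G x y * f x * f y)"
    by (simp add: power2_diff algebra_simps sum.distrib sum_subtractf sum_distrib_left)
  also have "(\<Sum>x\<in>UNIV. \<Sum>y\<in>UNIV. \<pi> x * G x y * f x * f y) = - dirichlet \<pi> G f"
    by (simp add: dirichlet_def pi_inner_def gen_app_def sum_distrib_left sum_distrib_right
        sum_negf algebra_simps)
  finally show ?thesis by (simp add: row col)
qed

definition reversible :: "('a::finite \<Rightarrow> 'a \<Rightarrow> real) \<Rightarrow> ('a \<Rightarrow> real) \<Rightarrow> bool" where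
  "reversible G \<pi> \<longleftrightarrow> (\<forall>x y. \<pi> x * G x y = \<pi> y * G y x)"

lemma reversible_pi_inner:
  assumes "reversible G \<pi>"
  shows "pi_inner \<pi> (gen_app G f) g = pi_inner \<pi> f (gen_app G g)"
proof -
  have "pi_inner \<pi> (gen_app G f) g = (\<Sum>x\<in>UNIV. \<Sum>y\<in>UNIV. \<pi> x * G x y * f y * g x)"
    by (simp add: pi_inner_def gen_app_def sum_distrib_left sum_distrib_right algebra_simps)
  also have "\<dots> = (\<Sum>x\<in>UNIV. \<Sum>y\<in>UNIV. \<pi> y * G y x * f y * g x)"
    using assms by (simp add: reversible_def)
  also have "\<dots> = (\<Sum>y\<in>UNIV. \<Sum>x\<in>UNIV. \<pi> y * G y x * f y * g x)"
    by (rule sum.swap)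
  also have "\<dots> = pi_inner \<pi> f (gen_app G g)"
    by (simp add: pi_inner_def gen_app_def sum_distrib_left sum_distrib_right algebra_simps)
  finally show ?thesis .
qed

lemma reversible_stationary:
  assumes "markov_generator G" "reversible G \<pi>" "prob_vector \<pi>"
  shows "stationary G \<pi>"
proof -
  have "(\<Sum>x\<in>UNIV. \<pi> x * G x y) = \<pi> y * (\<Sum>x\<in>UNIV. G y x)" for y
    using assms(2) by (simp add: reversible_def sum_distrib_left)
  with assms(1,3) show ?thesis by (simp add: stationary_def markov_generator_def)
qed

lemma dirichlet_nonneg:
  assumes "markov_generator G" "stationary G \<pi>"
  shows "0 \<le> dirichlet \<pi> G f"
proof -
  have "0 \<le> \<pi> x * G x y * (f x - f y)\<^sup>2" for x y
    using assms by (cases "x = y") (auto simp: markov_generator_def stationary_def prob_vector_def)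
  then show ?thesis
    unfolding dirichlet_eq_sum_squares[OF assms] by (intro divide_nonneg_nonneg sum_nonneg) auto
qed

lemma dirichlet_mono:
  assumes "markov_generator G" "stationary G \<pi>" "markov_generator H" "stationary H \<pi>"
    and le: "\<And>x y. x \<noteq> y \<Longrightarrow> G x y \<le> H x y"
  shows "dirichlet \<pi> G f \<le> dirichlet \<pi> H f"
proof -
  have "\<pi> x * G x y * (f x - f y)\<^sup>2 \<le> \<pi> x * H x y * (f x - f y)\<^sup>2" for x y
    using le[of x y] assms(2)
    by (cases "x = y") (auto simp: stationary_def prob_vector_def intro!: mult_right_mono mult_left_mono)
  then show ?thesis
    unfolding dirichlet_eq_sum_squares[OF assms(1,2)] dirichlet_eq_sum_squares[OF assms(3,4)]
    by (intro divide_right_mono sum_mono) auto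
qed

lemma dirichlet_eq_0_const:
  assumes G: "markov_generator G" "irreducible_generator G" "stationary G \<pi>"
    and pos: "\<And>x. 0 < \<pi> x" and zero: "dirichlet \<pi> G f = 0"
  shows "f x = f y"
proof -
  have nn: "0 \<le> \<pi> x * G x y * (f x - f y)\<^sup>2" for x y
    using G by (cases "x = y") (auto simp: markov_generator_def stationary_def prob_vector_def)
  have "(\<Sum>x\<in>UNIV. \<Sum>y\<in>UNIV. \<pi> x * G x y * (f x - f y)\<^sup>2) = 0"
    using zero by (simp add: dirichlet_eq_sum_squares[OF G(1,3)])
  then have "\<forall>x\<in>UNIV. (\<Sum>y\<in>UNIV. \<pi> x * G x y * (f x - f y)\<^sup>2) = 0"
    using nn by (subst (asm) sum_nonneg_eq_0_iff) (auto intro: sum_nonneg)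
  then have "\<forall>y\<in>UNIV. \<pi> x * G x y * (f x - f y)\<^sup>2 = 0" for x
    using nn by (subst sum_nonneg_eq_0_iff[symmetric]) auto
  then have edge: "0 < G x y \<Longrightarrow> f x = f y" for x y
    using pos[of x] by (metis UNIV_I divisors_zero less_irrefl power_eq_0_iff right_minus_eq)
  have "(x, y) \<in> {(u, v). u \<noteq> v \<and> 0 < G u v}\<^sup>*"
    using G(2) by (simp add: irreducible_generator_def)
  then show ?thesis
    by (induction rule: rtrancl_induct) (auto dest: edge)
qed

text \<open>
  Positive mass spreads along the transitions, since a state with an incoming flow cannot have mass
  zero in equilibrium, and every state can be reached.
\<close>

lemma stationary_pos:
  assumes G: "markov_generator G" "irreducible_generator G" "stationary G \<pi>"
  shows "0 < \<pi> x"
proof -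
  have nn: "0 \<le> \<pi> x" for x using G(3) by (simp add: stationary_def prob_vector_def)
  have step: "0 < \<pi> y" if "0 < \<pi> x" "x \<noteq> y" "0 < G x y" for x y
  proof (rule ccontr)
    assume "\<not> 0 < \<pi> y"
    then have "\<pi> y = 0" using nn[of y] by simp
    then have "(\<Sum>z\<in>UNIV - {y}. \<pi> z * G z y) = 0"
      using G(3) by (simp add: stationary_def sum_diff1)
    moreover have "\<forall>z\<in>UNIV - {y}. 0 \<le> \<pi> z * G z y"
      using nn G(1) by (auto simp: markov_generator_def)
    ultimately have "\<pi> x * G x y = 0"
      using that(2) by (subst (asm) sum_nonneg_eq_0_iff) auto
    with that show False by simp
  qed
  obtain z where z: "0 < \<pi> z"
  proof -
    have "(\<Sum>x\<in>UNIV. \<pi> x) = 1" using G(3) by (simp add: stationary_def prob_vector_def)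
    then have "\<exists>z. \<pi> z \<noteq> 0" by (metis sum.neutral zero_neq_one)
    then show ?thesis using that nn by (metis less_eq_real_def)
  qed
  have "(z, x) \<in> {(u, v). u \<noteq> v \<and> 0 < G u v}\<^sup>*"
    using G(2) by (simp add: irreducible_generator_def)
  then show ?thesis
    by (induction rule: rtrancl_induct) (auto intro: z step)
qed

text \<open>
  The operator \<open>f \<mapsto> G f + \<pi>(f)\<close> preserves the mean by stationarity and is injective: on its kernel
  \<open>\<pi>(f) = 0\<close> and \<open>G f = 0\<close>, so the Dirichlet form vanishes and \<open>f\<close> is constant. In finite dimension it
  is therefore onto, and a preimage of a function of mean zero has mean zero.
\<close>

lemma poisson_solvable:
  fixes G :: "'a::finite \<Rightarrow> 'a \<Rightarrow> real"
  assumes G: "markov_generator G" "irreducible_generator G" "stationary G \<pi>" and h: "mean \<pi> h = 0"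
  shows "\<exists>g. gen_app G g = h"
proof -
  have pos: "0 < \<pi> x" for x by (rule stationary_pos[OF G])
  have total: "(\<Sum>x\<in>UNIV. \<pi> x) = 1" using G(3) by (simp add: stationary_def prob_vector_def)
  define T :: "real ^ 'a \<Rightarrow> real ^ 'a" where
    "T = (\<lambda>v. \<chi> x. gen_app G (\<lambda>y. v $ y) x + mean \<pi> (\<lambda>y. v $ y))"
  have lin: "linear T"
    by (rule linearI) (auto simp: T_def vec_eq_iff gen_app_def mean_def algebra_simps sum.distrib
        sum_distrib_left)
  have mean_T: "mean \<pi> (\<lambda>x. T v $ x) = mean \<pi> (\<lambda>y. v $ y)" for v
  proof -
    have "mean \<pi> (\<lambda>x. T v $ x) =
        mean \<pi> (gen_app G (\<lambda>y. v $ y)) + (\<Sum>x\<in>UNIV. mean \<pi> (\<lambda>y. v $ y) * \<pi> x)"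
      by (simp add: T_def mean_def distrib_right sum.distrib)
    then show ?thesis
      by (simp add: mean_gen_app[OF G(3)] total flip: sum_distrib_left)
  qed
  have "inj T"
  proof (subst linear_injective_0[OF lin], intro allI impI)
    fix v assume v: "T v = 0"
    then have m: "mean \<pi> (\<lambda>y. v $ y) = 0"
      using mean_T[of v] by (simp add: mean_def)
    then have "gen_app G (\<lambda>y. v $ y) x = 0" for x
      using arg_cong[OF v, of "\<lambda>w. w $ x"] by (simp add: T_def)
    then have "dirichlet \<pi> G (\<lambda>y. v $ y) = 0"
      by (simp add: dirichlet_def pi_inner_def)
    then have const: "v $ x = v $ y" for x y
      using dirichlet_eq_0_const[OF G pos] by blast
    have "v $ x = 0" for x
    proof -
      have "mean \<pi> (\<lambda>y. v $ y) = (\<Sum>y\<in>UNIV. v $ x * \<pi> y)"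
        unfolding mean_def by (rule sum.cong[OF refl], subst const[of _ x], rule refl)
      with m show ?thesis by (simp add: total flip: sum_distrib_left)
    qed
    then show "v = 0" by (simp add: vec_eq_iff)
  qed
  then have "surj T"
    using linear_injective_imp_surjective[OF lin] by blast
  then obtain v where v: "T v = (\<chi> x. h x)" by (metis surjD)
  then have "mean \<pi> (\<lambda>y. v $ y) = 0"
    using mean_T[of v] h by simp
  then have "gen_app G (\<lambda>y. v $ y) x = h x" for x
    using arg_cong[OF v, of "\<lambda>w. w $ x"] by (simp add: T_def)
  then show ?thesis by blast
qed

section \<open>Comparison of two generators\<close>

text \<open>
  The situation common to all the comparisons. The first Metropolis-Hastings generator, which takes the
  place of \<open>K\<close>, may have several communicating classes, so irreducibility is asked of \<open>L\<close>; it makes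
  \<open>\<pi>\<close> positive and the Poisson equation of \<open>L\<close> solvable.
\<close>

locale form_comparison =
  fixes \<pi> :: "'a::finite \<Rightarrow> real" and K L :: "'a \<Rightarrow> 'a \<Rightarrow> real"
  assumes gen_K: "markov_generator K" and rev_K: "reversible K \<pi>"
    and gen_L: "markov_generator L" and irr_L: "irreducible_generator L" and stat_L: "stationary L \<pi>"
    and form_le: "\<And>f. dirichlet \<pi> K f \<le> dirichlet \<pi> L f"
begin

lemma pi_pos: "0 < \<pi> x"
  using stationary_pos[OF gen_L irr_L stat_L] .

lemma pi_nonneg: "0 \<le> \<pi> x"
  using pi_pos[of x] by simp

lemma stat_K: "stationary K \<pi>"
  using reversible_stationary[OF gen_K rev_K] stat_L by (simp add: stationary_def)

lemma dirichlet_K_diff: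
  "dirichlet \<pi> K (\<lambda>x. f x - g x) =
     dirichlet \<pi> K f - 2 * pi_inner \<pi> (\<lambda>x. - gen_app K f x) g + dirichlet \<pi> K g"
proof -
  have "pi_inner \<pi> (gen_app K g) f = pi_inner \<pi> (gen_app K f) g"
    using reversible_pi_inner[OF rev_K] by (simp add: pi_inner_commute)
  then show ?thesis
    by (simp add: dirichlet_def gen_app_diff pi_inner_minus_left pi_inner_diff_left pi_inner_diff_right)
qed

end

section \<open>Comparison of hitting times\<close>

text \<open>
  With \<open>w = l u - G u\<close>, the product \<open>w u\<close> equals \<open>w\<close>: off \<open>A\<close> both vanish, and on \<open>A\<close> one has \<open>u = 1\<close>.
  Thus \<open>\<langle>w, u\<rangle> = \<langle>w, 1\<rangle>\<close>, and stationarity removes \<open>G u\<close> from the mean of \<open>w\<close>.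
\<close>

lemma resolvent_energy:
  fixes A :: "'a::finite set"
  assumes G: "markov_generator G" and s: "stationary G \<pi>" and l: "0 < l"
  defines "u \<equiv> laplace l A G"
  shows "dirichlet \<pi> G u + l * pi_inner \<pi> u u = l * laplace_hitting l A G \<pi>"
proof -
  have on_A: "u x = 1" if "x \<in> A" for x
    using laplace_in[OF G that] by (simp add: u_def)
  have off_A: "l * u x - gen_app G u x = 0" if "x \<notin> A" for x
    using laplace_out[OF G that l] by (simp add: u_def)
  have "dirichlet \<pi> G u + l * pi_inner \<pi> u u = pi_inner \<pi> (\<lambda>x. l * u x - gen_app G u x) u"
    by (simp add: dirichlet_def pi_inner_minus_left pi_inner_diff_left pi_inner_cmult_left)
  also have "\<dots> = (\<Sum>x\<in>UNIV. (l * u x - gen_app G u x) * \<pi> x)"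
    unfolding pi_inner_def
  proof (rule sum.cong[OF refl])
    fix x
    show "(l * u x - gen_app G u x) * u x * \<pi> x = (l * u x - gen_app G u x) * \<pi> x"
      using on_A[of x] off_A[of x] by (cases "x \<in> A") simp_all
  qed
  also have "\<dots> = l * mean \<pi> u - mean \<pi> (gen_app G u)"
    by (simp add: mean_def left_diff_distrib right_diff_distrib sum_subtractf sum_distrib_left mult_ac)
  also have "\<dots> = l * laplace_hitting l A G \<pi>"
    using mean_gen_app[OF s, of u] by (simp add: mean_def laplace_hitting_def u_def laplace_def mult_ac)
  finally show ?thesis .
qed

context form_comparison
begin

text \<open>
  The difference of \<open>u\<close> and \<open>v\<close> vanishes on \<open>A\<close>, where the boundary values agree, and \<open>l u - K u\<close>
  vanishes off \<open>A\<close>. So the two are orthogonal, and \<open>u\<close> minimises the energy of \<open>K\<close> among functions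
  that are \<open>1\<close> on \<open>A\<close>.
\<close>

lemma laplace_hitting_le:
  assumes l: "0 < l"
  shows "laplace_hitting l A K \<pi> \<le> laplace_hitting l A L \<pi>"
proof -
  define u where "u = laplace l A K"
  define v where "v = laplace l A L"
  let ?E = "\<lambda>f. dirichlet \<pi> K f + l * pi_inner \<pi> f f"
  have "(l * u x - gen_app K u x) * (u x - v x) * \<pi> x = 0" for x
  proof (cases "x \<in> A")
    case True
    then show ?thesis
      using laplace_in[OF gen_K True] laplace_in[OF gen_L True] by (simp add: u_def v_def)
  next
    case False
    then show ?thesis
      using laplace_out[OF gen_K False l] by (simp add: u_def)
  qed
  then have cross: "pi_inner \<pi> (\<lambda>x. l * u x - gen_app K u x) (\<lambda>x. u x - v x) = 0"
    unfolding pi_inner_def by (intro sum.neutral ballI)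
  have "?E (\<lambda>x. u x - v x) = ?E v - ?E u + 2 * pi_inner \<pi> (\<lambda>x. l * u x - gen_app K u x) (\<lambda>x. u x - v x)"
  proof -
    have "dirichlet \<pi> K (\<lambda>x. u x - v x) =
        dirichlet \<pi> K u + 2 * pi_inner \<pi> (gen_app K u) v + dirichlet \<pi> K v"
      by (simp add: dirichlet_K_diff pi_inner_minus_left)
    moreover have "dirichlet \<pi> K u = - pi_inner \<pi> (gen_app K u) u"
      by (simp add: dirichlet_def pi_inner_minus_left)
    moreover have "l * pi_inner \<pi> (\<lambda>x. u x - v x) (\<lambda>x. u x - v x) =
        l * pi_inner \<pi> u u - 2 * (l * pi_inner \<pi> u v) + l * pi_inner \<pi> v v"
      by (simp add: pi_inner_diff_left pi_inner_diff_right pi_inner_commute[of \<pi> v u] algebra_simps)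
    moreover have "pi_inner \<pi> (\<lambda>x. l * u x - gen_app K u x) (\<lambda>x. u x - v x) =
        l * pi_inner \<pi> u u - l * pi_inner \<pi> u v - pi_inner \<pi> (gen_app K u) u + pi_inner \<pi> (gen_app K u) v"
      by (simp add: pi_inner_diff_left pi_inner_diff_right pi_inner_cmult_left)
    ultimately show ?thesis by linarith
  qed
  moreover have "0 \<le> ?E (\<lambda>x. u x - v x)"
    using dirichlet_nonneg[OF gen_K stat_K] pi_inner_self_nonneg[of \<pi>] pi_nonneg l
    by (intro add_nonneg_nonneg mult_nonneg_nonneg) auto
  ultimately have "?E u \<le> ?E v" using cross by simp
  also have "\<dots> \<le> dirichlet \<pi> L v + l * pi_inner \<pi> v v"
    using form_le[of v] by simp
  finally have "l * laplace_hitting l A K \<pi> \<le> l * laplace_hitting l A L \<pi>"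
    using resolvent_energy[OF gen_K stat_K l, of A] resolvent_energy[OF gen_L stat_L l, of A]
    by (simp add: u_def v_def)
  then show ?thesis using l by simp
qed

end

lemma mean_hitting_LIMSEQ:
  assumes "prob_vector \<pi>"
  shows "(\<lambda>n. ennreal (real (Suc n) * (1 - laplace_hitting (1 / real (Suc n)) A G \<pi>)))
    \<longlonglongrightarrow> mean_hitting A G \<pi>"
proof -
  have pi: "0 \<le> \<pi> x" "(\<Sum>x\<in>UNIV. \<pi> x) = 1" for x
    using assms by (auto simp: prob_vector_def)
  have le1: "laplace l A G x \<le> 1" if "0 < l" for l x
  proof -
    interpret C: prob_space "chain_space G" by (rule prob_space_chain_space)
    have "laplace l A G x \<le> (\<integral>\<omega>. 1 \<partial>chain_space G)"
      unfolding laplace_def using that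
      by (intro integral_mono integrable_exp_neg_mult exp_neg_mult_le_1) auto
    then show ?thesis by (simp add: C.prob_space)
  qed
  have "(\<lambda>n. \<Sum>x\<in>UNIV. ennreal (\<pi> x) * ennreal (real (Suc n) * (1 - laplace (1 / real (Suc n)) A G x)))
      \<longlonglongrightarrow> (\<Sum>x\<in>UNIV. ennreal (\<pi> x) * expected_hitting A G x)"
    by (intro tendsto_sum ennreal_tendsto_cmult expected_hitting_LIMSEQ) simp
  moreover have "(\<Sum>x\<in>UNIV. ennreal (\<pi> x) * ennreal (real (Suc n) * (1 - laplace (1 / real (Suc n)) A G x))) =
      ennreal (real (Suc n) * (1 - laplace_hitting (1 / real (Suc n)) A G \<pi>))" for n
  proof -
    let ?c = "real (Suc n)" and ?u = "laplace (1 / real (Suc n)) A G"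
    have "(\<Sum>x\<in>UNIV. ennreal (\<pi> x) * ennreal (?c * (1 - ?u x))) = (\<Sum>x\<in>UNIV. ennreal (\<pi> x * (?c * (1 - ?u x))))"
      using pi le1 by (intro sum.cong refl) (simp add: ennreal_mult[symmetric] del: of_nat_Suc)
    also have "\<dots> = ennreal (\<Sum>x\<in>UNIV. \<pi> x * (?c * (1 - ?u x)))"
      using pi le1 by (intro sum_ennreal mult_nonneg_nonneg) (auto simp del: of_nat_Suc)
    also have "(\<Sum>x\<in>UNIV. \<pi> x * (?c * (1 - ?u x))) = ?c * ((\<Sum>x\<in>UNIV. \<pi> x) - (\<Sum>x\<in>UNIV. \<pi> x * ?u x))"
      by (simp add: sum_distrib_left sum_subtractf[symmetric] algebra_simps del: of_nat_Suc)
    finally show ?thesis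
      by (simp add: pi laplace_hitting_def laplace_def del: of_nat_Suc)
  qed
  ultimately show ?thesis by (simp add: mean_hitting_def)
qed

context form_comparison
begin

lemma mean_hitting_ge: "mean_hitting A L \<pi> \<le> mean_hitting A K \<pi>"
proof (rule LIMSEQ_le)
  have "prob_vector \<pi>" using stat_L by (simp add: stationary_def)
  then show "(\<lambda>n. ennreal (real (Suc n) * (1 - laplace_hitting (1 / real (Suc n)) A L \<pi>)))
      \<longlonglongrightarrow> mean_hitting A L \<pi>"
    "(\<lambda>n. ennreal (real (Suc n) * (1 - laplace_hitting (1 / real (Suc n)) A K \<pi>)))
      \<longlonglongrightarrow> mean_hitting A K \<pi>"
    by (rule mean_hitting_LIMSEQ)+
  show "\<exists>N. \<forall>n\<ge>N. ennreal (real (Suc n) * (1 - laplace_hitting (1 / real (Suc n)) A L \<pi>))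
      \<le> ennreal (real (Suc n) * (1 - laplace_hitting (1 / real (Suc n)) A K \<pi>))"
    by (intro exI allI impI ennreal_leI mult_left_mono diff_left_mono laplace_hitting_le) auto
qed

lemma t_av_ge: "t_av L \<pi> \<le> t_av K \<pi>"
proof -
  have eq: "t_av G \<pi> = (\<Sum>y\<in>UNIV. ennreal (\<pi> y) * mean_hitting {y} G \<pi>)" for G
    unfolding t_av_def mean_hitting_def
    by (subst sum.swap) (simp add: sum_distrib_left mult_ac)
  show ?thesis unfolding eq by (intro sum_mono mult_left_mono mean_hitting_ge) simp
qed

section \<open>Spectral gap\<close>

lemma spectral_gap_le: "spectral_gap K \<pi> \<le> spectral_gap L \<pi>"
  unfolding spectral_gap_def dirichlet_def[symmetric]
  by (rule INF_mono) (use form_le in auto)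

lemma t_rel_ge: "t_rel L \<pi> \<le> t_rel K \<pi>"
proof -
  have "0 \<le> spectral_gap K \<pi>"
    unfolding spectral_gap_def dirichlet_def[symmetric]
    by (rule INF_greatest) (simp add: dirichlet_nonneg[OF gen_K stat_K])
  then show ?thesis
    unfolding t_rel_def divide_ereal_def
    using ereal_inverse_antimono[OF _ spectral_gap_le] by simp
qed

section \<open>Asymptotic variance and commute times\<close>

text \<open>
  This is the nonnegativity of \<open>E_K\<close> at \<open>g - g'\<close>. By reversibility the mixed term is
  \<open>\<langle>h, g'\<rangle>\<close>, so only the energy of \<open>g'\<close> has to be passed from \<open>K\<close> to \<open>L\<close>.
\<close>

lemma poisson_energy_le:
  assumes "gen_app K g = h" "gen_app L g' = h"
  shows "- pi_inner \<pi> h g' \<le> - pi_inner \<pi> h g"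
proof -
  have "0 \<le> dirichlet \<pi> K (\<lambda>x. g x - g' x)"
    by (rule dirichlet_nonneg[OF gen_K stat_K])
  also have "\<dots> = dirichlet \<pi> K g + 2 * pi_inner \<pi> h g' + dirichlet \<pi> K g'"
    by (simp add: dirichlet_K_diff assms pi_inner_minus_left)
  also have "dirichlet \<pi> K g = - pi_inner \<pi> h g"
    by (simp add: dirichlet_def assms pi_inner_minus_left)
  also have "dirichlet \<pi> K g' \<le> dirichlet \<pi> L g'" by (rule form_le)
  also have "dirichlet \<pi> L g' = - pi_inner \<pi> h g'"
    by (simp add: dirichlet_def assms pi_inner_minus_left)
  finally show ?thesis by simp
qed

lemma asymptotic_variance_ge:
  assumes "mean \<pi> h = 0"
  shows "asymptotic_variance h L \<pi> \<le> asymptotic_variance h K \<pi>"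
proof (cases "\<exists>g. gen_app K g = h")
  case True
  have L: "\<exists>g. gen_app L g = h"
    by (rule poisson_solvable[OF gen_L irr_L stat_L assms])
  from poisson_energy_le[OF someI_ex[OF True] someI_ex[OF L]] show ?thesis
    using True L by (simp add: asymptotic_variance_def)
next
  case False
  then show ?thesis by (simp add: asymptotic_variance_def)
qed

end

text \<open>
  The approximations \<open>m n = (1 - u) / l\<close> of the expected hitting time, with \<open>l = 1 / (n + 1)\<close>, vanish at
  \<open>y\<close> and solve \<open>G m = l m - 1\<close> elsewhere. A solution \<open>w\<close> of the limiting equation exists by
  \<open>poisson_solvable\<close> and dominates them all by the minimum principle, which makes the expectations
  finite; the equation then passes to the limit.
\<close>

lemma hitting_point_equation:
  fixes G :: "'a::finite \<Rightarrow> 'a \<Rightarrow> real"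
  assumes G: "markov_generator G" "irreducible_generator G" "stationary G \<pi>"
  obtains m where "\<And>x. expected_hitting {y} G x = ennreal (m x)" "\<And>x. 0 \<le> m x" "m y = 0"
    "\<And>x. gen_app G m x = of_bool (x = y) / \<pi> y - 1"
proof -
  have pos: "0 < \<pi> x" for x by (rule stationary_pos[OF G])
  have total: "(\<Sum>x\<in>UNIV. \<pi> x) = 1" using G(3) by (simp add: stationary_def prob_vector_def)
  have "mean \<pi> (\<lambda>x. of_bool (x = y) / \<pi> y - 1) = 0"
  proof -
    have "mean \<pi> (\<lambda>x. of_bool (x = y) / \<pi> y - 1) = (\<Sum>x\<in>UNIV. of_bool (x = y) - \<pi> x)"
      unfolding mean_def by (rule sum.cong[OF refl]) (use pos[of y] in \<open>simp add: field_simps\<close>)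
    then show ?thesis by (simp add: sum_subtractf total)
  qed
  then obtain g where g: "gen_app G g = (\<lambda>x. of_bool (x = y) / \<pi> y - 1)"
    using poisson_solvable[OF G] by blast
  define w where "w = (\<lambda>x. g x - g y)"
  have w_y: "w y = 0" by (simp add: w_def)
  have w_eq: "gen_app G w x = of_bool (x = y) / \<pi> y - 1" for x
    by (simp add: w_def gen_app_diff gen_app_const[OF G(1)] g)
  \<comment> \<open>Superharmonic functions off \<open>y\<close> take their minimum at \<open>y\<close>.\<close>
  have minimum: "0 \<le> f x" if "f y = 0" "\<And>z. z \<noteq> y \<Longrightarrow> f z < 0 \<Longrightarrow> gen_app G f z < 0" for f x
  proof (rule ccontr)
    assume neg: "\<not> 0 \<le> f x"
    have "Min (range f) \<in> range f" by (rule Min_in) auto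
    then obtain z where z: "Min (range f) = f z" by (rule rangeE)
    have min: "f z \<le> f v" for v by (simp flip: z)
    with neg have "f z < 0" by (meson not_le order.strict_trans1)
    moreover from this that(1) have "z \<noteq> y" by auto
    ultimately have "gen_app G f z < 0" by (rule that(2)[rotated])
    moreover have "gen_app G (\<lambda>x. - 1 * f x) z \<le> 0"
      by (rule gen_app_at_max_le_0[OF G(1)]) (simp add: min)
    ultimately show False by (simp only: gen_app_cmult)
  qed
  define m where "m = (\<lambda>n x. real (Suc n) * (1 - laplace (1 / real (Suc n)) {y} G x))"
  have m_y: "m n y = 0" for n
    by (simp add: m_def laplace_in[OF G(1)])
  have m_eq: "gen_app G (m n) x = m n x / real (Suc n) - 1" if "x \<noteq> y" for n x
  proof -
    have "gen_app G (m n) x = real (Suc n) * (0 - gen_app G (laplace (1 / real (Suc n)) {y} G) x)"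
      unfolding m_def by (simp only: gen_app_cmult gen_app_diff gen_app_const[OF G(1)])
    also have "\<dots> = real (Suc n) * (0 - 1 / real (Suc n) * laplace (1 / real (Suc n)) {y} G x)"
      using that by (subst laplace_out[OF G(1)]) auto
    also have "\<dots> = m n x / real (Suc n) - 1"
      by (simp add: m_def field_simps del: of_nat_Suc)
    finally show ?thesis .
  qed
  have w_nonneg: "0 \<le> w x" for x
    by (rule minimum) (auto simp: w_y w_eq)
  have m_nonneg: "0 \<le> m n x" for n x
  proof (rule minimum[of "m n", OF m_y])
    fix z assume "z \<noteq> y" "m n z < 0"
    then show "gen_app G (m n) z < 0" by (simp add: m_eq field_simps)
  qed
  have m_le_w: "m n x \<le> w x" for n x
  proof -
    have "0 \<le> w x - m n x"
    proof (rule minimum)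
      fix z assume "z \<noteq> y" "w z - m n z < 0"
      moreover have "0 < m n z" using w_nonneg[of z] \<open>w z - m n z < 0\<close> by simp
      ultimately show "gen_app G (\<lambda>x. w x - m n x) z < 0"
        by (simp add: gen_app_diff w_eq m_eq)
    qed (simp add: w_y m_y)
    then show ?thesis by simp
  qed
  have lim: "(\<lambda>n. ennreal (m n x)) \<longlonglongrightarrow> expected_hitting {y} G x" for x
    unfolding m_def by (rule expected_hitting_LIMSEQ)
  define M where "M = (\<lambda>x. enn2real (expected_hitting {y} G x))"
  have bound: "expected_hitting {y} G x \<le> ennreal (w x)" for x
    by (rule LIMSEQ_le_const2[OF lim]) (use m_le_w in \<open>auto intro: ennreal_leI\<close>)
  have M: "expected_hitting {y} G x = ennreal (M x)" for x
    using bound[of x] by (simp add: M_def top.extremum_unique less_top[symmetric] ennreal_enn2real_if)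
       (metis ennreal_neq_top infinity_ennreal_def top.extremum_unique)
  have M_nonneg: "0 \<le> M x" for x by (simp add: M_def)
  have m_lim: "(\<lambda>n. m n x) \<longlonglongrightarrow> M x" for x
    using lim[of x] unfolding M by (subst (asm) tendsto_ennreal_iff) (auto simp: m_nonneg M_nonneg)
  have M_y: "M y = 0"
    using LIMSEQ_unique[OF m_lim[of y]] by (simp add: m_y)
  have M_off: "gen_app G M x = - 1" if "x \<noteq> y" for x
  proof (rule LIMSEQ_unique)
    show "(\<lambda>n. gen_app G (m n) x) \<longlonglongrightarrow> gen_app G M x"
      unfolding gen_app_def by (intro tendsto_intros m_lim)
    have "(\<lambda>n. m n x * inverse (real (Suc n)) - 1) \<longlonglongrightarrow> M x * 0 - 1"
      by (intro tendsto_intros m_lim LIMSEQ_inverse_real_of_nat)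
    then show "(\<lambda>n. gen_app G (m n) x) \<longlonglongrightarrow> - 1"
      using that by (simp add: m_eq divide_inverse)
  qed
  \<comment> \<open>The value at \<open>y\<close> is forced by stationarity.\<close>
  have "0 = mean \<pi> (gen_app G M)" using mean_gen_app[OF G(3)] by simp
  also have "\<dots> = gen_app G M y * \<pi> y + (\<Sum>x\<in>UNIV - {y}. gen_app G M x * \<pi> x)"
    unfolding mean_def by (rule sum.remove) auto
  also have "(\<Sum>x\<in>UNIV - {y}. gen_app G M x * \<pi> x) = (\<Sum>x\<in>UNIV - {y}. - \<pi> x)"
    by (rule sum.cong) (auto simp: M_off)
  also have "\<dots> = \<pi> y - 1"
    by (simp add: sum_negf sum_diff1 total)
  finally have "gen_app G M y = 1 / \<pi> y - 1"
    using pos[of y] by (simp add: field_simps)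
  with M_off have "gen_app G M x = of_bool (x = y) / \<pi> y - 1" for x
    by (cases "x = y") auto
  then show ?thesis using that M M_nonneg M_y by blast
qed

text \<open>
  The potential is the difference of the expected hitting times of \<open>y\<close> and of \<open>x\<close>. In \<open>G g\<close> the two
  constants \<open>- 1\<close> cancel, and \<open>g(x) - g(y)\<close> is the commute time because each hitting time vanishes at
  its own target.
\<close>

lemma t_com_eq_poisson:
  fixes x y :: "'a::finite"
  assumes G: "markov_generator G" "irreducible_generator G" "stationary G \<pi>" and "x \<noteq> y"
  defines "h \<equiv> \<lambda>z. of_bool (z = y) / \<pi> y - of_bool (z = x) / \<pi> x"
  shows "\<exists>g. gen_app G g = h \<and> t_com x y G = ennreal (- pi_inner \<pi> h g)"
proof -
  have pos: "0 < \<pi> x" for x by (rule stationary_pos[OF G])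
  obtain m where m: "\<And>z. expected_hitting {y} G z = ennreal (m z)" "\<And>z. 0 \<le> m z" "m y = 0"
      "\<And>z. gen_app G m z = of_bool (z = y) / \<pi> y - 1"
    by (rule hitting_point_equation[OF G, of y]) blast
  obtain m' where m': "\<And>z. expected_hitting {x} G z = ennreal (m' z)" "\<And>z. 0 \<le> m' z" "m' x = 0"
      "\<And>z. gen_app G m' z = of_bool (z = x) / \<pi> x - 1"
    by (rule hitting_point_equation[OF G, of x]) blast
  define g where "g = (\<lambda>z. m z - m' z)"
  have "gen_app G g = h"
    by (rule ext) (simp add: g_def h_def gen_app_diff m(4) m'(4))
  moreover have "pi_inner \<pi> h g = (\<Sum>z\<in>UNIV. (of_bool (z = y) - of_bool (z = x)) * g z)"
    unfolding pi_inner_def h_def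
    by (rule sum.cong[OF refl]) (use pos[of x] pos[of y] in \<open>auto simp: field_simps\<close>)
  then have "pi_inner \<pi> h g = g y - g x"
    by (simp add: left_diff_distrib sum_subtractf)
  then have "t_com x y G = ennreal (- pi_inner \<pi> h g)"
    using m m' by (simp add: t_com_def g_def flip: ennreal_plus)
  ultimately show ?thesis by blast
qed

context form_comparison
begin

lemma t_com_ge:
  assumes "irreducible_generator K" "x \<noteq> y"
  shows "t_com x y L \<le> t_com x y K"
  using t_com_eq_poisson[OF gen_K assms(1) stat_K assms(2)]
    t_com_eq_poisson[OF gen_L irr_L stat_L assms(2)]
    poisson_energy_le
  by (metis ennreal_leI)

section \<open>Large deviations\<close>

text \<open>
  Reversibility symmetrises \<open>\<Sum> \<pi>(x) K(x,y) f(x)\<^sup>2 u(y) / u(x)\<close>, and the mean of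
  \<open>f(x)\<^sup>2 u(y) / u(x)\<close> and \<open>f(y)\<^sup>2 u(x) / u(y)\<close> is at least \<open>f(x) f(y)\<close>.
\<close>

lemma rate_function_le_dirichlet:
  assumes "prob_vector \<nu>"
  shows "rate_function K \<nu> \<le> ereal (dirichlet \<pi> K (\<lambda>x. sqrt (\<nu> x / \<pi> x)))"
  unfolding rate_function_def
proof (rule SUP_least)
  fix u :: "'a \<Rightarrow> real" assume "u \<in> {u. \<forall>x. 0 < u x}"
  then have u: "0 < u x" for x by simp
  define f where "f = (\<lambda>x. sqrt (\<nu> x / \<pi> x))"
  have f2: "\<nu> x = \<pi> x * (f x)\<^sup>2" for x
    using assms pi_pos[of x] by (simp add: f_def prob_vector_def)
  have f0: "0 \<le> f x" for x
    using assms pi_pos[of x] by (simp add: f_def prob_vector_def)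
  let ?c = "\<lambda>x y. \<pi> x * K x y"
  have amgm: "?c x y * (2 * f x * f y) \<le> ?c x y * ((f x)\<^sup>2 * (u y / u x) + (f y)\<^sup>2 * (u x / u y))" for x y
  proof (cases "x = y")
    case False
    have "0 \<le> (f x * u y - f y * u x)\<^sup>2 / (u x * u y)"
      using u[of x] u[of y] by (intro divide_nonneg_nonneg) auto
    also have "\<dots> = (f x)\<^sup>2 * (u y / u x) + (f y)\<^sup>2 * (u x / u y) - 2 * f x * f y"
      using u[of x] u[of y] by (simp add: field_simps power2_eq_square)
    finally show ?thesis
      using False gen_K pi_nonneg[of x] by (intro mult_left_mono) (auto simp: markov_generator_def)
  next
    case True
    then show ?thesis using u[of x] by (simp add: power2_eq_square)
  qed
  have "2 * (\<Sum>x\<in>UNIV. \<Sum>y\<in>UNIV. ?c x y * f x * f y) = (\<Sum>x\<in>UNIV. \<Sum>y\<in>UNIV. ?c x y * (2 * f x * f y))"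
    by (simp add: sum_distrib_left mult_ac)
  also have "\<dots> \<le> (\<Sum>x\<in>UNIV. \<Sum>y\<in>UNIV. ?c x y * ((f x)\<^sup>2 * (u y / u x) + (f y)\<^sup>2 * (u x / u y)))"
    by (intro sum_mono amgm)
  also have "\<dots> = (\<Sum>x\<in>UNIV. \<Sum>y\<in>UNIV. ?c x y * ((f x)\<^sup>2 * (u y / u x))) +
      (\<Sum>x\<in>UNIV. \<Sum>y\<in>UNIV. ?c x y * ((f y)\<^sup>2 * (u x / u y)))"
    by (simp add: distrib_left sum.distrib)
  also have "(\<Sum>x\<in>UNIV. \<Sum>y\<in>UNIV. ?c x y * ((f y)\<^sup>2 * (u x / u y))) =
      (\<Sum>x\<in>UNIV. \<Sum>y\<in>UNIV. ?c y x * ((f y)\<^sup>2 * (u x / u y)))"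
    using rev_K by (simp add: reversible_def)
  also have "\<dots> = (\<Sum>x\<in>UNIV. \<Sum>y\<in>UNIV. ?c x y * ((f x)\<^sup>2 * (u y / u x)))"
    by (rule sum.swap)
  finally have "(\<Sum>x\<in>UNIV. \<Sum>y\<in>UNIV. ?c x y * f x * f y) \<le>
      (\<Sum>x\<in>UNIV. \<Sum>y\<in>UNIV. ?c x y * ((f x)\<^sup>2 * (u y / u x)))"
    by simp
  moreover have "(\<Sum>x\<in>UNIV. \<Sum>y\<in>UNIV. ?c x y * f x * f y) = - dirichlet \<pi> K f"
    by (simp add: dirichlet_def pi_inner_def gen_app_def sum_negf sum_distrib_left sum_distrib_right mult_ac)
  moreover have "(\<Sum>x\<in>UNIV. \<Sum>y\<in>UNIV. ?c x y * ((f x)\<^sup>2 * (u y / u x))) =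
      (\<Sum>x\<in>UNIV. \<nu> x * (gen_app K u x / u x))"
    by (simp add: gen_app_def f2 sum_distrib_left sum_divide_distrib mult_ac)
  ultimately show "ereal (- (\<Sum>x\<in>UNIV. \<nu> x * (gen_app K u x / u x))) \<le>
      ereal (dirichlet \<pi> K (\<lambda>x. sqrt (\<nu> x / \<pi> x)))"
    by (simp add: f_def)
qed

text \<open>
  The natural test function \<open>u = f\<close> may have zeros, so it is approximated by \<open>f + 1 / (n + 1)\<close>. The added
  constant is invisible to the generator, and \<open>f(x)\<^sup>2 / (f(x) + 1 / (n + 1))\<close> tends to \<open>f(x)\<close> even where
  \<open>f(x) = 0\<close>.
\<close>

lemma dirichlet_le_rate_function:
  assumes "prob_vector \<nu>"
  shows "ereal (dirichlet \<pi> L (\<lambda>x. sqrt (\<nu> x / \<pi> x))) \<le> rate_function L \<nu>"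
proof -
  define f where "f = (\<lambda>x. sqrt (\<nu> x / \<pi> x))"
  have f2: "\<nu> x = \<pi> x * (f x)\<^sup>2" for x
    using assms pi_pos[of x] by (simp add: f_def prob_vector_def)
  have f0: "0 \<le> f x" for x
    using assms pi_pos[of x] by (simp add: f_def prob_vector_def)
  let ?e = "\<lambda>n. inverse (real (Suc n))"
  let ?I = "\<lambda>n. - (\<Sum>x\<in>UNIV. \<nu> x * (gen_app L (\<lambda>z. f z + ?e n) x / (f x + ?e n)))"
  have "(\<lambda>n. \<nu> x * (gen_app L f x / (f x + ?e n))) \<longlonglongrightarrow> gen_app L f x * f x * \<pi> x" for x
  proof (cases "f x = 0")
    case True
    then show ?thesis by (simp add: f2)
  next
    case False
    have "(\<lambda>n. \<nu> x * (gen_app L f x / (f x + ?e n))) \<longlonglongrightarrow> \<nu> x * (gen_app L f x / (f x + 0))"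
      using False by (intro tendsto_intros LIMSEQ_inverse_real_of_nat) simp
    also have "\<nu> x * (gen_app L f x / (f x + 0)) = gen_app L f x * f x * \<pi> x"
      using False by (simp add: f2 power2_eq_square)
    finally show ?thesis .
  qed
  then have "(\<lambda>n. - (\<Sum>x\<in>UNIV. \<nu> x * (gen_app L f x / (f x + ?e n)))) \<longlonglongrightarrow>
      - (\<Sum>x\<in>UNIV. gen_app L f x * f x * \<pi> x)"
    by (intro tendsto_minus tendsto_sum)
  then have "?I \<longlonglongrightarrow> dirichlet \<pi> L f"
    by (simp only: gen_app_add gen_app_const[OF gen_L])
       (simp add: dirichlet_def pi_inner_def sum_negf)
  then have "(\<lambda>n. ereal (?I n)) \<longlonglongrightarrow> ereal (dirichlet \<pi> L f)"
    by (rule tendsto_ereal)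
  then have "ereal (dirichlet \<pi> L f) \<le> rate_function L \<nu>"
  proof (rule LIMSEQ_le_const2)
    have "ereal (?I n) \<le> rate_function L \<nu>" for n
      unfolding rate_function_def
      by (rule SUP_upper) (use f0 in \<open>auto intro: add_nonneg_pos\<close>)
    then show "\<exists>N. \<forall>n\<ge>N. ereal (?I n) \<le> rate_function L \<nu>" by blast
  qed
  then show ?thesis by (simp add: f_def)
qed

lemma rate_function_le:
  assumes "prob_vector \<nu>"
  shows "rate_function K \<nu> \<le> rate_function L \<nu>"
proof -
  have "rate_function K \<nu> \<le> ereal (dirichlet \<pi> K (\<lambda>x. sqrt (\<nu> x / \<pi> x)))"
    by (rule rate_function_le_dirichlet[OF assms])
  also have "\<dots> \<le> ereal (dirichlet \<pi> L (\<lambda>x. sqrt (\<nu> x / \<pi> x)))"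
    using form_le by simp
  also have "\<dots> \<le> rate_function L \<nu>"
    by (rule dirichlet_le_rate_function[OF assms])
  finally show ?thesis .
qed

end

section \<open>Capacity\<close>

text \<open>
  The function \<open>1 - h\<close> is \<open>1\<close> on \<open>A\<close> and \<open>0\<close> on \<open>B\<close>, and \<open>G h\<close> vanishes elsewhere. Hence the sum over
  \<open>A\<close> is \<open>\<langle>G h, 1 - h\<rangle>\<close>, and stationarity leaves \<open>- \<langle>G h, h\<rangle>\<close>.
\<close>

lemma capacity_eq_dirichlet:
  assumes G: "markov_generator G" and s: "stationary G \<pi>" and "A \<inter> B = {}"
  shows "capacity A B G \<pi> = dirichlet \<pi> G (hits_first G A B)"
proof -
  define h where "h = hits_first G A B"
  have "(1 - h x) * gen_app G h x * \<pi> x = (if x \<in> A then \<pi> x * gen_app G h x else 0)" for x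
    using hits_first_A[OF G, of x A B] hits_first_B[OF G, of x B A] hits_first_harmonic[OF G, of x A B]
    by (cases "x \<in> A"; cases "x \<in> B") (simp_all add: h_def)
  then have "(\<Sum>x\<in>UNIV. (1 - h x) * gen_app G h x * \<pi> x) = (\<Sum>x\<in>A. \<pi> x * gen_app G h x)"
    by (simp add: sum.If_cases)
  also have "\<dots> = capacity A B G \<pi>"
    by (simp add: capacity_eq[OF G] h_def)
  also have "(\<Sum>x\<in>UNIV. (1 - h x) * gen_app G h x * \<pi> x) = mean \<pi> (gen_app G h) + dirichlet \<pi> G h"
    by (simp add: mean_def dirichlet_def pi_inner_def left_diff_distrib right_diff_distrib sum_subtractf sum_negf mult_ac)
  finally show ?thesis
    by (simp add: mean_gen_app[OF s] h_def)
qed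

context form_comparison
begin

text \<open>
  The two equilibrium potentials agree on \<open>A\<close> and on \<open>B\<close>, and \<open>K h\<close> vanishes elsewhere, so that \<open>h\<close>
  minimises the energy of \<open>K\<close> for these boundary values.
\<close>

lemma capacity_le:
  assumes "A \<inter> B = {}"
  shows "capacity A B K \<pi> \<le> capacity A B L \<pi>"
proof -
  define h where "h = hits_first K A B"
  define k where "k = hits_first L A B"
  have "gen_app K h x * (h x - k x) * \<pi> x = 0" for x
    using hits_first_A[OF gen_K, of x A B] hits_first_B[OF gen_K, of x B A]
      hits_first_A[OF gen_L, of x A B] hits_first_B[OF gen_L, of x B A]
      hits_first_harmonic[OF gen_K, of x A B]
    by (cases "x \<in> A"; cases "x \<in> B") (simp_all add: h_def k_def)
  then have "pi_inner \<pi> (gen_app K h) (\<lambda>x. h x - k x) = 0"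
    unfolding pi_inner_def by (intro sum.neutral ballI)
  then have "pi_inner \<pi> (gen_app K h) k = pi_inner \<pi> (gen_app K h) h"
    by (simp add: pi_inner_diff_right)
  then have "dirichlet \<pi> K (\<lambda>x. h x - k x) = dirichlet \<pi> K k - dirichlet \<pi> K h"
    by (simp add: dirichlet_K_diff) (simp add: dirichlet_def pi_inner_minus_left)
  then have "dirichlet \<pi> K h \<le> dirichlet \<pi> K k"
    using dirichlet_nonneg[OF gen_K stat_K, of "\<lambda>x. h x - k x"] by simp
  also have "\<dots> \<le> dirichlet \<pi> L k" by (rule form_le)
  finally show ?thesis
    using capacity_eq_dirichlet[OF gen_K stat_K assms] capacity_eq_dirichlet[OF gen_L stat_L assms]
    by (simp add: h_def k_def)
qed

end

section \<open>Mixing times\<close>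

lemma gen_app_sum: "gen_app G (\<lambda>x. \<Sum>i\<in>I. f i x) x = (\<Sum>i\<in>I. gen_app G (f i) x)"
  unfolding gen_app_def sum_distrib_left by (rule sum.swap)

text \<open>
  Gronwall's argument for \<open>exp (2 c t) * \<langle>v, v\<rangle>\<close>. With the spectral gap as \<open>c\<close> it gives the decay of the
  variance; with \<open>c = 0\<close> it gives uniqueness for the backward equation.
\<close>

lemma energy_decay:
  fixes v :: "real \<Rightarrow> 'a::finite \<Rightarrow> real"
  assumes T: "0 \<le> T"
    and deriv: "\<And>t x. 0 \<le> t \<Longrightarrow> t \<le> T \<Longrightarrow>
      ((\<lambda>t. v t x) has_real_derivative gen_app G (v t) x) (at t within {0..T})"
    and gap: "\<And>t. 0 \<le> t \<Longrightarrow> t \<le> T \<Longrightarrow> c * pi_inner \<pi> (v t) (v t) \<le> dirichlet \<pi> G (v t)"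
  shows "exp (2 * c * T) * pi_inner \<pi> (v T) (v T) \<le> pi_inner \<pi> (v 0) (v 0)"
proof -
  define \<phi> where "\<phi> = (\<lambda>t. exp (2 * c * t) * pi_inner \<pi> (v t) (v t))"
  have D: "(\<phi> has_real_derivative
      2 * exp (2 * c * t) * (c * pi_inner \<pi> (v t) (v t) - dirichlet \<pi> G (v t))) (at t within {0..T})"
    if t: "0 \<le> t" "t \<le> T" for t
  proof -
    have "((\<lambda>t. pi_inner \<pi> (v t) (v t)) has_real_derivative
        (\<Sum>x\<in>UNIV. 2 * gen_app G (v t) x * v t x * \<pi> x)) (at t within {0..T})"
      unfolding pi_inner_def
    proof (rule DERIV_sum)
      fix x
      show "((\<lambda>t. v t x * v t x * \<pi> x) has_real_derivative 2 * gen_app G (v t) x * v t x * \<pi> x)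
          (at t within {0..T})"
        using DERIV_cmult_right[OF DERIV_mult[OF deriv[OF t] deriv[OF t]], of x x "\<pi> x"]
        by (simp add: algebra_simps)
    qed
    moreover have "(\<Sum>x\<in>UNIV. 2 * gen_app G (v t) x * v t x * \<pi> x) = - 2 * dirichlet \<pi> G (v t)"
      by (simp add: dirichlet_def pi_inner_def sum_negf sum_distrib_left mult_ac)
    ultimately have N: "((\<lambda>t. pi_inner \<pi> (v t) (v t)) has_real_derivative
        - 2 * dirichlet \<pi> G (v t)) (at t within {0..T})"
      by simp
    show ?thesis
      unfolding \<phi>_def by (rule derivative_eq_intros N refl)+ (simp add: algebra_simps)
  qed
  have "\<phi> T \<le> \<phi> 0"
  proof (rule DERIV_nonpos_imp_decreasing_open[OF T])
    fix t assume t: "0 < t" "t < T"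
    then have "DERIV \<phi> t :> 2 * exp (2 * c * t) * (c * pi_inner \<pi> (v t) (v t) - dirichlet \<pi> G (v t))"
      using D[of t] by (simp add: at_within_Icc_at)
    moreover have "2 * exp (2 * c * t) * (c * pi_inner \<pi> (v t) (v t) - dirichlet \<pi> G (v t)) \<le> 0"
      using gap[of t] t by (intro mult_nonneg_nonpos) auto
    ultimately show "\<exists>y. DERIV \<phi> t :> y \<and> y \<le> 0" by blast
  next
    show "continuous_on {0..T} \<phi>"
      by (rule DERIV_continuous_on[OF D]) auto
  qed
  then show ?thesis by (simp add: \<phi>_def)
qed

text \<open>
  The deviation \<open>P_t(x, y) - \<pi>(y)\<close> solves the backward equation in \<open>x\<close>, its mean is zero at all times
  by stationarity, and its initial energy is at most \<open>1\<close>. A single value is recovered from the energy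
  at the price of the factor \<open>1 / sqrt (\<pi> x)\<close>.
\<close>

lemma transition_deviation_decay:
  assumes G: "markov_generator G" and s: "stationary G \<pi>" and pos: "\<And>x. 0 < \<pi> x"
    and T: "0 \<le> T" and gap: "\<And>f. mean \<pi> f = 0 \<Longrightarrow> c * pi_inner \<pi> f f \<le> dirichlet \<pi> G f"
  shows "mean \<pi> (\<lambda>x. transition G T x y - \<pi> y) = 0"
    and "\<bar>transition G T x y - \<pi> y\<bar> \<le> exp (- c * T) / sqrt (\<pi> x)"
proof -
  have total: "(\<Sum>x\<in>UNIV. \<pi> x) = 1" using s by (simp add: stationary_def prob_vector_def)
  define v where "v = (\<lambda>t x. transition G t x y - \<pi> y)"
  have D: "((\<lambda>t. v t x) has_real_derivative gen_app G (v t) x) (at t within {0..T})"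
    if "0 \<le> t" "t \<le> T" for t x
  proof -
    have "((\<lambda>t. v t x) has_real_derivative gen_app G (\<lambda>z. transition G t z y) x - 0) (at t within {0..T})"
      unfolding v_def by (intro DERIV_diff transition_has_derivative[OF G that] DERIV_const)
    then show ?thesis
      by (simp add: v_def gen_app_diff gen_app_const[OF G])
  qed
  have mean_0: "mean \<pi> (v 0) = 0"
    by (simp add: mean_def v_def transition_0[OF G] left_diff_distrib sum_subtractf total flip: sum_distrib_left)
  have mean_t: "mean \<pi> (v t) = 0" if t: "0 \<le> t" "t \<le> T" for t
  proof -
    have "\<exists>d. \<forall>t\<in>{0..T}. mean \<pi> (v t) = d"
    proof (rule has_field_derivative_zero_constant)
      fix t assume t: "t \<in> {0..T}"
      have "((\<lambda>t. mean \<pi> (v t)) has_real_derivative mean \<pi> (gen_app G (v t))) (at t within {0..T})"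
        unfolding mean_def using t by (intro DERIV_sum DERIV_cmult_right D) auto
      then show "((\<lambda>t. mean \<pi> (v t)) has_real_derivative 0) (at t within {0..T})"
        by (simp add: mean_gen_app[OF s])
    qed simp
    then show ?thesis using mean_0 t T by fastforce
  qed
  then show "mean \<pi> (\<lambda>x. transition G T x y - \<pi> y) = 0"
    using T by (simp add: v_def)
  have pi_le: "\<pi> y \<le> 1"
    using total pos by (metis UNIV_I finite less_imp_le member_le_sum)
  have "pi_inner \<pi> (v 0) (v 0) \<le> (\<Sum>x\<in>UNIV. 1 * \<pi> x)"
    unfolding pi_inner_def
  proof (intro sum_mono mult_right_mono)
    fix x
    have "\<bar>v 0 x\<bar> \<le> 1" using pi_le pos[of y] by (simp add: v_def transition_0[OF G] of_bool_def)
    then show "v 0 x * v 0 x \<le> 1" by (metis abs_square_le_1 power2_eq_square)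
  qed (simp add: pos less_imp_le)
  then have start: "pi_inner \<pi> (v 0) (v 0) \<le> 1" by (simp add: total)
  have "exp (2 * c * T) * (v T x * v T x * \<pi> x) \<le> exp (2 * c * T) * pi_inner \<pi> (v T) (v T)"
    unfolding pi_inner_def
    by (intro mult_left_mono member_le_sum mult_nonneg_nonneg[OF zero_le_square] less_imp_le[OF pos]) simp_all
  also have "\<dots> \<le> pi_inner \<pi> (v 0) (v 0)"
    by (rule energy_decay[OF T D]) (auto intro: gap mean_t)
  also note start
  also have "exp (2 * c * T) = (exp (c * T))\<^sup>2"
    by (simp add: exp_double[symmetric] mult.assoc)
  also have "v T x * v T x * \<pi> x = (\<bar>v T x\<bar> * sqrt (\<pi> x))\<^sup>2"
    by (simp only: power_mult_distrib power2_abs real_sqrt_pow2[OF less_imp_le[OF pos]])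
       (simp only: power2_eq_square)
  finally have "(exp (c * T) * (\<bar>v T x\<bar> * sqrt (\<pi> x)))\<^sup>2 \<le> 1\<^sup>2"
    by (simp add: power_mult_distrib)
  then have "exp (c * T) * (\<bar>v T x\<bar> * sqrt (\<pi> x)) \<le> 1"
    by (rule power2_le_imp_le) simp
  then have "\<bar>v T x\<bar> \<le> exp (- c * T) / sqrt (\<pi> x)"
    using pos[of x] by (simp add: exp_minus field_simps)
  then show "\<bar>transition G T x y - \<pi> y\<bar> \<le> exp (- c * T) / sqrt (\<pi> x)"
    by (simp add: v_def)
qed

text \<open>
  By uniqueness for the backward equation the semigroup multiplies \<open>f\<close> by \<open>exp (- c T)\<close>. At a state
  where \<open>\<bar>f\<bar>\<close> is maximal this factor is at most twice the total variation distance, since \<open>f\<close> has mean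
  zero.
\<close>

lemma eigenfunction_contraction:
  assumes G: "markov_generator G" and s: "stationary G \<pi>" and pos: "\<And>x. 0 < \<pi> x"
    and f: "mean \<pi> f = 0" "f z \<noteq> 0" and eigen: "\<And>x. gen_app G f x = - c * f x"
    and T: "0 \<le> T" and mixed: "\<And>x. tv_dist (transition G T x) \<pi> < 1 / 4"
  shows "exp (- c * T) < 1 / 2"
proof -
  define v where "v = (\<lambda>t x. (\<Sum>y\<in>UNIV. transition G t x y * f y) - exp (- c * t) * f x)"
  have D: "((\<lambda>t. v t x) has_real_derivative gen_app G (v t) x) (at t within {0..T})"
    if "0 \<le> t" "t \<le> T" for t x
  proof -
    have "((\<lambda>t. v t x) has_real_derivative
        (\<Sum>y\<in>UNIV. gen_app G (\<lambda>z. transition G t z y) x * f y) - (- c * exp (- c * t)) * f x)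
        (at t within {0..T})"
      unfolding v_def
      by (intro DERIV_diff DERIV_sum DERIV_cmult_right transition_has_derivative[OF G that])
         (auto intro!: derivative_eq_intros)
    moreover have "gen_app G (\<lambda>z. transition G t z y * f y) x = gen_app G (\<lambda>z. transition G t z y) x * f y" for y
      using gen_app_cmult[of G "f y" "\<lambda>z. transition G t z y" x] by (simp add: mult_ac)
    then have "gen_app G (v t) x =
        (\<Sum>y\<in>UNIV. gen_app G (\<lambda>z. transition G t z y) x * f y) - exp (- c * t) * (- c * f x)"
      unfolding v_def by (simp only: gen_app_diff gen_app_sum gen_app_cmult eigen)
    ultimately show ?thesis by (simp add: mult_ac)
  qed
  have "v 0 = (\<lambda>x. 0)"
    by (rule ext) (simp add: v_def transition_0[OF G])
  then have "exp (2 * 0 * T) * pi_inner \<pi> (v T) (v T) \<le> 0"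
    using energy_decay[OF T D, of 0 \<pi>] dirichlet_nonneg[OF G s] by (simp add: pi_inner_def)
  then have "pi_inner \<pi> (v T) (v T) = 0"
    using pi_inner_self_nonneg[of \<pi> "v T", OF less_imp_le[OF pos]] by simp
  then have flow: "(\<Sum>y\<in>UNIV. transition G T x y * f y) = exp (- c * T) * f x" for x
    using pi_inner_self_eq_0[where \<pi> = \<pi> and f = "v T" and x = x, OF pos] by (simp add: v_def)
  have "Max (range (\<lambda>x. \<bar>f x\<bar>)) \<in> range (\<lambda>x. \<bar>f x\<bar>)" by (rule Max_in) auto
  then obtain x where x: "Max (range (\<lambda>x. \<bar>f x\<bar>)) = \<bar>f x\<bar>" by (rule rangeE)
  have max: "\<bar>f y\<bar> \<le> \<bar>f x\<bar>" for y by (simp flip: x)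
  have "f x \<noteq> 0" using max[of z] f(2) by auto
  have "exp (- c * T) * \<bar>f x\<bar> = \<bar>\<Sum>y\<in>UNIV. transition G T x y * f y\<bar>"
    by (simp add: flow abs_mult)
  also have "(\<Sum>y\<in>UNIV. transition G T x y * f y) = (\<Sum>y\<in>UNIV. (transition G T x y - \<pi> y) * f y)"
    using f(1) by (simp add: mean_def left_diff_distrib right_diff_distrib sum_subtractf mult_ac)
  also have "\<bar>\<dots>\<bar> \<le> (\<Sum>y\<in>UNIV. \<bar>transition G T x y - \<pi> y\<bar> * \<bar>f x\<bar>)"
    by (rule order_trans[OF sum_abs]) (auto simp: abs_mult intro!: sum_mono mult_left_mono max)
  also have "\<dots> = 2 * tv_dist (transition G T x) \<pi> * \<bar>f x\<bar>"
    by (simp add: tv_dist_def sum_distrib_right)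
  also have "\<dots> < 2 * (1 / 4) * \<bar>f x\<bar>"
    using mixed[of x] \<open>f x \<noteq> 0\<close> by (intro mult_strict_right_mono mult_strict_left_mono) auto
  finally show ?thesis using \<open>f x \<noteq> 0\<close> by simp
qed

text \<open>
  The Dirichlet form attains its minimum on the compact set of normalised functions of mean zero. The
  first variation at the minimiser shows that it is an eigenfunction. The function \<open>f0\<close> excludes a
  one-point space, on which there is nothing to normalise.
\<close>

lemma spectral_gap_attained:
  fixes G :: "'a::finite \<Rightarrow> 'a \<Rightarrow> real"
  assumes G: "markov_generator G" "reversible G \<pi>" "stationary G \<pi>" and pos: "\<And>x. 0 < \<pi> x"
    and ex: "mean \<pi> f0 = 0" "f0 z0 \<noteq> 0"
  obtains f c z where "mean \<pi> f = 0" "f z \<noteq> 0" "\<And>x. gen_app G f x = - c * f x"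
    "\<And>g. mean \<pi> g = 0 \<Longrightarrow> c * pi_inner \<pi> g g \<le> dirichlet \<pi> G g"
proof -
  have cmult: "dirichlet \<pi> G (\<lambda>x. a * g x) = a\<^sup>2 * dirichlet \<pi> G g"
      "pi_inner \<pi> (\<lambda>x. a * g x) (\<lambda>x. a * g x) = a\<^sup>2 * pi_inner \<pi> g g"
      "mean \<pi> (\<lambda>x. a * g x) = a * mean \<pi> g" for a g
    by (simp_all add: dirichlet_def pi_inner_def mean_def gen_app_def sum_distrib_left
        sum_distrib_right power2_eq_square mult_ac)
  have nth_lambda: "vec_nth (vec_lambda h) = h" for h :: "'a \<Rightarrow> real"
    by (rule ext) simp
  define S where "S = {v :: real ^ 'a. mean \<pi> (\<lambda>x. v $ x) = 0 \<and> pi_inner \<pi> (\<lambda>x. v $ x) (\<lambda>x. v $ x) = 1}"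
  have norm_pos: "0 < pi_inner \<pi> g g" if "g x \<noteq> 0" for g :: "'a \<Rightarrow> real" and x
    using pi_inner_self_eq_0[where \<pi> = \<pi> and f = g and x = x, OF pos] pi_inner_self_nonneg[of \<pi> g, OF less_imp_le[OF pos]] that
    by linarith
  have normalized: "(\<chi> x. inverse (sqrt (pi_inner \<pi> g g)) * g x) \<in> S" if "mean \<pi> g = 0" "g x \<noteq> 0" for g x
    using norm_pos[of g x, OF that(2)] that(1) by (simp add: S_def nth_lambda cmult power_inverse)
  have "compact S"
  proof (subst compact_eq_bounded_closed, intro conjI)
    have "norm v \<le> (\<Sum>x\<in>UNIV. 1 / sqrt (\<pi> x))" if v: "v \<in> S" for v
    proof -
      have "\<bar>v $ x\<bar> \<le> 1 / sqrt (\<pi> x)" for x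
      proof -
        have "v $ x * v $ x * \<pi> x \<le> pi_inner \<pi> (\<lambda>x. v $ x) (\<lambda>x. v $ x)"
          unfolding pi_inner_def
          by (intro member_le_sum mult_nonneg_nonneg[OF zero_le_square] less_imp_le[OF pos]) simp_all
        also have "v $ x * v $ x * \<pi> x = (\<bar>v $ x\<bar> * sqrt (\<pi> x))\<^sup>2"
          by (simp only: power_mult_distrib power2_abs real_sqrt_pow2[OF less_imp_le[OF pos]])
             (simp only: power2_eq_square)
        finally have "(\<bar>v $ x\<bar> * sqrt (\<pi> x))\<^sup>2 \<le> 1\<^sup>2"
          using v by (simp add: S_def)
        then have "\<bar>v $ x\<bar> * sqrt (\<pi> x) \<le> 1" by (rule power2_le_imp_le) simp
        then show ?thesis using pos[of x] by (simp add: field_simps)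
      qed
      then show ?thesis by (intro order_trans[OF norm_le_l1_cart] sum_mono)
    qed
    then show "bounded S" by (auto simp: bounded_iff)
    show "closed S"
      unfolding S_def mean_def pi_inner_def
      by (intro closed_Collect_conj closed_Collect_eq continuous_intros)
  qed
  moreover have "S \<noteq> {}" using normalized[OF ex] by blast
  moreover have "continuous_on S (\<lambda>v. dirichlet \<pi> G (\<lambda>x. v $ x))"
    unfolding dirichlet_def pi_inner_def gen_app_def by (intro continuous_intros)
  ultimately have "\<exists>v\<in>S. \<forall>w\<in>S. dirichlet \<pi> G (\<lambda>x. v $ x) \<le> dirichlet \<pi> G (\<lambda>x. w $ x)"
    by (rule continuous_attains_inf)
  then obtain v where v: "v \<in> S"
    and min: "\<And>w. w \<in> S \<Longrightarrow> dirichlet \<pi> G (\<lambda>x. v $ x) \<le> dirichlet \<pi> G (\<lambda>x. w $ x)"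
    by (elim bexE) simp
  define f where "f = (\<lambda>x. v $ x)"
  define c where "c = dirichlet \<pi> G f"
  have f: "mean \<pi> f = 0" "pi_inner \<pi> f f = 1" using v by (auto simp: S_def f_def)
  have gap: "c * pi_inner \<pi> g g \<le> dirichlet \<pi> G g" if g: "mean \<pi> g = 0" for g
  proof (cases "\<exists>x. g x \<noteq> 0")
    case True
    then obtain x where x: "g x \<noteq> 0" by blast
    let ?n = "pi_inner \<pi> g g"
    have "c \<le> (inverse (sqrt ?n))\<^sup>2 * dirichlet \<pi> G g"
      using min[OF normalized[OF g x]] by (simp add: c_def f_def nth_lambda cmult)
    then show ?thesis
      using norm_pos[of g x, OF x] by (simp add: power_inverse field_simps)
  next
    case False
    then have "g = (\<lambda>x. 0)" by auto
    then show ?thesis by (simp add: dirichlet_def pi_inner_def)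
  qed
  \<comment> \<open>First variation at the minimiser in the direction of the defect \<open>r\<close> of the eigenvalue equation.\<close>
  define r where "r = (\<lambda>x. - gen_app G f x - c * f x)"
  have mean_r: "mean \<pi> r = 0"
  proof -
    have "mean \<pi> r = - mean \<pi> (gen_app G f) - c * mean \<pi> f"
      by (simp add: mean_def r_def left_diff_distrib right_diff_distrib sum_subtractf sum_negf sum_distrib_left mult_ac)
    then show ?thesis by (simp add: mean_gen_app[OF G(3)] f)
  qed
  define b where "b = pi_inner \<pi> r r"
  define d where "d = dirichlet \<pi> G r - c * b"
  have quad: "0 \<le> 2 * a * b + a\<^sup>2 * d" for a
  proof -
    let ?g = "\<lambda>x. f x + a * r x"
    have "mean \<pi> ?g = mean \<pi> f + a * mean \<pi> r"
      by (simp add: mean_def distrib_right distrib_left sum.distrib sum_distrib_left mult_ac)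
    then have ineq: "c * pi_inner \<pi> ?g ?g \<le> dirichlet \<pi> G ?g"
      by (intro gap) (simp add: f mean_r)
    have eq1: "pi_inner \<pi> ?g ?g = 1 + 2 * a * pi_inner \<pi> f r + a\<^sup>2 * b"
      by (simp add: pi_inner_add_left pi_inner_add_right pi_inner_cmult_left pi_inner_cmult_right
          f b_def pi_inner_commute[of \<pi> r f] power2_eq_square algebra_simps)
    have eq2: "dirichlet \<pi> G ?g = c - 2 * a * pi_inner \<pi> (gen_app G f) r + a\<^sup>2 * dirichlet \<pi> G r"
    proof -
      have "pi_inner \<pi> (gen_app G r) f = pi_inner \<pi> (gen_app G f) r"
        using reversible_pi_inner[OF G(2)] by (simp add: pi_inner_commute)
      then show ?thesis
        by (simp only: c_def dirichlet_def gen_app_add gen_app_cmult pi_inner_minus_left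
            pi_inner_add_left pi_inner_add_right pi_inner_cmult_left pi_inner_cmult_right)
           (simp add: power2_eq_square algebra_simps)
    qed
    have b: "b = - pi_inner \<pi> (gen_app G f) r - c * pi_inner \<pi> f r"
    proof -
      have "b = pi_inner \<pi> (\<lambda>x. - gen_app G f x - c * f x) r" by (simp add: b_def r_def)
      then show ?thesis by (simp add: pi_inner_diff_left pi_inner_minus_left pi_inner_cmult_left)
    qed
    have "2 * a * b = 2 * a * (- pi_inner \<pi> (gen_app G f) r - c * pi_inner \<pi> f r)"
      by (simp only: b)
    then show ?thesis
      using ineq unfolding eq1 eq2 by (simp add: d_def algebra_simps)
  qed
  have "b = 0"
  proof (rule ccontr)
    assume "b \<noteq> 0"
    moreover have "0 \<le> b" unfolding b_def by (rule pi_inner_self_nonneg) (simp add: pos less_imp_le)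
    ultimately have b: "0 < b" by simp
    \<comment> \<open>For \<open>a < 0\<close> close to \<open>0\<close> the linear term wins; this \<open>a\<close> is chosen so that \<open>\<bar>a * d\<bar> < b\<close>.\<close>
    define a where "a = - b / (\<bar>d\<bar> + b)"
    have "a < 0" "(\<bar>d\<bar> + b) * a = - b"
      using b by (auto simp: a_def divide_neg_pos)
    have "- (a * d) \<le> - a * \<bar>d\<bar>"
      using \<open>a < 0\<close> mult_left_mono_neg[of d "\<bar>d\<bar>" a] by simp
    also have "- a * \<bar>d\<bar> = b + a * b" using \<open>(\<bar>d\<bar> + b) * a = - b\<close> by (simp add: algebra_simps)
    also have "\<dots> < b" using \<open>a < 0\<close> b by (simp add: mult_neg_pos)
    finally have "0 < 2 * b + a * d" using b by linarith
    then have "2 * a * b + a\<^sup>2 * d < 0"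
      using mult_neg_pos[OF \<open>a < 0\<close>, of "2 * b + a * d"] by (simp add: power2_eq_square algebra_simps)
    with quad[of a] show False by simp
  qed
  then have "gen_app G f x = - c * f x" for x
    using pi_inner_self_eq_0[where \<pi> = \<pi> and f = r and x = x, OF pos] by (simp add: b_def r_def)
  moreover obtain z where "f z \<noteq> 0"
  proof (rule ccontr)
    assume "\<not> thesis"
    then have "f = (\<lambda>x. 0)" using that by blast
    with f(2) show False by (simp add: pi_inner_def)
  qed
  ultimately show ?thesis using that f(1) gap by blast
qed

lemma SUP_finite_less_iff:
  fixes f :: "'a::finite \<Rightarrow> real"
  shows "(SUP x. f x) < a \<longleftrightarrow> (\<forall>x. f x < a)"
  by (subst finite_Sup_less_iff) auto

text \<open>
  The constant is positive so that the strict bound \<open>exp (- c t) < 1/2\<close> survives raising to this power.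
  The double sum is at least twice the bound that \<open>transition_deviation_decay\<close> gives for the total
  variation distance, without the exponential factor.
\<close>

definition mixing_constant :: "('a::finite \<Rightarrow> real) \<Rightarrow> nat" where
  "mixing_constant \<pi> = (SOME n. 0 < n \<and> 2 * (\<Sum>x\<in>(UNIV :: 'a set). \<Sum>y\<in>(UNIV :: 'a set). 1 / sqrt (\<pi> x)) < 2 ^ n)"

lemma mixing_constant:
  fixes \<pi> :: "'a::finite \<Rightarrow> real"
  shows "0 < mixing_constant \<pi>"
    "2 * (\<Sum>x\<in>(UNIV :: 'a set). \<Sum>y\<in>(UNIV :: 'a set). 1 / sqrt (\<pi> x)) < 2 ^ mixing_constant \<pi>"
proof -
  let ?B = "2 * (\<Sum>x\<in>(UNIV :: 'a set). \<Sum>y\<in>(UNIV :: 'a set). 1 / sqrt (\<pi> x))"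
  obtain n where "?B < 2 ^ n" using real_arch_pow[of 2 ?B] by auto
  also have "(2::real) ^ n \<le> 2 ^ Suc n" by simp
  finally have "\<exists>n. 0 < n \<and> ?B < 2 ^ n" by blast
  from someI_ex[OF this] show "0 < mixing_constant \<pi>" "?B < 2 ^ mixing_constant \<pi>"
    by (auto simp: mixing_constant_def)
qed

context form_comparison
begin

text \<open>
  A mixed chain \<open>K\<close> has \<open>exp (- c t) < 1/2\<close> for its spectral gap \<open>c\<close>, which is also a lower bound for the
  gap of \<open>L\<close>. At \<open>n\<close> times the time, the factor \<open>exp (- c t)^n < (1/2)^n\<close> outweighs the constant in the
  decay estimate.
\<close>

lemma mixing_transfer:
  assumes t: "0 \<le> t" and mixed: "\<And>x. tv_dist (transition K t x) \<pi> < 1 / 4"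
  shows "tv_dist (transition L (real (mixing_constant \<pi>) * t) x) \<pi> < 1 / 4"
proof -
  let ?C = "mixing_constant \<pi>"
  let ?T = "real ?C * t"
  have T: "0 \<le> ?T" using t by simp
  show ?thesis
  proof (cases "\<exists>f z. mean \<pi> f = 0 \<and> f z \<noteq> 0")
    case True
    then obtain f0 z0 where "mean \<pi> f0 = 0" "f0 z0 \<noteq> 0" by blast
    then obtain f c z where f: "mean \<pi> f = 0" "f z \<noteq> 0" "\<And>x. gen_app K f x = - c * f x"
      and gap: "\<And>g. mean \<pi> g = 0 \<Longrightarrow> c * pi_inner \<pi> g g \<le> dirichlet \<pi> K g"
      by (rule spectral_gap_attained[OF gen_K rev_K stat_K pi_pos]) blast
    have half: "exp (- c * t) < 1 / 2"
      by (rule eigenfunction_contraction[OF gen_K stat_K pi_pos f t mixed])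
    have gap_L: "c * pi_inner \<pi> g g \<le> dirichlet \<pi> L g" if "mean \<pi> g = 0" for g
      using gap[OF that] form_le[of g] by simp
    have "exp (- c * ?T) = exp (- c * t) ^ ?C"
      by (simp add: exp_of_nat_mult[symmetric] mult_ac)
    also have "\<dots> < (1 / 2) ^ ?C"
      using half mixing_constant(1)[of \<pi>] by (intro power_strict_mono) auto
    finally have E: "exp (- c * ?T) < (1 / 2) ^ ?C" .
    let ?B = "\<Sum>x\<in>(UNIV :: 'a set). \<Sum>y\<in>(UNIV :: 'a set). 1 / sqrt (\<pi> x)"
    have "tv_dist (transition L ?T x) \<pi> \<le> (\<Sum>y\<in>(UNIV :: 'a set). exp (- c * ?T) / sqrt (\<pi> x)) / 2"
      unfolding tv_dist_def
      by (intro divide_right_mono sum_mono transition_deviation_decay(2)[OF gen_L stat_L pi_pos T gap_L]) auto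
    also have "\<dots> = exp (- c * ?T) * (\<Sum>y\<in>(UNIV :: 'a set). 1 / sqrt (\<pi> x)) / 2"
      by simp
    also have "\<dots> \<le> exp (- c * ?T) * ?B / 2"
      using pi_nonneg
      by (intro divide_right_mono mult_left_mono member_le_sum[where f = "\<lambda>x. \<Sum>y\<in>(UNIV :: 'a set). 1 / sqrt (\<pi> x)"])
         (auto intro!: sum_nonneg)
    also have "\<dots> \<le> (1 / 2) ^ ?C * ?B / 2"
      using E pi_nonneg by (intro divide_right_mono mult_right_mono sum_nonneg) auto
    also have "\<dots> < 1 / 4"
      using mixing_constant(2)[of \<pi>] by (simp add: power_divide field_simps)
    finally show ?thesis .
  next
    case False
    \<comment> \<open>On a one-point space every function of mean zero vanishes.\<close>
    have "transition L ?T x y = \<pi> y" for y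
      using False transition_deviation_decay(1)[OF gen_L stat_L pi_pos T, of 0 y]
        dirichlet_nonneg[OF gen_L stat_L]
      by (metis (no_types, lifting) eq_iff_diff_eq_0 mult_zero_left)
    then show ?thesis by (simp add: tv_dist_def)
  qed
qed

lemma t_mix_le: "t_mix L \<pi> (1/4) \<le> ennreal (real (mixing_constant \<pi>)) * t_mix K \<pi> (1/4)"
proof -
  let ?C = "real (mixing_constant \<pi>)"
  have C: "0 < ?C" using mixing_constant(1)[of \<pi>] by simp
  have "ennreal (1 / ?C) * t_mix L \<pi> (1/4) \<le> t_mix K \<pi> (1/4)"
    unfolding t_mix_def[of K]
  proof (rule INF_greatest)
    fix t assume "t \<in> {t. 0 \<le> t \<and> (SUP x. tv_dist (transition K t x) \<pi>) < 1/4}"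
    then have t: "0 \<le> t" "\<And>x. tv_dist (transition K t x) \<pi> < 1/4"
      by (simp_all only: mem_Collect_eq SUP_finite_less_iff)
    have "t_mix L \<pi> (1/4) \<le> ennreal (?C * t)"
      unfolding t_mix_def
      by (rule INF_lower)
         (use t mixing_transfer in \<open>simp only: mem_Collect_eq SUP_finite_less_iff, simp\<close>)
    then have "ennreal (1 / ?C) * t_mix L \<pi> (1/4) \<le> ennreal (1 / ?C) * ennreal (?C * t)"
      by (rule mult_left_mono) simp
    also have "\<dots> = ennreal t"
      using C t(1) by (simp flip: ennreal_mult)
    finally show "ennreal (1 / ?C) * t_mix L \<pi> (1/4) \<le> ennreal t" .
  qed
  then have "ennreal ?C * (ennreal (1 / ?C) * t_mix L \<pi> (1/4)) \<le> ennreal ?C * t_mix K \<pi> (1/4)"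
    by (rule mult_left_mono) simp
  moreover have "ennreal ?C * (ennreal (1 / ?C) * t_mix L \<pi> (1/4)) = t_mix L \<pi> (1/4)"
    using C by (simp add: mult.assoc[symmetric] flip: ennreal_mult)
  ultimately show ?thesis by simp
qed

end

section \<open>The two Metropolis-Hastings generators\<close>

lemma min_le_average: "min a b \<le> (a + b) / (2::real)"
  by (simp add: min_def)

lemma average_le_max: "(a + b) / (2::real) \<le> max a b"
  by (simp add: max_def)

context
  fixes \<pi> :: "'a::finite \<Rightarrow> real" and Q :: "'a \<Rightarrow> 'a \<Rightarrow> real"
  assumes gen: "markov_generator Q" and irr: "irreducible_generator Q" and stat: "stationary Q \<pi>"
begin

lemma target_pos: "0 < \<pi> x"
  by (rule stationary_pos[OF gen irr stat])

lemma irreducible_mono: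
  assumes "\<And>x y. x \<noteq> y \<Longrightarrow> 0 < Q x y \<Longrightarrow> 0 < G x y"
  shows "irreducible_generator G"
  unfolding irreducible_generator_def
proof (intro allI)
  fix x y
  have "{(u, v). u \<noteq> v \<and> 0 < Q u v} \<subseteq> {(u, v). u \<noteq> v \<and> 0 < G u v}"
    using assms by auto
  then show "(x, y) \<in> {(u, v). u \<noteq> v \<and> 0 < G u v}\<^sup>*"
    using irr rtrancl_mono unfolding irreducible_generator_def by blast
qed

lemma Q_nonneg: "x \<noteq> y \<Longrightarrow> 0 \<le> Q x y"
  using gen by (simp add: markov_generator_def)

lemma reversed_nonneg: "x \<noteq> y \<Longrightarrow> 0 \<le> \<pi> y / \<pi> x * Q y x"
  using Q_nonneg[of y x] target_pos by (simp add: less_imp_le)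

lemma generator_MH1: "markov_generator (MH1 Q \<pi>)"
  unfolding markov_generator_def
proof (intro conjI allI impI)
  fix x
  have "(\<Sum>y\<in>UNIV. MH1 Q \<pi> x y) = MH1 Q \<pi> x x + (\<Sum>y\<in>UNIV - {x}. MH1 Q \<pi> x y)"
    by (rule sum.remove) auto
  also have "(\<Sum>y\<in>UNIV - {x}. MH1 Q \<pi> x y) = (\<Sum>y\<in>UNIV - {x}. min (Q x y) (\<pi> y / \<pi> x * Q y x))"
    by (rule sum.cong) (auto simp: MH1_def)
  finally show "(\<Sum>y\<in>UNIV. MH1 Q \<pi> x y) = 0" by (simp add: MH1_def)
qed (use Q_nonneg reversed_nonneg in \<open>simp add: MH1_def\<close>)

lemma generator_MH2: "markov_generator (MH2 Q \<pi>)"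
  unfolding markov_generator_def
proof (intro conjI allI impI)
  fix x
  have "(\<Sum>y\<in>UNIV. MH2 Q \<pi> x y) = MH2 Q \<pi> x x + (\<Sum>y\<in>UNIV - {x}. MH2 Q \<pi> x y)"
    by (rule sum.remove) auto
  also have "(\<Sum>y\<in>UNIV - {x}. MH2 Q \<pi> x y) = (\<Sum>y\<in>UNIV - {x}. max (Q x y) (\<pi> y / \<pi> x * Q y x))"
    by (rule sum.cong) (auto simp: MH2_def)
  finally show "(\<Sum>y\<in>UNIV. MH2 Q \<pi> x y) = 0" by (simp add: MH2_def)
qed (use Q_nonneg in \<open>simp add: MH2_def le_max_iff_disj\<close>)

lemma generator_additive_rev: "markov_generator (additive_rev Q \<pi>)"
  unfolding markov_generator_def
proof (intro conjI allI impI)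
  fix x y :: 'a assume "x \<noteq> y"
  then show "0 \<le> additive_rev Q \<pi> x y"
    using Q_nonneg[of x y] reversed_nonneg[of x y] by (simp add: additive_rev_def time_reversal_def)
next
  fix x
  have "(\<Sum>y\<in>UNIV. additive_rev Q \<pi> x y) =
      ((\<Sum>y\<in>UNIV. Q x y) + (\<Sum>y\<in>UNIV. \<pi> y * Q y x) / \<pi> x) / 2"
    by (simp add: additive_rev_def time_reversal_def sum_divide_distrib[symmetric] sum.distrib)
  then show "(\<Sum>y\<in>UNIV. additive_rev Q \<pi> x y) = 0"
    using gen stat by (simp add: markov_generator_def stationary_def)
qed

lemma reversible_MH1: "reversible (MH1 Q \<pi>) \<pi>"
  unfolding reversible_def
proof (intro allI)
  fix x y
  show "\<pi> x * MH1 Q \<pi> x y = \<pi> y * MH1 Q \<pi> y x"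
    using target_pos[of x] target_pos[of y]
    by (cases "x = y") (simp_all add: MH1_def min_mult_distrib_left min.commute)
qed

lemma reversible_MH2: "reversible (MH2 Q \<pi>) \<pi>"
  unfolding reversible_def
proof (intro allI)
  fix x y
  show "\<pi> x * MH2 Q \<pi> x y = \<pi> y * MH2 Q \<pi> y x"
    using target_pos[of x] target_pos[of y]
    by (cases "x = y") (simp_all add: MH2_def max_mult_distrib_left max.commute)
qed

lemma reversible_additive_rev: "reversible (additive_rev Q \<pi>) \<pi>"
  unfolding reversible_def
proof (intro allI)
  fix x y
  show "\<pi> x * additive_rev Q \<pi> x y = \<pi> y * additive_rev Q \<pi> y x"
    using target_pos[of x] target_pos[of y]
    by (simp add: additive_rev_def time_reversal_def field_simps)
qed

text \<open>The quadratic form of an operator is that of its symmetric part.\<close>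

lemma dirichlet_additive_rev: "dirichlet \<pi> (additive_rev Q \<pi>) f = dirichlet \<pi> Q f"
proof -
  have "pi_inner \<pi> (gen_app (additive_rev Q \<pi>) f) f =
      (\<Sum>x\<in>UNIV. \<Sum>y\<in>UNIV. (\<pi> x * Q x y * f x * f y + \<pi> y * Q y x * f x * f y) / 2)"
    unfolding pi_inner_def gen_app_def sum_distrib_right
    by (intro sum.cong refl)
       (use target_pos in \<open>simp add: additive_rev_def time_reversal_def field_simps less_imp_neq[symmetric]\<close>)
  also have "\<dots> = ((\<Sum>x\<in>UNIV. \<Sum>y\<in>UNIV. \<pi> x * Q x y * f x * f y) +
      (\<Sum>x\<in>UNIV. \<Sum>y\<in>UNIV. \<pi> y * Q y x * f x * f y)) / 2"
    by (simp add: sum.distrib sum_divide_distrib[symmetric])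
  also have "(\<Sum>x\<in>UNIV. \<Sum>y\<in>UNIV. \<pi> y * Q y x * f x * f y) = (\<Sum>y\<in>UNIV. \<Sum>x\<in>UNIV. \<pi> y * Q y x * f x * f y)"
    by (rule sum.swap)
  also have "\<dots> = (\<Sum>x\<in>UNIV. \<Sum>y\<in>UNIV. \<pi> x * Q x y * f x * f y)"
    by (simp add: mult_ac)
  also have "((\<Sum>x\<in>UNIV. \<Sum>y\<in>UNIV. \<pi> x * Q x y * f x * f y) +
      (\<Sum>x\<in>UNIV. \<Sum>y\<in>UNIV. \<pi> x * Q x y * f x * f y)) / 2 = pi_inner \<pi> (gen_app Q f) f"
    by (simp add: pi_inner_def gen_app_def sum_distrib_right sum_distrib_left mult_ac)
  finally show ?thesis by (simp add: dirichlet_def pi_inner_minus_left)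
qed

lemma stationary_of_reversible: "markov_generator G \<Longrightarrow> reversible G \<pi> \<Longrightarrow> stationary G \<pi>"
  using reversible_stationary stat by (auto simp: stationary_def)

lemma irreducible_additive_rev: "irreducible_generator (additive_rev Q \<pi>)"
proof (rule irreducible_mono)
  fix x y assume "x \<noteq> y" "0 < Q x y"
  then show "0 < additive_rev Q \<pi> x y"
    using reversed_nonneg[of x y] by (simp add: additive_rev_def time_reversal_def)
qed

lemma irreducible_MH2: "irreducible_generator (MH2 Q \<pi>)"
  by (rule irreducible_mono) (simp add: MH2_def less_max_iff_disj)

lemma comparison_MH1: "form_comparison \<pi> (MH1 Q \<pi>) (additive_rev Q \<pi>)"
proof
  fix f
  show "dirichlet \<pi> (MH1 Q \<pi>) f \<le> dirichlet \<pi> (additive_rev Q \<pi>) f"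
  proof (rule dirichlet_mono)
    fix x y :: 'a assume "x \<noteq> y"
    then show "MH1 Q \<pi> x y \<le> additive_rev Q \<pi> x y"
      using min_le_average[of "Q x y" "\<pi> y / \<pi> x * Q y x"]
      by (simp add: MH1_def additive_rev_def time_reversal_def)
  qed (auto intro: stationary_of_reversible generator_MH1 reversible_MH1
      generator_additive_rev reversible_additive_rev)
qed (auto intro: stationary_of_reversible generator_MH1 reversible_MH1
      generator_additive_rev reversible_additive_rev irreducible_additive_rev)

lemma comparison_MH2: "form_comparison \<pi> (additive_rev Q \<pi>) (MH2 Q \<pi>)"
proof
  fix f
  show "dirichlet \<pi> (additive_rev Q \<pi>) f \<le> dirichlet \<pi> (MH2 Q \<pi>) f"
  proof (rule dirichlet_mono)
    fix x y :: 'a assume "x \<noteq> y"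
    then show "additive_rev Q \<pi> x y \<le> MH2 Q \<pi> x y"
      using average_le_max[of "Q x y" "\<pi> y / \<pi> x * Q y x"]
      by (simp add: MH2_def additive_rev_def time_reversal_def)
  qed (auto intro: stationary_of_reversible generator_MH2 reversible_MH2
      generator_additive_rev reversible_additive_rev)
qed (auto intro: stationary_of_reversible generator_MH2 reversible_MH2
      generator_additive_rev reversible_additive_rev irreducible_MH2)

lemma comparison_proposal: "form_comparison \<pi> (additive_rev Q \<pi>) Q"
  by standard (auto intro: gen irr stat generator_additive_rev reversible_additive_rev
      simp: dirichlet_additive_rev)

end

theorem theorem4p2:
  fixes \<pi> :: "'a::finite \<Rightarrow> real"
  shows "\<exists>C1 C2 :: real. 0 < C1 \<and> 0 < C2 \<and>
    (\<forall>Q :: 'a \<Rightarrow> 'a \<Rightarrow> real.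
      markov_generator Q \<and> irreducible_generator Q \<and> stationary Q \<pi> \<longrightarrow>
      (let M1 = MH1 Q \<pi>; M2 = MH2 Q \<pi>; Qb = additive_rev Q \<pi> in
        (\<forall>l A. 0 < l \<longrightarrow>
           laplace_hitting l A M1 \<pi> \<le> laplace_hitting l A Qb \<pi> \<and>
           laplace_hitting l A Qb \<pi> \<le> min (laplace_hitting l A Q \<pi>) (laplace_hitting l A M2 \<pi>))
      \<and> (\<forall>A. mean_hitting A M1 \<pi> \<ge> mean_hitting A Qb \<pi> \<and>
           mean_hitting A Qb \<pi> \<ge> max (mean_hitting A Q \<pi>) (mean_hitting A M2 \<pi>))
      \<and> (t_av M1 \<pi> \<ge> t_av Qb \<pi> \<and> t_av Qb \<pi> \<ge> max (t_av Q \<pi>) (t_av M2 \<pi>))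
      \<and> (t_mix M2 \<pi> (1/4) \<le> ennreal C1 * t_mix Qb \<pi> (1/4) \<and>
           ennreal C1 * t_mix Qb \<pi> (1/4) \<le> ennreal C2 * t_mix M1 \<pi> (1/4))
      \<and> (spectral_gap M1 \<pi> \<le> spectral_gap Qb \<pi> \<and> spectral_gap Qb \<pi> \<le> spectral_gap M2 \<pi>)
      \<and> (t_rel M1 \<pi> \<ge> t_rel Qb \<pi> \<and> t_rel Qb \<pi> \<ge> t_rel M2 \<pi>)
      \<and> (\<forall>h. mean \<pi> h = 0 \<longrightarrow>
           asymptotic_variance h M1 \<pi> \<ge> asymptotic_variance h Qb \<pi> \<and>
           asymptotic_variance h Qb \<pi>
             \<ge> max (asymptotic_variance h Q \<pi>) (asymptotic_variance h M2 \<pi>))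
      \<and> (\<forall>\<nu>. prob_vector \<nu> \<longrightarrow>
           rate_function M1 \<nu> \<le> rate_function Qb \<nu> \<and>
           rate_function Qb \<nu> \<le> min (rate_function Q \<nu>) (rate_function M2 \<nu>))
      \<and> (\<forall>A B. A \<inter> B = {} \<longrightarrow>
           capacity A B M1 \<pi> \<le> capacity A B Qb \<pi> \<and>
           capacity A B Qb \<pi> \<le> min (capacity A B Q \<pi>) (capacity A B M2 \<pi>))
      \<and> (\<forall>x y. x \<noteq> y \<longrightarrow>
           (irreducible_generator M1 \<longrightarrow> t_com x y M1 \<ge> t_com x y Qb) \<and>
           t_com x y Qb \<ge> max (t_com x y Q) (t_com x y M2))))"
proof -
  let ?C = "real (mixing_constant \<pi>)"
  have C: "0 < ?C" using mixing_constant(1)[of \<pi>] by simp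
  show ?thesis
    (is "\<exists>C1 C2. 0 < C1 \<and> 0 < C2 \<and> (\<forall>Q. ?A Q \<longrightarrow> ?P C1 C2 Q)")
  proof (rule exI[of _ ?C], rule exI[of _ "?C * ?C"], intro conjI allI impI)
    show "0 < ?C" "0 < ?C * ?C" using C by auto
    fix Q :: "'a \<Rightarrow> 'a \<Rightarrow> real"
    assume Q: "markov_generator Q \<and> irreducible_generator Q \<and> stationary Q \<pi>"
    interpret one: form_comparison \<pi> "MH1 Q \<pi>" "additive_rev Q \<pi>"
      using Q by (intro comparison_MH1) auto
    interpret two: form_comparison \<pi> "additive_rev Q \<pi>" "MH2 Q \<pi>"
      using Q by (intro comparison_MH2) auto
    interpret proposal: form_comparison \<pi> "additive_rev Q \<pi>" Q
      using Q by (intro comparison_proposal) auto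
    have "ennreal ?C * t_mix (additive_rev Q \<pi>) \<pi> (1/4) \<le>
        ennreal ?C * (ennreal ?C * t_mix (MH1 Q \<pi>) \<pi> (1/4))"
      by (rule mult_left_mono[OF one.t_mix_le]) simp
    then have mix: "ennreal ?C * t_mix (additive_rev Q \<pi>) \<pi> (1/4) \<le>
        ennreal (?C * ?C) * t_mix (MH1 Q \<pi>) \<pi> (1/4)"
      by (simp only: ennreal_mult[OF less_imp_le[OF C] less_imp_le[OF C]] mult.assoc)
    show "?P ?C (?C * ?C) Q"
      unfolding Let_def
      by (intro conjI allI impI min.boundedI max.boundedI mix
          one.laplace_hitting_le two.laplace_hitting_le proposal.laplace_hitting_le
          one.mean_hitting_ge two.mean_hitting_ge proposal.mean_hitting_ge
          one.t_av_ge two.t_av_ge proposal.t_av_ge two.t_mix_le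
          one.spectral_gap_le two.spectral_gap_le one.t_rel_ge two.t_rel_ge
          one.asymptotic_variance_ge two.asymptotic_variance_ge proposal.asymptotic_variance_ge
          one.rate_function_le two.rate_function_le proposal.rate_function_le
          one.capacity_le two.capacity_le proposal.capacity_le
          one.t_com_ge two.t_com_ge[OF one.irr_L] proposal.t_com_ge[OF one.irr_L])
  qed
qed

end
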